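(* Let $M$ be a connected Riemannian manifold (without boundary) and $1<p<\infty$, $1/p+1/p'=1$. Then the pair $(\mathcal W^p(M),\mathcal W^{p'}(M))$ of dual wavelet systems $$\mathcal W^p(M)=\{P_{\Omega_x}T^p_xf^{\mathbf e}_{(j,k)}:x\in X,j\ge j_0,k\in\Gamma_j,\mathbf e\in E_j\},$$ $$\mathcal W^{p'}(M)=\{(P_{\Omega_x})^*T^{p'}_xf^{\mathbf e}_{(j,k)}:x\in X,j\ge j_0,k\in\Gamma_j,\mathbf e\in E_j\}$$ is an unconditional frame of $L^p(M)$.
   Context: Unconditional frame. For an infinite-dimensional separable Banach space $B$ with dual $B'$, a sequence $(f_j,g_j)_{j\in\mathbb N}$ with $f_j\in B$, $g_j\in B'$ is a (Schauder) frame of $B$ if $f=\sum_j\langle g_j,f\rangle f_j$ with convergence in norm for every $f\in B$; it is an unconditional frame if these series converge unconditionally. Here $L^p(M)'=L^{p'}(M)$ and $\langle f,g\rangle=\int_Mfg\,d\nu$. Local Parseval frame. $\mathcal W(m,j_0,\varepsilon)=\{f^{\mathbf e}_{(j,k)}\}$ is a fixed local Parseval frame of smoothness $m\in\mathbb N\cup\{\infty\}$, $j_0\in\mathbb N_0$, $0<\varepsilon<1/2$, defined as follows. Let $Q=(-1,1)^d$, $Q_\varepsilon=(-1-\varepsilon,1+\varepsilon)^d$, $E'=\{0,1\}^d$, $E=E'\setminus\{0\}$, $E_{j_0}=E'$, $E_j=E$ for $j>j_0$. A local Parseval frame of smoothness $m$ is a family $\{f^{\mathbf e}_{(j,k)}:j\ge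 j_0,k\in\Gamma_j,\mathbf e\in E_j\}$ together with $\Gamma_j\subset\mathbb Z^d$ and a natural number $\lambda\ge2$, where $\Gamma_j\subset\Lambda_j:=\mathbb Z^d\cap[-2^{j-1}\lambda,2^{j-1}\lambda)^d$ if $m<\infty$ and $\Gamma_j=\mathbb Z^d$ if $m=\infty$, such that, with $\rho_{j,k}(x)=2^{jd/2}\chi_{[0,1]^d}(2^j\lambda x-k)$ if $m<\infty$, and $\rho_{j,k}(x)=2^{jd/2}\chi_{[0,1]^d}(2^j\lambda x-k')$ with $k'\in\Lambda_j$, $k-k'\in2^j\lambda\mathbb Z^d$, if $m=\infty$: (a) $f^{\mathbf e}_{(j,k)}\in C^m(\mathbb R^d)$, $\operatorname{supp}f^{\mathbf e}_{(j,k)}\subset Q_\varepsilon$; (b) $\|f\|_2^2=\sum_{j,\mathbf e,k}|\langle f,f^{\mathbf e}_{(j,k)}\rangle|^2$ for $f\in L^2(\mathbb R^d)$ with $\operatorname{supp}f\subset Q$; (c) for all $s\in\mathbb R$, $0<p<\infty$, $0<q\le\infty$ with $m>\max(s,\sigma_{p,q}-s)$, $\sigma_{p,q}=d\max(1/p-1,1/q-1,0)$, and all $f\in\mathbf F^s_{p,q}(\mathbb R^d)$ (Triebel-Lizorkin space; $\mathbf F^0_{p,2}=L^p$ for $1<p<\infty$) with $\operatorname{supp}f\subset Q$: $f=\sum_{j,\mathbf e,k}\langle f,f^{\mathbf e}_{(j,k)}\rangle f^{\mathbf e}_{(j,k)}$ unconditionally in $\mathbf F^s_{p,q}$ if $q<\infty$,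 in $\mathbf F^{s-\epsilon}_{p,q}$ for every $\epsilon>0$ if $q=\infty$; and $\|f\|_{\mathbf F^s_{p,q}}\asymp\big\|\big(\sum_{j,\mathbf e,k}(2^{js}|\langle f,f^{\mathbf e}_{(j,k)}\rangle|\rho_{j,k})^q\big)^{1/q}\big\|_{L^p}$ with constants independent of $f$. Geometry. $M$ is smooth, $d$-dimensional, with Riemannian measure $\nu$. For each $x\in M$ fix $r=r(x)>0$ such that $\exp_x$ is a well-defined diffeomorphism of $B(0,r)\subset T_xM$ onto a precompact neighborhood $\Omega_x(r)$ of $x$; $\kappa=\kappa_x=i_x\circ\exp_x^{-1}$ with $i_x:T_xM\to\mathbb R^d$ a linear isometry. Put $\Omega_x:=\Omega_x(r(x)/(3\sqrt d))$. For $f$ on $B(0,3\sqrt d)\subset\mathbb R^d$, $T^p_xf(u)=(3\sqrt d/r)^{d/p}f\big(\tfrac{3\sqrt d}{r}\kappa(u)\big)|\det g_\kappa(u)|^{-1/(2p)}$, $u\in\Omega_x(r)$, where $\det g_\kappa$ is the determinant of the metric matrix in the chart $\kappa$; functions with support inside $\Omega_x(r)$ are extended by zero to $M$. Decomposition of identity. A simple $H$-operator on $M$ is $H_{\varphi,\Phi,V}f(x)=\varphi(x)f(\Phi(x))$ for $x\in V$, $0$ otherwise, with $\Phi:V\to V'$ a $C^\infty$ diffeomorphism of open subsets of $M$ and $\varphi:M\to\mathbb R$ compactly supported, $C^\infty$, $\operatorname{supp}\varphi\subset V$. $\mathcal H(M)$ is the set of finite combinations of these; $T\in\mathcal H(M)$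 is localized on an open $U$ if it is a finite combination with all $V,\Phi(V)\subset U$. $X\subset M$ is at most countable and $\{P_{\Omega_x}\}_{x\in X}$ is a smooth decomposition of identity in $L^p(M)$ subordinate to $\{\Omega_x\}_{x\in X}$, i.e.: it is locally finite (for any compact $K$ only finitely many nonzero $P_{\Omega_x}$ have $\Omega_x\cap K\ne\emptyset$); each $P_{\Omega_x}\in\mathcal H(M)$ is localized on $\Omega_x$ and is a projection on $L^p(M)$; $P_{\Omega_x}P_{\Omega_y}=0$ for $x\ne y$; $\sum_{x\in X}P_{\Omega_x}=\mathbf I$ unconditionally in the strong operator topology of $L^p(M)$; and $\big(\sum_x\|P_{\Omega_x}f\|_p^p\big)^{1/p}\asymp\|f\|_p$. Such $X$ and projections exist, and the adjoints $\{(P_{\Omega_x})^*\}_{x\in X}$ form a smooth decomposition of identity in $L^{p'}(M)$, by earlier work of the authors. *)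

theory Defs
  imports "HOL-Analysis.Analysis"
begin

text \<open>All functions, distributions and function spaces are real-valued; the pairing of functions
  is \<open>\<integral> f g\<close> without conjugation.\<close>

section \<open>Smooth functions on \<open>\<real>\<^sup>d\<close>\<close>

definition partial_deriv ::
  "'d::finite \<Rightarrow> (real^'d \<Rightarrow> 'b::real_normed_vector) \<Rightarrow> real^'d \<Rightarrow> 'b" where
  "partial_deriv i f x = frechet_derivative f (at x) (axis i 1)"

definition iter_deriv ::
  "'d::finite list \<Rightarrow> (real^'d \<Rightarrow> 'b::real_normed_vector) \<Rightarrow> real^'d \<Rightarrow> 'b" where
  "iter_deriv ds f = foldr partial_deriv ds f"

text \<open>Only meant for open \<open>S\<close>.\<close>

primrec Ck_on ::
  "nat \<Rightarrow> (real^'d::finite) set \<Rightarrow> (real^'d \<Rightarrow> 'b::real_normed_vector) \<Rightarrow> bool" where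
  "Ck_on 0 S f \<longleftrightarrow> continuous_on S f"
| "Ck_on (Suc n) S f \<longleftrightarrow> f differentiable_on S \<and> (\<forall>i. Ck_on n S (partial_deriv i f))"

definition smooth_on :: "(real^'d::finite) set \<Rightarrow> (real^'d \<Rightarrow> 'b::real_normed_vector) \<Rightarrow> bool" where
  "smooth_on S f \<longleftrightarrow> (\<forall>n. Ck_on n S f)"

definition fun_supp :: "('a::topological_space \<Rightarrow> real) \<Rightarrow> 'a set" where
  "fun_supp f = closure {x. f x \<noteq> 0}"


section \<open>Lebesgue norms and unconditional convergence\<close>

definition epowr :: "ennreal \<Rightarrow> real \<Rightarrow> ennreal" where
  "epowr a r = (if a = \<infinity> then \<infinity> else ennreal (enn2real a powr r))"

definition elp_norm :: "real \<Rightarrow> 'a measure \<Rightarrow> ('a \<Rightarrow> ennreal) \<Rightarrow> ennreal" where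
  "elp_norm p M G = epowr (\<integral>\<^sup>+ x. epowr (G x) p \<partial>M) (1 / p)"

definition Lp_norm :: "real \<Rightarrow> 'a measure \<Rightarrow> ('a \<Rightarrow> real) \<Rightarrow> ennreal" where
  "Lp_norm p M f = elp_norm p M (\<lambda>x. ennreal \<bar>f x\<bar>)"

definition Lp :: "real \<Rightarrow> 'a measure \<Rightarrow> ('a \<Rightarrow> real) set" where
  "Lp p M = {f \<in> borel_measurable M. Lp_norm p M f < \<infinity>}"

definition lq_norm :: "ennreal \<Rightarrow> 'i set \<Rightarrow> ('i \<Rightarrow> ennreal) \<Rightarrow> ennreal" where
  "lq_norm q I a = (if q = \<infinity> then (SUP i\<in>I. a i) else elp_norm (enn2real q) (count_space I) a)"

text \<open>Unconditional convergence of \<open>\<Sum>i\<in>I. a i\<close> to \<open>s\<close> in the (quasi-)norm \<open>N\<close>: convergence of the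
  net of finite partial sums. Vectors are functions on \<open>'b\<close>, compared only through \<open>N\<close>; this is used
  for \<open>L\<^sup>p\<close> functions as well as for distributions.\<close>

definition uncond_sum ::
  "(('b \<Rightarrow> real) \<Rightarrow> ennreal) \<Rightarrow> 'i set \<Rightarrow> ('i \<Rightarrow> 'b \<Rightarrow> real) \<Rightarrow> ('b \<Rightarrow> real) \<Rightarrow> bool" where
  "uncond_sum N I a s \<longleftrightarrow>
     (\<forall>e>0. \<exists>F. finite F \<and> F \<subseteq> I \<and>
        (\<forall>F'. finite F' \<and> F \<subseteq> F' \<and> F' \<subseteq> I \<longrightarrow> N (\<lambda>y. s y - (\<Sum>i\<in>F'. a i y)) < ennreal e))"

text \<open>Unconditional frame \<open>(f\<^sub>i, g\<^sub>i)\<close> of \<open>L\<^sup>p\<close>, with \<open>L\<^sup>p'\<close> as dual space.\<close>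

definition unconditional_frame_Lp ::
  "real \<Rightarrow> real \<Rightarrow> 'a measure \<Rightarrow> 'i set \<Rightarrow> ('i \<Rightarrow> 'a \<Rightarrow> real) \<Rightarrow> ('i \<Rightarrow> 'a \<Rightarrow> real) \<Rightarrow> bool" where
  "unconditional_frame_Lp p p' M I f g \<longleftrightarrow>
     countable I \<and> (\<forall>i\<in>I. f i \<in> Lp p M \<and> g i \<in> Lp p' M) \<and>
     (\<forall>h\<in>Lp p M. uncond_sum (Lp_norm p M) I (\<lambda>i y. (\<integral>x. g i x * h x \<partial>M) * f i y) h)"


section \<open>Tempered distributions and Triebel-Lizorkin spaces\<close>

definition schwartz :: "(real^'d::finite \<Rightarrow> real) set" where
  "schwartz = {f. smooth_on UNIV f \<and>
     (\<forall>N ds. \<exists>B. \<forall>x. (1 + norm x) ^ N * \<bar>iter_deriv ds f x\<bar> \<le> B)}"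

definition schwartz_norm :: "nat \<Rightarrow> (real^'d::finite \<Rightarrow> real) \<Rightarrow> real" where
  "schwartz_norm N f =
     (SUP (ds, x) \<in> {ds. length ds \<le> N} \<times> UNIV. (1 + norm x) ^ N * \<bar>iter_deriv ds f x\<bar>)"

text \<open>Values of a distribution outside \<open>schwartz\<close> are irrelevant.\<close>

definition tempered :: "((real^'d::finite \<Rightarrow> real) \<Rightarrow> real) set" where
  "tempered = {u. (\<forall>f\<in>schwartz. \<forall>g\<in>schwartz. \<forall>a. u (\<lambda>x. a * f x + g x) = a * u f + u g) \<and>
     (\<exists>N C. \<forall>f\<in>schwartz. \<bar>u f\<bar> \<le> C * schwartz_norm N f)}"

definition test_fun :: "(real^'d::finite \<Rightarrow> real) \<Rightarrow> bool" where
  "test_fun f \<longleftrightarrow> smooth_on UNIV f \<and> compact (fun_supp f)"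

definition distr_supp :: "((real^'d::finite \<Rightarrow> real) \<Rightarrow> real) \<Rightarrow> (real^'d) set" where
  "distr_supp u = - \<Union>{U. open U \<and> (\<forall>f. test_fun f \<and> fun_supp f \<subseteq> U \<longrightarrow> u f = 0)}"

text \<open>The support of a function determined only almost everywhere.\<close>

definition ess_supp :: "(real^'d::finite \<Rightarrow> real) \<Rightarrow> (real^'d) set" where
  "ess_supp h = - \<Union>{U. open U \<and> (AE x in lborel. x \<in> U \<longrightarrow> h x = 0)}"

text \<open>Pairing of a compactly supported distribution of order at most \<open>m\<close> with a compactly supported
  \<open>C\<^sup>m\<close> function, i.e. the extension of the distribution by continuity. Compactly supported elements
  of \<open>F\<^sup>s\<^sub>p\<^sub>q\<close> have such an order if \<open>m > \<sigma>\<^sub>p\<^sub>q - s\<close>.\<close>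

definition distr_pair ::
  "enat \<Rightarrow> ((real^'d::finite \<Rightarrow> real) \<Rightarrow> real) \<Rightarrow> (real^'d \<Rightarrow> real) \<Rightarrow> real" where
  "distr_pair m u g =
     (THE L. \<forall>G. (\<forall>n. test_fun (G n)) \<and> (\<exists>K. compact K \<and> (\<forall>n. fun_supp (G n) \<subseteq> K)) \<and>
        (\<forall>ds. enat (length ds) \<le> m \<longrightarrow>
           uniform_limit UNIV (\<lambda>n. iter_deriv ds (G n)) (iter_deriv ds g) sequentially) \<longrightarrow>
        (\<lambda>n. u (G n)) \<longlonglongrightarrow> L)"

definition fourier :: "(real^'d::finite \<Rightarrow> real) \<Rightarrow> real^'d \<Rightarrow> complex" where
  "fourier f \<xi> = (\<integral>x. exp (- (\<i> * complex_of_real (x \<bullet> \<xi>))) * complex_of_real (f x) \<partial>lborel)"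

text \<open>Generator of a smooth dyadic (Littlewood-Paley) resolution of unity on the Fourier side. The
  Triebel-Lizorkin space and its quasi-norm, up to equivalence, do not depend on its choice.\<close>

definition lp_kernel :: "(real^'d::finite \<Rightarrow> real) \<Rightarrow> bool" where
  "lp_kernel \<Phi> \<longleftrightarrow> \<Phi> \<in> schwartz \<and> (\<forall>\<xi>. norm \<xi> \<le> 1 \<longrightarrow> fourier \<Phi> \<xi> = 1) \<and>
     (\<forall>\<xi>. norm \<xi> \<ge> 2 \<longrightarrow> fourier \<Phi> \<xi> = 0)"

text \<open>The Fourier transform of \<open>dyadic \<Phi> j\<close> is \<open>\<Phi>^(2\<^sup>-\<^sup>j \<xi>) - \<Phi>^(2\<^sup>1\<^sup>-\<^sup>j \<xi>)\<close> for \<open>j \<ge> 1\<close>.\<close>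

definition dyadic :: "(real^'d::finite \<Rightarrow> real) \<Rightarrow> nat \<Rightarrow> real^'d \<Rightarrow> real" where
  "dyadic \<Phi> j x = (if j = 0 then \<Phi> x
     else 2 ^ (j * CARD('d)) * \<Phi> (2 ^ j *\<^sub>R x)
        - 2 ^ ((j - 1) * CARD('d)) * \<Phi> (2 ^ (j - 1) *\<^sub>R x))"

definition tl_norm ::
  "real \<Rightarrow> real \<Rightarrow> ennreal \<Rightarrow> ((real^'d::finite \<Rightarrow> real) \<Rightarrow> real) \<Rightarrow> ennreal" where
  "tl_norm s p q u =
     elp_norm p lborel (\<lambda>x. lq_norm q UNIV
       (\<lambda>j. ennreal (2 powr (real j * s) * \<bar>u (\<lambda>y. dyadic (SOME \<Phi>. lp_kernel \<Phi>) j (x - y))\<bar>)))"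

definition TL :: "real \<Rightarrow> real \<Rightarrow> ennreal \<Rightarrow> ((real^'d::finite \<Rightarrow> real) \<Rightarrow> real) set" where
  "TL s p q = {u \<in> tempered. tl_norm s p q u < \<infinity>}"


section \<open>Local Parseval frames\<close>

type_synonym 'd wavelet_index = "nat \<times> (int^'d) \<times> (nat^'d)"

definition open_cube :: "real \<Rightarrow> (real^'d::finite) set" where
  "open_cube a = {x. \<forall>i. - a < x $ i \<and> x $ i < a}"

definition zero_one :: "(nat^'d::finite) set" where
  "zero_one = {e. \<forall>i. e $ i \<in> {0, 1}}"

definition frame_indices ::
  "nat \<Rightarrow> (nat \<Rightarrow> (int^'d::finite) set) \<Rightarrow> 'd wavelet_index set" where
  "frame_indices j0 \<Gamma> = {(j, k, e). j \<ge> j0 \<and> k \<in> \<Gamma> j \<and> e \<in> zero_one \<and> (j > j0 \<longrightarrow> e \<noteq> 0)}"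

definition Lattice :: "nat \<Rightarrow> nat \<Rightarrow> (int^'d::finite) set" where
  "Lattice l j = {k. \<forall>i. - (2 ^ j * real l / 2) \<le> real_of_int (k $ i) \<and>
                        real_of_int (k $ i) < 2 ^ j * real l / 2}"

definition lattice_rep :: "nat \<Rightarrow> nat \<Rightarrow> int^'d::finite \<Rightarrow> int^'d" where
  "lattice_rep l j k = (THE k'. k' \<in> Lattice l j \<and> (\<forall>i. 2 ^ j * int l dvd k $ i - k' $ i))"

definition rho :: "enat \<Rightarrow> nat \<Rightarrow> nat \<Rightarrow> int^'d::finite \<Rightarrow> real^'d \<Rightarrow> real" where
  "rho m l j k x =
     (let k' = (if m = \<infinity> then lattice_rep l j k else k) in
       2 powr (real j * real CARD('d) / 2) *
       indicator {y. \<forall>i. 0 \<le> y $ i \<and> y $ i \<le> 1}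
         (\<chi> i. 2 ^ j * real l * x $ i - real_of_int (k' $ i)))"

definition inv_q :: "ennreal \<Rightarrow> real" where
  "inv_q q = (if q = \<infinity> then 0 else 1 / enn2real q)"

definition sigma_pq :: "nat \<Rightarrow> real \<Rightarrow> ennreal \<Rightarrow> real" where
  "sigma_pq d p q = real d * max (max (1 / p - 1) (inv_q q - 1)) 0"

definition seq_norm ::
  "enat \<Rightarrow> nat \<Rightarrow> 'd::finite wavelet_index set \<Rightarrow> real \<Rightarrow> real \<Rightarrow> ennreal \<Rightarrow>
     ('d wavelet_index \<Rightarrow> real) \<Rightarrow> ennreal" where
  "seq_norm m l I s p q a =
     elp_norm p lborel (\<lambda>x. lq_norm q I
       (\<lambda>(j, k, e). ennreal (2 powr (real j * s) * \<bar>a (j, k, e)\<bar> * rho m l j k x)))"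

text \<open>Every \<open>u \<in> V\<close> is unconditionally the sum of \<open>coef u i * w i\<close>, in each of the norms of the
  set \<open>Ns\<close>, and the norm \<open>N u\<close> is equivalent to the sequence norm \<open>sn\<close> of the coefficients.\<close>

definition frame_characterizes ::
  "('b \<Rightarrow> real) set \<Rightarrow> (('b \<Rightarrow> real) \<Rightarrow> ennreal) \<Rightarrow> (('b \<Rightarrow> real) \<Rightarrow> ennreal) set \<Rightarrow>
     (('b \<Rightarrow> real) \<Rightarrow> 'i \<Rightarrow> real) \<Rightarrow> ('i \<Rightarrow> 'b \<Rightarrow> real) \<Rightarrow> 'i set \<Rightarrow> (('i \<Rightarrow> real) \<Rightarrow> ennreal) \<Rightarrow> bool" where
  "frame_characterizes V N Ns coef w I sn \<longleftrightarrow>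
     (\<forall>u\<in>V. \<forall>N'\<in>Ns. uncond_sum N' I (\<lambda>i y. coef u i * w i y) u) \<and>
     (\<exists>c C. 0 < c \<and> 0 < C \<and> (\<forall>u\<in>V. ennreal c * N u \<le> sn (coef u) \<and>
                                      sn (coef u) \<le> ennreal C * N u))"

text \<open>The last clause is the instance \<open>s = 0\<close>, \<open>q = 2\<close>, \<open>1 < p\<close> of the preceding one under the
  identification \<open>F\<^sup>0\<^sub>p\<^sub>2 = L\<^sup>p\<close> (equivalent norms), read for functions instead of the distributions
  \<open>\<phi> \<mapsto> \<integral> h \<phi>\<close> which they represent.\<close>

definition local_Parseval_frame ::
  "enat \<Rightarrow> nat \<Rightarrow> real \<Rightarrow> nat \<Rightarrow> (nat \<Rightarrow> (int^'d::finite) set) \<Rightarrow>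
     ('d wavelet_index \<Rightarrow> real^'d \<Rightarrow> real) \<Rightarrow> bool" where
  "local_Parseval_frame m j0 \<epsilon> l \<Gamma> W \<longleftrightarrow>
     l \<ge> 2 \<and> (\<forall>j\<ge>j0. if m = \<infinity> then \<Gamma> j = UNIV else \<Gamma> j \<subseteq> Lattice l j) \<and>
     (let I = frame_indices j0 \<Gamma> in
      (\<forall>i\<in>I. (\<forall>n. enat n \<le> m \<longrightarrow> Ck_on n UNIV (W i)) \<and> fun_supp (W i) \<subseteq> open_cube (1 + \<epsilon>)) \<and>
      (\<forall>h\<in>Lp 2 lborel. ess_supp h \<subseteq> open_cube 1 \<longrightarrow>
         ((\<lambda>i. (\<integral>x. h x * W i x \<partial>lborel)\<^sup>2) has_sum (\<integral>x. (h x)\<^sup>2 \<partial>lborel)) I) \<and>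
      (\<forall>s p q. 0 < p \<and> 0 < q \<and>
         ereal (max s (sigma_pq CARD('d) p q - s)) < ereal_of_enat m \<longrightarrow>
         frame_characterizes {u \<in> TL s p q. distr_supp u \<subseteq> open_cube 1} (tl_norm s p q)
           (if q = \<infinity> then {tl_norm (s - \<delta>) p q | \<delta>. \<delta> > 0} else {tl_norm s p q})
           (\<lambda>u i. distr_pair m u (W i)) (\<lambda>i \<phi>. \<integral>x. W i x * \<phi> x \<partial>lborel)
           I (seq_norm m l I s p q)) \<and>
      (\<forall>p>1. frame_characterizes {h \<in> Lp p lborel. ess_supp h \<subseteq> open_cube 1}
           (Lp_norm p lborel) {Lp_norm p lborel} (\<lambda>h i. \<integral>x. h x * W i x \<partial>lborel) W
           I (seq_norm m l I 0 p 2)))"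


section \<open>Riemannian manifolds\<close>

text \<open>The manifold is the type \<open>'a\<close>, with a maximal smooth atlas \<open>A\<close>. A chart consists of its domain
  and its coordinate map; the values of the latter off the domain are irrelevant.\<close>

type_synonym ('a, 'd) chart = "'a set \<times> ('a \<Rightarrow> real^'d)"

abbreviation chart_inv :: "('a, 'd::finite) chart \<Rightarrow> real^'d \<Rightarrow> 'a" where
  "chart_inv c \<equiv> inv_into (fst c) (snd c)"

definition is_chart :: "('a::topological_space, 'd::finite) chart \<Rightarrow> bool" where
  "is_chart c \<longleftrightarrow> open (fst c) \<and> open (snd c ` fst c) \<and>
     homeomorphism (fst c) (snd c ` fst c) (snd c) (chart_inv c)"

definition transition :: "('a, 'd::finite) chart \<Rightarrow> ('a, 'd) chart \<Rightarrow> real^'d \<Rightarrow> real^'d" where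
  "transition c c' = snd c' \<circ> chart_inv c"

definition compatible :: "('a, 'd::finite) chart \<Rightarrow> ('a, 'd) chart \<Rightarrow> bool" where
  "compatible c c' \<longleftrightarrow> smooth_on (snd c ` (fst c \<inter> fst c')) (transition c c') \<and>
                     smooth_on (snd c' ` (fst c \<inter> fst c')) (transition c' c)"

definition smooth_structure :: "('a::topological_space, 'd::finite) chart set \<Rightarrow> bool" where
  "smooth_structure A \<longleftrightarrow> (\<forall>c\<in>A. is_chart c) \<and> (\<Union>c\<in>A. fst c) = UNIV \<and>
     (\<forall>c\<in>A. \<forall>c'\<in>A. compatible c c') \<and>
     (\<forall>c. is_chart c \<and> (\<forall>c'\<in>A. compatible c c') \<longrightarrow> c \<in> A)"

text \<open>Smooth maps between open subsets of the manifold and of Euclidean spaces.\<close>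

definition smooth_from ::
  "('a, 'd::finite) chart set \<Rightarrow> 'a set \<Rightarrow> ('a \<Rightarrow> 'b::real_normed_vector) \<Rightarrow> bool" where
  "smooth_from A V f \<longleftrightarrow> (\<forall>c\<in>A. smooth_on (snd c ` (V \<inter> fst c)) (f \<circ> chart_inv c))"

definition smooth_into ::
  "('a::topological_space, 'd::finite) chart set \<Rightarrow> (real^'d) set \<Rightarrow> (real^'d \<Rightarrow> 'a) \<Rightarrow> bool" where
  "smooth_into A S F \<longleftrightarrow> continuous_on S F \<and>
     (\<forall>c\<in>A. smooth_on {y \<in> S. F y \<in> fst c} (snd c \<circ> F))"

definition smooth_map ::
  "('a::topological_space, 'd::finite) chart set \<Rightarrow> 'a set \<Rightarrow> ('a \<Rightarrow> 'a) \<Rightarrow> bool" where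
  "smooth_map A V F \<longleftrightarrow> continuous_on V F \<and>
     (\<forall>c\<in>A. \<forall>c'\<in>A. smooth_on (snd c ` {x \<in> V \<inter> fst c. F x \<in> fst c'}) (snd c' \<circ> F \<circ> chart_inv c))"

definition manifold_diffeo ::
  "('a::topological_space, 'd::finite) chart set \<Rightarrow> 'a set \<Rightarrow> 'a set \<Rightarrow> ('a \<Rightarrow> 'a) \<Rightarrow> bool" where
  "manifold_diffeo A V V' F \<longleftrightarrow> open V \<and> open V' \<and> bij_betw F V V' \<and>
     smooth_map A V F \<and> smooth_map A V' (inv_into V F)"

text \<open>A tangent vector at \<open>x\<close> is the family of its coordinate vectors in the charts around \<open>x\<close>; these
  transform by the derivatives of the transition maps.\<close>

type_synonym ('a, 'd) tvec = "('a, 'd) chart \<Rightarrow> real^'d"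

definition tangent_space :: "('a, 'd::finite) chart set \<Rightarrow> 'a \<Rightarrow> ('a, 'd) tvec set" where
  "tangent_space A x = {v.
     (\<forall>c\<in>A. \<forall>c'\<in>A. x \<in> fst c \<inter> fst c' \<longrightarrow>
        v c' = frechet_derivative (transition c c') (at (snd c x)) (v c)) \<and>
     (\<forall>c. c \<notin> A \<or> x \<notin> fst c \<longrightarrow> v c = 0)}"

definition coord_vector ::
  "('a, 'd::finite) chart set \<Rightarrow> ('a, 'd) chart \<Rightarrow> 'a \<Rightarrow> 'd \<Rightarrow> ('a, 'd) tvec" where
  "coord_vector A c x i = (\<lambda>c'. if c' \<in> A \<and> x \<in> fst c'
     then frechet_derivative (transition c c') (at (snd c x)) (axis i 1) else 0)"

type_synonym ('a, 'd) metric = "'a \<Rightarrow> ('a, 'd) tvec \<Rightarrow> ('a, 'd) tvec \<Rightarrow> real"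

definition metric_matrix ::
  "('a, 'd::finite) chart set \<Rightarrow> ('a, 'd) metric \<Rightarrow> ('a, 'd) chart \<Rightarrow> 'a \<Rightarrow> real^'d^'d" where
  "metric_matrix A g c x = (\<chi> i j. g x (coord_vector A c x i) (coord_vector A c x j))"

definition riemannian_manifold ::
  "('a::topological_space, 'd::finite) chart set \<Rightarrow> ('a, 'd) metric \<Rightarrow> bool" where
  "riemannian_manifold A g \<longleftrightarrow> smooth_structure A \<and>
     (\<forall>x. (\<forall>u\<in>tangent_space A x. \<forall>v\<in>tangent_space A x.
              g x u v = g x v u \<and>
              (\<forall>w\<in>tangent_space A x. \<forall>a.
                 g x (\<lambda>c. a *\<^sub>R u c + v c) w = a * g x u w + g x v w)) \<and>
          (\<forall>u\<in>tangent_space A x. u \<noteq> (\<lambda>_. 0) \<longrightarrow> g x u u > 0)) \<and>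
     (\<forall>c\<in>A. \<forall>i j. smooth_from {c} (fst c) (\<lambda>x. metric_matrix A g c x $ i $ j))"

definition riemannian_measure ::
  "('a::topological_space, 'd::finite) chart set \<Rightarrow> ('a, 'd) metric \<Rightarrow> 'a measure \<Rightarrow> bool" where
  "riemannian_measure A g \<nu> \<longleftrightarrow> sets \<nu> = sets borel \<and>
     (\<forall>c\<in>A. \<forall>B\<in>sets borel. B \<subseteq> fst c \<longrightarrow>
        emeasure \<nu> B = (\<integral>\<^sup>+ y. indicator (snd c ` B) y *
          ennreal (sqrt (det (metric_matrix A g c (chart_inv c y)))) \<partial>lborel))"

subsection \<open>Geodesics and the exponential map\<close>

definition christoffel ::
  "('a, 'd::finite) chart set \<Rightarrow> ('a, 'd) metric \<Rightarrow> ('a, 'd) chart \<Rightarrow> 'a \<Rightarrow>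
     'd \<Rightarrow> 'd \<Rightarrow> 'd \<Rightarrow> real" where
  "christoffel A g c x k i j =
     (let D = (\<lambda>a b e. partial_deriv a (\<lambda>y. metric_matrix A g c (chart_inv c y) $ b $ e) (snd c x))
      in (\<Sum>n\<in>UNIV. matrix_inv (metric_matrix A g c x) $ k $ n * (D i j n + D j i n - D n i j)) / 2)"

text \<open>The geodesic equation; \<open>v\<close> is the coordinate velocity. \<open>J\<close> is an open interval.\<close>

definition geodesic_on ::
  "('a::topological_space, 'd::finite) chart set \<Rightarrow> ('a, 'd) metric \<Rightarrow> real set \<Rightarrow>
     (real \<Rightarrow> 'a) \<Rightarrow> bool" where
  "geodesic_on A g J \<gamma> \<longleftrightarrow> continuous_on J \<gamma> \<and>
     (\<forall>c\<in>A. \<exists>v. \<forall>t\<in>J. \<gamma> t \<in> fst c \<longrightarrow>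
        ((snd c \<circ> \<gamma>) has_vector_derivative v t) (at t) \<and>
        (v has_vector_derivative
           (\<chi> k. - (\<Sum>i\<in>UNIV. \<Sum>j\<in>UNIV. christoffel A g c (\<gamma> t) k i j * v t $ i * v t $ j))) (at t))"

definition velocity ::
  "('a, 'd::finite) chart set \<Rightarrow> (real \<Rightarrow> 'a) \<Rightarrow> real \<Rightarrow> ('a, 'd) tvec" where
  "velocity A \<gamma> t = (\<lambda>c. if c \<in> A \<and> \<gamma> t \<in> fst c
     then vector_derivative (snd c \<circ> \<gamma>) (at t) else 0)"

definition exp_rel ::
  "('a::topological_space, 'd::finite) chart set \<Rightarrow> ('a, 'd) metric \<Rightarrow> 'a \<Rightarrow>
     ('a, 'd) tvec \<Rightarrow> 'a \<Rightarrow> bool" where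
  "exp_rel A g x v y \<longleftrightarrow> (\<exists>J \<gamma>. open J \<and> is_interval J \<and> {0..1} \<subseteq> J \<and> geodesic_on A g J \<gamma> \<and>
     \<gamma> 0 = x \<and> velocity A \<gamma> 0 = v \<and> \<gamma> 1 = y)"

definition exp_domain ::
  "('a::topological_space, 'd::finite) chart set \<Rightarrow> ('a, 'd) metric \<Rightarrow> 'a \<Rightarrow> ('a, 'd) tvec set" where
  "exp_domain A g x = {v \<in> tangent_space A x. \<exists>y. exp_rel A g x v y}"

definition riem_exp ::
  "('a::topological_space, 'd::finite) chart set \<Rightarrow> ('a, 'd) metric \<Rightarrow> 'a \<Rightarrow> ('a, 'd) tvec \<Rightarrow> 'a" where
  "riem_exp A g x v = (THE y. exp_rel A g x v y)"

definition tangent_ball ::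
  "('a, 'd::finite) chart set \<Rightarrow> ('a, 'd) metric \<Rightarrow> 'a \<Rightarrow> real \<Rightarrow> ('a, 'd) tvec set" where
  "tangent_ball A g x r = {v \<in> tangent_space A x. sqrt (g x v v) < r}"

definition geodesic_ball ::
  "('a::topological_space, 'd::finite) chart set \<Rightarrow> ('a, 'd) metric \<Rightarrow> 'a \<Rightarrow> real \<Rightarrow> 'a set" where
  "geodesic_ball A g x r = riem_exp A g x ` tangent_ball A g x r"

definition tangent_isometry ::
  "('a, 'd::finite) chart set \<Rightarrow> ('a, 'd) metric \<Rightarrow> 'a \<Rightarrow> (('a, 'd) tvec \<Rightarrow> real^'d) \<Rightarrow> bool" where
  "tangent_isometry A g x \<iota> \<longleftrightarrow> bij_betw \<iota> (tangent_space A x) UNIV \<and>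
     (\<forall>u\<in>tangent_space A x. \<forall>v\<in>tangent_space A x.
        (\<forall>a. \<iota> (\<lambda>c. a *\<^sub>R u c + v c) = a *\<^sub>R \<iota> u + \<iota> v) \<and> \<iota> u \<bullet> \<iota> v = g x u v)"

definition normal_coords ::
  "('a::topological_space, 'd::finite) chart set \<Rightarrow> ('a, 'd) metric \<Rightarrow> 'a \<Rightarrow> real \<Rightarrow>
     (('a, 'd) tvec \<Rightarrow> real^'d) \<Rightarrow> 'a \<Rightarrow> real^'d" where
  "normal_coords A g x r \<iota> = \<iota> \<circ> inv_into (tangent_ball A g x r) (riem_exp A g x)"

text \<open>\<open>exp\<^sub>x\<close> is a well-defined diffeomorphism of the ball of radius \<open>r\<close> in the tangent space onto a
  precompact neighbourhood of \<open>x\<close>. The smooth structure of the tangent space is transported by the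
  linear isomorphism \<open>\<iota>\<close>, which does not influence it.\<close>

definition exp_diffeo_ball ::
  "('a::topological_space, 'd::finite) chart set \<Rightarrow> ('a, 'd) metric \<Rightarrow> 'a \<Rightarrow> real \<Rightarrow>
     (('a, 'd) tvec \<Rightarrow> real^'d) \<Rightarrow> bool" where
  "exp_diffeo_ball A g x r \<iota> \<longleftrightarrow> r > 0 \<and> tangent_ball A g x r \<subseteq> exp_domain A g x \<and>
     inj_on (riem_exp A g x) (tangent_ball A g x r) \<and>
     open (geodesic_ball A g x r) \<and> x \<in> geodesic_ball A g x r \<and>
     compact (closure (geodesic_ball A g x r)) \<and>
     smooth_into A (ball 0 r) (riem_exp A g x \<circ> inv_into (tangent_space A x) \<iota>) \<and>
     smooth_from A (geodesic_ball A g x r) (normal_coords A g x r \<iota>)"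

text \<open>The operator \<open>T\<^sup>p\<^sub>x\<close>, extended by zero.\<close>

definition transport ::
  "('a::topological_space, 'd::finite) chart set \<Rightarrow> ('a, 'd) metric \<Rightarrow> real \<Rightarrow> 'a \<Rightarrow> real \<Rightarrow>
     (('a, 'd) tvec \<Rightarrow> real^'d) \<Rightarrow> (real^'d \<Rightarrow> real) \<Rightarrow> 'a \<Rightarrow> real" where
  "transport A g p x r \<iota> f u =
     (let a = 3 * sqrt (real CARD('d)) / r;
          U = geodesic_ball A g x r;
          \<kappa> = normal_coords A g x r \<iota>
      in if u \<in> U
         then a powr (real CARD('d) / p) * f (a *\<^sub>R \<kappa> u) *
              \<bar>det (metric_matrix A g (U, \<kappa>) u)\<bar> powr (- 1 / (2 * p))
         else 0)"


section \<open>Smooth decompositions of identity\<close>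

definition H_operator ::
  "('a \<Rightarrow> real) \<Rightarrow> ('a \<Rightarrow> 'a) \<Rightarrow> 'a set \<Rightarrow> ('a \<Rightarrow> real) \<Rightarrow> 'a \<Rightarrow> real" where
  "H_operator \<phi> \<Phi> V f x = (if x \<in> V then \<phi> x * f (\<Phi> x) else 0)"

definition simple_H_on ::
  "('a::topological_space, 'd::finite) chart set \<Rightarrow> 'a set \<Rightarrow>
     (('a \<Rightarrow> real) \<Rightarrow> 'a \<Rightarrow> real) set" where
  "simple_H_on A U = {H_operator \<phi> \<Phi> V | \<phi> \<Phi> V V'.
     manifold_diffeo A V V' \<Phi> \<and> smooth_from A UNIV \<phi> \<and>
     compact (fun_supp \<phi>) \<and> fun_supp \<phi> \<subseteq> V \<and> V \<subseteq> U \<and> V' \<subseteq> U}"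

text \<open>\<open>H_ops_on A UNIV\<close> is \<open>\<H>(M)\<close>, and \<open>H_ops_on A U\<close> consists of the operators localized on \<open>U\<close>.\<close>

definition H_ops_on ::
  "('a::topological_space, 'd::finite) chart set \<Rightarrow> 'a set \<Rightarrow>
     (('a \<Rightarrow> real) \<Rightarrow> 'a \<Rightarrow> real) set" where
  "H_ops_on A U = {T. \<exists>n a S. (\<forall>i<n. S i \<in> simple_H_on A U) \<and>
     T = (\<lambda>f x. \<Sum>i<(n::nat). (a i :: real) * S i f x)}"

definition Lp_projection ::
  "real \<Rightarrow> 'a measure \<Rightarrow> (('a \<Rightarrow> real) \<Rightarrow> 'a \<Rightarrow> real) \<Rightarrow> bool" where
  "Lp_projection p M T \<longleftrightarrow>
     (\<exists>C. \<forall>f\<in>Lp p M. T f \<in> Lp p M \<and> Lp_norm p M (T f) \<le> ennreal C * Lp_norm p M f) \<and>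
     (\<forall>f\<in>Lp p M. AE x in M. T (T f) x = T f x)"

definition Lp_zero_op ::
  "real \<Rightarrow> 'a measure \<Rightarrow> (('a \<Rightarrow> real) \<Rightarrow> 'a \<Rightarrow> real) \<Rightarrow> bool" where
  "Lp_zero_op p M T \<longleftrightarrow> (\<forall>f\<in>Lp p M. AE x in M. T f x = 0)"

definition smooth_decomposition ::
  "('a::topological_space, 'd::finite) chart set \<Rightarrow> 'a measure \<Rightarrow> real \<Rightarrow> 'a set \<Rightarrow>
     ('a \<Rightarrow> 'a set) \<Rightarrow> ('a \<Rightarrow> ('a \<Rightarrow> real) \<Rightarrow> 'a \<Rightarrow> real) \<Rightarrow> bool" where
  "smooth_decomposition A M p X \<Omega> P \<longleftrightarrow> countable X \<and>
     (\<forall>K. compact K \<longrightarrow> finite {x \<in> X. \<not> Lp_zero_op p M (P x) \<and> \<Omega> x \<inter> K \<noteq> {}}) \<and>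
     (\<forall>x\<in>X. P x \<in> H_ops_on A (\<Omega> x) \<and> Lp_projection p M (P x)) \<and>
     (\<forall>x\<in>X. \<forall>y\<in>X. x \<noteq> y \<longrightarrow> Lp_zero_op p M (\<lambda>f. P x (P y f))) \<and>
     (\<forall>f\<in>Lp p M. uncond_sum (Lp_norm p M) X (\<lambda>x. P x f) f) \<and>
     (\<exists>c C. 0 < c \<and> 0 < C \<and> (\<forall>f\<in>Lp p M.
        ennreal c * Lp_norm p M f \<le> lq_norm (ennreal p) X (\<lambda>x. Lp_norm p M (P x f)) \<and>
        lq_norm (ennreal p) X (\<lambda>x. Lp_norm p M (P x f)) \<le> ennreal C * Lp_norm p M f))"

text \<open>\<open>T'\<close> represents the adjoint \<open>T\<^sup>*\<close> on \<open>L\<^sup>p'\<close> of the operator \<open>T\<close> on \<open>L\<^sup>p\<close>; it is determined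
  almost everywhere.\<close>

definition Lp_adjoint ::
  "real \<Rightarrow> real \<Rightarrow> 'a measure \<Rightarrow> (('a \<Rightarrow> real) \<Rightarrow> 'a \<Rightarrow> real) \<Rightarrow>
     (('a \<Rightarrow> real) \<Rightarrow> 'a \<Rightarrow> real) \<Rightarrow> bool" where
  "Lp_adjoint p p' M T T' \<longleftrightarrow> (\<forall>g\<in>Lp p' M. T' g \<in> Lp p' M) \<and>
     (\<forall>f\<in>Lp p M. \<forall>g\<in>Lp p' M. (\<integral>x. T f x * g x \<partial>M) = (\<integral>x. f x * T' g x \<partial>M))"

end

theory Submission
  imports Defs
begin

text \<open>
Why the theorem holds. Fix \<open>h\<close> in \<open>L\<^sup>p\<close> of the manifold and a point \<open>x\<close> of \<open>X\<close>. The operator \<open>P\<^sub>x\<close> is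
localized: \<open>P\<^sub>x f\<close> vanishes off a compact subset \<open>K\<close> of \<open>\<Omega>\<^sub>x\<close> and depends only on \<open>f\<close> restricted to
\<open>K\<close> (\<open>H_ops_on_props\<close>). In rescaled normal coordinates \<open>\<Omega>\<^sub>x\<close> is the unit ball, which lies in the
cube \<open>Q\<close>, and \<open>T\<^sup>p\<^sub>x\<close> is an isometry of \<open>L\<^sup>p\<close> of the ball of radius \<open>3 \<surd>d\<close> onto \<open>L\<^sup>p\<close> of the large geodesic
ball. Hence \<open>P\<^sub>x h = T\<^sup>p\<^sub>x u\<close> with \<open>u\<close> supported in a compact subset of \<open>Q\<close>, the pairing of \<open>u\<close> with
\<open>f\<^sub>i\<close> equals that of \<open>h\<close> with \<open>P\<^sub>x\<^sup>* T\<^sup>p\<^sup>'\<^sub>x f\<^sub>i\<close>, and applying \<open>P\<^sub>x T\<^sup>p\<^sub>x\<close> to the expansion of \<open>u\<close> in the local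
Parseval frame expands \<open>P\<^sub>x P\<^sub>x h = P\<^sub>x h\<close> in the functions \<open>P\<^sub>x T\<^sup>p\<^sub>x f\<^sub>i\<close>.

These expansions are glued along \<open>h = \<Sum>\<^sub>x P\<^sub>x h\<close> in \<open>uncond_sum_glue\<close>. By the equivalence of the norm of \<open>h\<close>
with the \<open>l\<^sup>p\<close>-norm of the norms of its pieces, and since \<open>P\<^sub>y P\<^sub>x = 0\<close> for \<open>y \<noteq> x\<close>, the error of a
finite partial sum is controlled by the sum over \<open>y\<close> of the \<open>p\<close>-th powers of the local errors. Finitely
many of them are made small by convergence of the local expansions; the remaining ones are bounded by a
constant times the tail of the convergent series of the \<open>p\<close>-th powers of the norms of \<open>P\<^sub>y h\<close>, provided
that the constant is uniform in \<open>y\<close> and in the partial sum.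

This uniformity is the point that needs care. The functions supported in compact subsets of the open cube
\<open>Q\<close> are not a closed subspace, so the uniform boundedness principle does not give it, and the partial
sums \<open>S\<^sub>F u\<close> leave \<open>Q\<close>. However, only the values of \<open>S\<^sub>F u\<close> on \<open>K\<close> matter, and these are estimated by
duality (\<open>psum_uniform_bound\<close>): for \<open>v\<close> in \<open>L\<^sup>p\<^sup>'\<close> supported in a compact subset of \<open>Q\<close>, the integral of
\<open>v S\<^sub>F u\<close> is \<open>\<Sum>\<^sub>i \<langle>u, f\<^sub>i\<rangle> \<langle>v, f\<^sub>i\<rangle>\<close> over \<open>F\<close>, which the inequalities of Cauchy-Schwarz and Hoelder bound by
the product of the two sequence norms, and these are dominated by the norms of \<open>u\<close> and \<open>v\<close>.

On the geometric side, normal coordinates form a chart of the maximal atlas (\<open>normal_chart\<close>), so that the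
defining property of the Riemannian measure is already the change of variables formula in these
coordinates; the metric matrix has positive determinant because it is a Gram matrix
(\<open>det_metric_matrix_pos\<close>).
\<close>

section \<open>Powers of Lebesgue norms\<close>

text \<open>The \<open>p\<close>-th power of the \<open>L\<^sup>p\<close>-norm. It is additive over disjoint pieces and avoids the exponent
  \<open>1 / p\<close>; up to the factor \<open>2 powr p\<close> it is subadditive, which replaces the triangle inequality below.\<close>

definition lp_int :: "real \<Rightarrow> 'a measure \<Rightarrow> ('a \<Rightarrow> real) \<Rightarrow> ennreal" where
  "lp_int p M f = (\<integral>\<^sup>+x. ennreal (\<bar>f x\<bar> powr p) \<partial>M)"

lemma epowr_ennreal: "0 \<le> a \<Longrightarrow> epowr (ennreal a) r = ennreal (a powr r)"
  by (simp add: epowr_def)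

lemma epowr_top: "epowr top r = top"
  by (simp add: epowr_def)

lemma epowr_epowr: "epowr (epowr a r) s = epowr a (r * s)"
  by (cases a) (simp_all add: epowr_ennreal epowr_top powr_powr)

lemma epowr_one: "epowr a 1 = a"
  by (cases a) (simp_all add: epowr_ennreal epowr_top)

lemma epowr_mono: "0 \<le> r \<Longrightarrow> a \<le> b \<Longrightarrow> epowr a r \<le> epowr b r"
  by (cases a; cases b)
    (auto simp: epowr_ennreal epowr_top top_unique intro!: ennreal_leI powr_mono2)

lemma epowr_le_iff: "0 < r \<Longrightarrow> epowr a r \<le> epowr b r \<longleftrightarrow> a \<le> b"
  using epowr_mono[of r a b] epowr_mono[of "1 / r" "epowr a r" "epowr b r"]
  by (auto simp: epowr_epowr epowr_one)

lemma epowr_less_iff: "0 < r \<Longrightarrow> epowr a r < epowr b r \<longleftrightarrow> a < b"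
  using epowr_le_iff[of r b a] by (simp add: not_le[symmetric])

lemma epowr_cmult: "0 < c \<Longrightarrow> epowr (ennreal c * a) r = ennreal (c powr r) * epowr a r"
  by (cases a) (simp_all add: epowr_ennreal epowr_top ennreal_mult[symmetric] powr_mult ennreal_mult_top)

lemma Lp_norm_eq: "Lp_norm p M f = epowr (lp_int p M f) (1 / p)"
  unfolding Lp_norm_def elp_norm_def lp_int_def by (simp add: epowr_ennreal)

lemma epowr_Lp_norm: "p > 0 \<Longrightarrow> epowr (Lp_norm p M f) p = lp_int p M f"
  by (simp add: Lp_norm_eq epowr_epowr epowr_one)

lemma Lp_norm_less_iff:
  assumes "p > 0" "e > 0"
  shows "Lp_norm p M f < ennreal e \<longleftrightarrow> lp_int p M f < ennreal (e powr p)"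
  using epowr_less_iff[of p "Lp_norm p M f" "ennreal e"] assms
  by (simp add: epowr_Lp_norm epowr_ennreal)

lemma Lp_iff: "p > 0 \<Longrightarrow> f \<in> Lp p M \<longleftrightarrow> f \<in> borel_measurable M \<and> lp_int p M f < \<infinity>"
  using epowr_less_iff[of "1 / p" "lp_int p M f" top]
  by (simp add: Lp_def Lp_norm_eq epowr_top)

lemma uncond_sum_Lp_iff:
  assumes p: "p > 0"
  shows "uncond_sum (Lp_norm p M) I a s \<longleftrightarrow>
    (\<forall>e>0. \<exists>F. finite F \<and> F \<subseteq> I \<and>
      (\<forall>F'. finite F' \<and> F \<subseteq> F' \<and> F' \<subseteq> I \<longrightarrow> lp_int p M (\<lambda>y. s y - (\<Sum>i\<in>F'. a i y)) < ennreal e))"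
    (is "_ \<longleftrightarrow> ?R")
proof
  assume L: "uncond_sum (Lp_norm p M) I a s"
  show ?R
  proof (intro allI impI)
    fix e :: real assume e: "e > 0"
    then have e': "e powr (1 / p) > 0" "(e powr (1 / p)) powr p = e"
      using p by (simp_all add: powr_powr)
    show "\<exists>F. finite F \<and> F \<subseteq> I \<and>
      (\<forall>F'. finite F' \<and> F \<subseteq> F' \<and> F' \<subseteq> I \<longrightarrow> lp_int p M (\<lambda>y. s y - (\<Sum>i\<in>F'. a i y)) < ennreal e)"
      using L[unfolded uncond_sum_def, rule_format, OF e'(1)]
      unfolding Lp_norm_less_iff[OF p e'(1)] e'(2) .
  qed
next
  assume R: ?R
  show "uncond_sum (Lp_norm p M) I a s"
    unfolding uncond_sum_def
  proof (intro allI impI)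
    fix e :: real assume e: "e > 0"
    then have e': "e powr p > 0" by simp
    show "\<exists>F. finite F \<and> F \<subseteq> I \<and>
      (\<forall>F'. finite F' \<and> F \<subseteq> F' \<and> F' \<subseteq> I \<longrightarrow> Lp_norm p M (\<lambda>y. s y - (\<Sum>i\<in>F'. a i y)) < ennreal e)"
      using R[rule_format, OF e'] by (simp add: Lp_norm_less_iff[OF p e])
  qed
qed

lemma lp_int_cong_AE: "AE x in M. f x = g x \<Longrightarrow> lp_int p M f = lp_int p M g"
  unfolding lp_int_def by (intro nn_integral_cong_AE) auto

lemma powr_add_le:
  fixes a b p :: real
  assumes "p > 0" shows "\<bar>a + b\<bar> powr p \<le> 2 powr p * (\<bar>a\<bar> powr p + \<bar>b\<bar> powr p)"
proof -
  have "\<bar>a + b\<bar> powr p \<le> (2 * max \<bar>a\<bar> \<bar>b\<bar>) powr p"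
    using assms by (intro powr_mono2) auto
  also have "\<dots> = 2 powr p * (max \<bar>a\<bar> \<bar>b\<bar>) powr p" by (simp add: powr_mult)
  also have "\<dots> \<le> 2 powr p * (\<bar>a\<bar> powr p + \<bar>b\<bar> powr p)"
    by (intro mult_left_mono) (auto simp: max_def)
  finally show ?thesis .
qed

lemma lp_int_add_le:
  assumes "p > 0" "f \<in> borel_measurable M" "g \<in> borel_measurable M"
  shows "lp_int p M (\<lambda>x. f x + g x) \<le> ennreal (2 powr p) * (lp_int p M f + lp_int p M g)"
proof -
  have "lp_int p M (\<lambda>x. f x + g x) \<le>
      (\<integral>\<^sup>+x. ennreal (2 powr p) * (ennreal (\<bar>f x\<bar> powr p) + ennreal (\<bar>g x\<bar> powr p)) \<partial>M)"
    unfolding lp_int_def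
    by (intro nn_integral_mono)
      (use powr_add_le[OF assms(1)] in \<open>simp add: ennreal_plus[symmetric] ennreal_mult[symmetric] del: ennreal_plus\<close>)
  also have "\<dots> = ennreal (2 powr p) * (lp_int p M f + lp_int p M g)"
    unfolding lp_int_def using assms(2,3)
    by (subst nn_integral_cmult) (auto simp: nn_integral_add)
  finally show ?thesis .
qed

lemma lp_int_cmult:
  assumes "f \<in> borel_measurable M"
  shows "lp_int p M (\<lambda>x. c * f x) = ennreal (\<bar>c\<bar> powr p) * lp_int p M f"
  unfolding lp_int_def using assms
  by (subst nn_integral_cmult[symmetric]) (auto simp: abs_mult powr_mult ennreal_mult)

lemma lp_int_zero: "p > 0 \<Longrightarrow> lp_int p M (\<lambda>_. 0) = 0"
  by (simp add: lp_int_def)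

lemma Lp_measurable: "f \<in> Lp p M \<Longrightarrow> f \<in> borel_measurable M"
  by (simp add: Lp_def)

lemma Lp_add: "p > 0 \<Longrightarrow> f \<in> Lp p M \<Longrightarrow> g \<in> Lp p M \<Longrightarrow> (\<lambda>x. f x + g x) \<in> Lp p M"
  using lp_int_add_le[of p f M g]
  by (auto simp: Lp_iff ennreal_mult_less_top intro: le_less_trans)

lemma Lp_cmult: "p > 0 \<Longrightarrow> f \<in> Lp p M \<Longrightarrow> (\<lambda>x. c * f x) \<in> Lp p M"
  by (auto simp: Lp_iff lp_int_cmult ennreal_mult_less_top)

lemma Lp_diff: "p > 0 \<Longrightarrow> f \<in> Lp p M \<Longrightarrow> g \<in> Lp p M \<Longrightarrow> (\<lambda>x. f x - g x) \<in> Lp p M"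
  using Lp_add[of p f M "\<lambda>x. -1 * g x"] Lp_cmult[of p g M "-1"] by simp

lemma Lp_zero: "p > 0 \<Longrightarrow> (\<lambda>_. 0) \<in> Lp p M"
  by (simp add: Lp_iff lp_int_zero)

lemma Lp_sum:
  "p > 0 \<Longrightarrow> (\<And>i. i \<in> F \<Longrightarrow> f i \<in> Lp p M) \<Longrightarrow> (\<lambda>x. \<Sum>i\<in>F. f i x) \<in> Lp p M"
  by (induction F rule: infinite_finite_induct) (auto simp: Lp_zero Lp_add)

lemma Lp_mono:
  assumes "p > 0" "f \<in> Lp p M" "g \<in> borel_measurable M" "\<And>x. \<bar>g x\<bar> \<le> \<bar>f x\<bar>"
  shows "g \<in> Lp p M"
proof -
  have "lp_int p M g \<le> lp_int p M f"
    unfolding lp_int_def using assms by (intro nn_integral_mono ennreal_leI powr_mono2) auto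
  then show ?thesis using assms by (auto simp: Lp_iff)
qed

lemma lp_int_diff_le:
  assumes "p > 0" "f \<in> borel_measurable M" "g \<in> borel_measurable M"
  shows "lp_int p M (\<lambda>x. f x - g x) \<le> ennreal (2 powr p) * (lp_int p M f + lp_int p M g)"
  using lp_int_add_le[OF assms(1,2), of "\<lambda>x. -1 * g x"] lp_int_cmult[OF assms(3), of p "-1"] assms(3)
  by simp

text \<open>Hoelder's inequality in terms of upper bounds for the \<open>p\<close>-th and \<open>q\<close>-th powers; the bounds have to be
  positive because the proof normalizes by them.\<close>

lemma Hoelder_nn_integral:
  fixes f g :: "'a \<Rightarrow> real"
  assumes pq: "1 < p" "1 < q" "1 / p + 1 / q = 1"
    and [measurable]: "f \<in> borel_measurable M" "g \<in> borel_measurable M"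
    and AB: "lp_int p M f \<le> ennreal a" "lp_int q M g \<le> ennreal b" "0 < a" "0 < b"
  shows "(\<integral>\<^sup>+x. ennreal (\<bar>f x\<bar> * \<bar>g x\<bar>) \<partial>M) \<le> ennreal (a powr (1 / p) * b powr (1 / q))"
proof -
  let ?c = "a powr (1 / p) * b powr (1 / q)"
  have c: "?c > 0" using AB by simp
  have young: "\<bar>f x\<bar> * \<bar>g x\<bar> \<le> ?c / (p * a) * \<bar>f x\<bar> powr p + ?c / (q * b) * \<bar>g x\<bar> powr q" for x
  proof -
    let ?u = "\<bar>f x\<bar> / a powr (1 / p)" and ?v = "\<bar>g x\<bar> / b powr (1 / q)"
    have "?u * ?v \<le> ?u powr p / p + ?v powr q / q"
      using pq AB by (intro Youngs_inequality) auto
    also have "?u powr p = \<bar>f x\<bar> powr p / a" using pq AB by (simp add: powr_divide powr_powr)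
    also have "?v powr q = \<bar>g x\<bar> powr q / b" using pq AB by (simp add: powr_divide powr_powr)
    finally have "?u * ?v * ?c \<le> (\<bar>f x\<bar> powr p / a / p + \<bar>g x\<bar> powr q / b / q) * ?c"
      using c by (intro mult_right_mono) auto
    moreover have "?u * ?v * ?c = \<bar>f x\<bar> * \<bar>g x\<bar>" using AB by simp
    ultimately show ?thesis by (simp add: algebra_simps)
  qed
  have lin: "ennreal (k * u + k' * v) = ennreal k * ennreal u + ennreal k' * ennreal v"
    if "0 \<le> k" "0 \<le> k'" "0 \<le> u" "0 \<le> v" for k k' u v :: real
    using that by (simp add: ennreal_mult)
  have "(\<integral>\<^sup>+x. ennreal (\<bar>f x\<bar> * \<bar>g x\<bar>) \<partial>M) \<le>
    (\<integral>\<^sup>+x. ennreal (?c / (p * a)) * ennreal (\<bar>f x\<bar> powr p) + ennreal (?c / (q * b)) * ennreal (\<bar>g x\<bar> powr q) \<partial>M)"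
  proof (intro nn_integral_mono)
    fix x
    have "ennreal (\<bar>f x\<bar> * \<bar>g x\<bar>) \<le> ennreal (?c / (p * a) * \<bar>f x\<bar> powr p + ?c / (q * b) * \<bar>g x\<bar> powr q)"
      by (rule ennreal_leI[OF young])
    also have "\<dots> = ennreal (?c / (p * a)) * ennreal (\<bar>f x\<bar> powr p) + ennreal (?c / (q * b)) * ennreal (\<bar>g x\<bar> powr q)"
      using c pq AB by (intro lin) auto
    finally show "ennreal (\<bar>f x\<bar> * \<bar>g x\<bar>) \<le> \<dots>" .
  qed
  also have "\<dots> = ennreal (?c / (p * a)) * lp_int p M f + ennreal (?c / (q * b)) * lp_int q M g"
    unfolding lp_int_def by (simp add: nn_integral_add nn_integral_cmult)
  also have "\<dots> \<le> ennreal (?c / (p * a)) * ennreal a + ennreal (?c / (q * b)) * ennreal b"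
    by (intro add_mono mult_left_mono AB) auto
  also have "\<dots> = ennreal (?c * (1 / p + 1 / q))"
    using c pq AB by (simp add: ennreal_mult[symmetric] ennreal_plus[symmetric] field_simps del: ennreal_plus)
  finally show ?thesis using pq by simp
qed

section \<open>Partial sums of local Parseval frames\<close>

lemma conjugate_exponent_gt_1: "1 < (p::real) \<Longrightarrow> 1 / p + 1 / q = 1 \<Longrightarrow> 1 < q"
proof -
  assume p: "1 < p" and pq: "1 / p + 1 / q = 1"
  have "0 < 1 / p" "1 / p < 1" using p by simp_all
  then have *: "0 < 1 / q" "1 / q < 1" using pq by linarith+
  then have "0 < q" by simp
  then show "1 < q" using *(2) by simp
qed

text \<open>The function \<open>\<rho>\<close> of an index \<open>i = (j, k, e)\<close>. It is a multiple of the indicator of a cube of side length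
  \<open>1 / (2 ^ j * l)\<close>, normalized so that its \<open>L\<^sup>2\<close>-norm does not depend on \<open>i\<close>.\<close>

definition rho_at :: "enat \<Rightarrow> nat \<Rightarrow> 'd::finite wavelet_index \<Rightarrow> real^'d \<Rightarrow> real" where
  "rho_at m l i x = rho m l (fst i) (fst (snd i)) x"

lemma rho_nonneg: "rho_at m l i x \<ge> 0"
  unfolding rho_at_def rho_def Let_def by simp

lemma rho_at_eq:
  fixes i :: "'d::finite wavelet_index"
  assumes "l > 0"
  obtains k where "rho_at m l i = (\<lambda>x. 2 powr (real (fst i) * real CARD('d) / 2) *
      indicator (cbox (\<chi> n. k n / (2 ^ fst i * real l)) (\<chi> n. (k n + 1) / (2 ^ fst i * real l))) x)"
proof -
  let ?c = "2 ^ fst i * real l"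
  have c: "?c > 0" using assms by simp
  define k' where "k' = (if m = \<infinity> then lattice_rep l (fst i) (fst (snd i)) else fst (snd i))"
  show ?thesis
  proof (rule that[of "\<lambda>n. real_of_int (k' $ n)"], rule ext)
    fix x :: "real^'d"
    have "(0 \<le> ?c * x $ n - real_of_int (k' $ n) \<and> ?c * x $ n - real_of_int (k' $ n) \<le> 1) \<longleftrightarrow>
      (real_of_int (k' $ n) / ?c \<le> x $ n \<and> x $ n \<le> (real_of_int (k' $ n) + 1) / ?c)" for n
      using c by (simp add: pos_divide_le_eq pos_le_divide_eq mult.commute) linarith
    then have "indicator {y :: real^'d. \<forall>i. 0 \<le> y $ i \<and> y $ i \<le> 1} (\<chi> n. ?c * x $ n - real_of_int (k' $ n)) =
      (indicator (cbox (\<chi> n. real_of_int (k' $ n) / ?c) (\<chi> n. (real_of_int (k' $ n) + 1) / ?c)) x :: real)"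
      unfolding indicator_def mem_box_cart by simp
    then show "rho_at m l i x = 2 powr (real (fst i) * real CARD('d) / 2) *
      indicator (cbox (\<chi> n. real_of_int (k' $ n) / ?c) (\<chi> n. (real_of_int (k' $ n) + 1) / ?c)) x"
      unfolding rho_at_def rho_def Let_def k'_def[symmetric] by simp
  qed
qed

lemma rho_measurable:
  fixes i :: "'d::finite wavelet_index"
  assumes "l > 0"
  shows "rho_at m l i \<in> borel_measurable borel"
proof -
  obtain k where k: "rho_at m l i = (\<lambda>x. 2 powr (real (fst i) * real CARD('d) / 2) *
      indicator (cbox (\<chi> n. k n / (2 ^ fst i * real l)) (\<chi> n. (k n + 1) / (2 ^ fst i * real l))) x)"
    using rho_at_eq[OF assms] .
  show ?thesis unfolding k by (intro borel_measurable_times borel_measurable_const borel_measurable_indicator) simp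
qed

lemma nn_integral_rho_sq:
  fixes i :: "'d::finite wavelet_index"
  assumes "l > 0"
  shows "(\<integral>\<^sup>+x. ennreal ((rho_at m l i x)\<^sup>2) \<partial>lborel) = ennreal (1 / real l ^ CARD('d))"
proof -
  let ?c = "2 ^ fst i * real l"
  have c: "?c > 0" using assms by simp
  obtain k where k: "rho_at m l i = (\<lambda>x. 2 powr (real (fst i) * real CARD('d) / 2) *
      indicator (cbox (\<chi> n. k n / ?c) (\<chi> n. (k n + 1) / ?c)) x)"
    using rho_at_eq[OF assms] .
  let ?Q = "cbox (\<chi> n. k n / ?c) (\<chi> n. (k n + 1) / ?c) :: (real^'d) set"
  have sq: "(2 powr (real (fst i) * real CARD('d) / 2))\<^sup>2 = 2 powr (real (fst i) * real CARD('d))"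
    by (simp add: power2_eq_square powr_add[symmetric] mult.commute)
  have "ennreal ((rho_at m l i x)\<^sup>2) = ennreal (2 powr (real (fst i) * real CARD('d))) * indicator ?Q x" for x
    unfolding k by (simp add: indicator_def sq)
  then have "(\<integral>\<^sup>+x. ennreal ((rho_at m l i x)\<^sup>2) \<partial>lborel) =
      ennreal (2 powr (real (fst i) * real CARD('d))) * emeasure lborel ?Q"
    by (simp add: nn_integral_cmult_indicator)
  also have "emeasure lborel ?Q = ennreal (measure lborel ?Q)"
    by (rule emeasure_eq_ennreal_measure) (simp add: emeasure_lborel_cbox_eq)
  also have "measure lborel ?Q = (1 / ?c) ^ CARD('d)"
  proof -
    have "k n / ?c \<le> (k n + 1) / ?c" for n using c by (intro divide_right_mono) auto
    then have "?Q \<noteq> {}" unfolding interval_ne_empty_cart by simp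
    then have "measure lborel ?Q = (\<Prod>n\<in>UNIV. (k n + 1) / ?c - k n / ?c)"
      by (subst content_cbox_cart) simp_all
    also have "\<dots> = (\<Prod>n\<in>(UNIV::'d set). 1 / ?c)"
      by (intro prod.cong refl) (simp add: diff_divide_distrib[symmetric])
    finally show ?thesis by simp
  qed
  also have "ennreal (2 powr (real (fst i) * real CARD('d))) * ennreal ((1 / ?c) ^ CARD('d)) =
      ennreal (2 powr (real (fst i) * real CARD('d)) * (1 / ?c) ^ CARD('d))"
    using c by (intro ennreal_mult[symmetric]) auto
  also have "2 powr (real (fst i) * real CARD('d)) = (2 ^ fst i) ^ CARD('d)"
    by (simp add: powr_realpow[symmetric] powr_powr)
  also have "(2 ^ fst i) ^ CARD('d) * (1 / ?c) ^ CARD('d) = 1 / real l ^ CARD('d)"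
    using assms by (simp add: power_mult_distrib power_divide)
  finally show ?thesis .
qed

text \<open>The square function truncated to a finite set of indices; it bounds the sequence norm from below.\<close>

lemma L2_set_le_seq_norm:
  fixes a :: "'d::finite wavelet_index \<Rightarrow> real"
  assumes p: "p > 0" and F: "finite F" "F \<subseteq> I"
  shows "lp_int p lborel (\<lambda>x. L2_set (\<lambda>i. a i * rho_at m l i x) F) \<le> epowr (seq_norm m l I 0 p 2 a) p"
proof -
  define b where "b x = (\<lambda>(j, k, e). ennreal (2 powr (real j * 0) * \<bar>a (j, k, e)\<bar> * rho m l j k x))" for x
  have b: "b x i = ennreal \<bar>a i * rho_at m l i x\<bar>" for x i
    unfolding b_def rho_at_def using rho_nonneg[of m l i x]
    by (cases i) (simp add: abs_mult rho_at_def)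
  have le: "ennreal (L2_set (\<lambda>i. a i * rho_at m l i x) F) \<le> lq_norm 2 I (b x)" for x
  proof -
    have "ennreal (\<Sum>i\<in>F. (a i * rho_at m l i x)\<^sup>2) = (\<Sum>i\<in>F. epowr (b x i) 2)"
      by (simp add: b epowr_ennreal sum_ennreal)
    also have "\<dots> = (\<integral>\<^sup>+i. epowr (b x i) 2 * indicator F i \<partial>count_space I)"
      using F by (subst nn_integral_count_space'[where A=F]) (auto intro!: sum.cong)
    also have "\<dots> \<le> (\<integral>\<^sup>+i. epowr (b x i) 2 \<partial>count_space I)"
      by (intro nn_integral_mono) (simp add: indicator_def)
    finally have "epowr (ennreal (\<Sum>i\<in>F. (a i * rho_at m l i x)\<^sup>2)) (1 / 2) \<le>
        epowr (\<integral>\<^sup>+i. epowr (b x i) 2 \<partial>count_space I) (1 / 2)"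
      by (intro epowr_mono) auto
    then show ?thesis
      unfolding lq_norm_def elp_norm_def L2_set_def
      by (simp add: epowr_ennreal sum_nonneg powr_half_sqrt)
  qed
  have "lp_int p lborel (\<lambda>x. L2_set (\<lambda>i. a i * rho_at m l i x) F) \<le>
      (\<integral>\<^sup>+x. epowr (lq_norm 2 I (b x)) p \<partial>lborel)"
    unfolding lp_int_def
  proof (intro nn_integral_mono)
    fix x
    have "epowr (ennreal (L2_set (\<lambda>i. a i * rho_at m l i x) F)) p \<le> epowr (lq_norm 2 I (b x)) p"
      by (intro epowr_mono le) (use p in simp)
    then show "ennreal (\<bar>L2_set (\<lambda>i. a i * rho_at m l i x) F\<bar> powr p) \<le> epowr (lq_norm 2 I (b x)) p"
      by (simp add: epowr_ennreal)
  qed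
  also have "\<dots> = epowr (seq_norm m l I 0 p 2 a) p"
    unfolding seq_norm_def b_def elp_norm_def using p by (simp add: epowr_epowr epowr_one)
  finally show ?thesis .
qed

text \<open>Duality of the sequence norms for \<open>p\<close> and \<open>q\<close>. Since the square of each \<open>\<rho>\<close> has integral \<open>1 / l ^ d\<close>, the
  sum of \<open>\<bar>a\<^sub>i b\<^sub>i\<bar>\<close> is \<open>l ^ d\<close> times the integral of the sum of \<open>\<bar>a\<^sub>i \<rho>\<^sub>i\<bar> \<bar>b\<^sub>i \<rho>\<^sub>i\<bar>\<close>, to which the inequalities of
  Cauchy-Schwarz (in \<open>i\<close>) and Hoelder (in the space variable) apply.\<close>

lemma sum_abs_mult_le:
  fixes a b :: "'d::finite wavelet_index \<Rightarrow> real"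
  assumes pq: "1 < p" "1 < q" "1 / p + 1 / q = 1" and l: "l > 0" and F: "finite F" "F \<subseteq> I"
    and ab: "epowr (seq_norm m l I 0 p 2 a) p \<le> ennreal \<alpha>" "epowr (seq_norm m l I 0 q 2 b) q \<le> ennreal \<beta>"
    and pos: "0 < \<alpha>" "0 < \<beta>"
  shows "(\<Sum>i\<in>F. \<bar>a i * b i\<bar>) \<le> real l ^ CARD('d) * (\<alpha> powr (1 / p) * \<beta> powr (1 / q))"
proof -
  let ?r = "rho_at m l" and ?L = "real l ^ CARD('d)"
  note [measurable] = rho_measurable[OF l]
  have m: "(\<lambda>x. L2_set (\<lambda>i. c i * ?r i x) F) \<in> borel_measurable lborel" for c
    unfolding L2_set_def by measurable
  have "ennreal (\<Sum>i\<in>F. \<bar>a i * b i\<bar>) = (\<Sum>i\<in>F. ennreal (\<bar>a i * b i\<bar> * ?L) * ennreal (1 / ?L))"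
    using l by (subst sum_ennreal[symmetric]) (simp_all add: ennreal_mult[symmetric])
  also have "\<dots> = (\<Sum>i\<in>F. \<integral>\<^sup>+x. ennreal (\<bar>a i * b i\<bar> * ?L) * ennreal ((?r i x)\<^sup>2) \<partial>lborel)"
    by (simp add: nn_integral_cmult nn_integral_rho_sq[OF l])
  also have "\<dots> = (\<integral>\<^sup>+x. (\<Sum>i\<in>F. ennreal (\<bar>a i * b i\<bar> * ?L) * ennreal ((?r i x)\<^sup>2)) \<partial>lborel)"
    by (rule nn_integral_sum[symmetric]) measurable
  also have "\<dots> = (\<integral>\<^sup>+x. ennreal ?L * ennreal (\<Sum>i\<in>F. \<bar>a i * ?r i x\<bar> * \<bar>b i * ?r i x\<bar>) \<partial>lborel)"
  proof (intro nn_integral_cong)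
    fix x
    have "(\<Sum>i\<in>F. ennreal (\<bar>a i * b i\<bar> * ?L) * ennreal ((?r i x)\<^sup>2)) =
      (\<Sum>i\<in>F. ennreal (?L * (\<bar>a i * ?r i x\<bar> * \<bar>b i * ?r i x\<bar>)))"
      using rho_nonneg[of m l _ x]
      by (intro sum.cong refl) (simp add: ennreal_mult[symmetric] abs_mult power2_eq_square ac_simps)
    also have "\<dots> = ennreal ?L * ennreal (\<Sum>i\<in>F. \<bar>a i * ?r i x\<bar> * \<bar>b i * ?r i x\<bar>)"
      by (simp add: sum_ennreal sum_distrib_left[symmetric] ennreal_mult[symmetric] sum_nonneg)
    finally show "(\<Sum>i\<in>F. ennreal (\<bar>a i * b i\<bar> * ?L) * ennreal ((?r i x)\<^sup>2)) = \<dots>" .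
  qed
  also have "\<dots> = ennreal ?L * (\<integral>\<^sup>+x. ennreal (\<Sum>i\<in>F. \<bar>a i * ?r i x\<bar> * \<bar>b i * ?r i x\<bar>) \<partial>lborel)"
    by (rule nn_integral_cmult) measurable
  also have "\<dots> \<le> ennreal ?L * (\<integral>\<^sup>+x. ennreal (\<bar>L2_set (\<lambda>i. a i * ?r i x) F\<bar> * \<bar>L2_set (\<lambda>i. b i * ?r i x) F\<bar>) \<partial>lborel)"
    by (intro mult_left_mono nn_integral_mono ennreal_leI) (auto intro: L2_set_mult_ineq)
  also have "\<dots> \<le> ennreal ?L * ennreal (\<alpha> powr (1 / p) * \<beta> powr (1 / q))"
    using L2_set_le_seq_norm[OF _ F, of p a m l] L2_set_le_seq_norm[OF _ F, of q b m l] pq ab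
    by (intro mult_left_mono Hoelder_nn_integral pq m pos) (auto intro: order_trans)
  also have "\<dots> = ennreal (?L * (\<alpha> powr (1 / p) * \<beta> powr (1 / q)))"
    by (simp add: ennreal_mult)
  finally show ?thesis by (subst (asm) ennreal_le_iff) simp_all
qed

text \<open>A local Parseval frame, with the coefficients \<open>coef\<close> and the partial sums \<open>psum\<close> of the expansion of
  a function.\<close>

locale local_frame =
  fixes m :: enat and j0 l :: nat and \<epsilon> :: real and \<Gamma> :: "nat \<Rightarrow> (int^'d::finite) set"
    and W :: "'d wavelet_index \<Rightarrow> real^'d \<Rightarrow> real"
  assumes frame: "local_Parseval_frame m j0 \<epsilon> l \<Gamma> W"
begin

abbreviation "I \<equiv> frame_indices j0 \<Gamma>"
definition coef :: "(real^'d \<Rightarrow> real) \<Rightarrow> 'd wavelet_index \<Rightarrow> real" where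
  "coef u i = (\<integral>x. u x * W i x \<partial>lborel)"
definition psum :: "(real^'d \<Rightarrow> real) \<Rightarrow> 'd wavelet_index set \<Rightarrow> real^'d \<Rightarrow> real" where
  "psum u F y = (\<Sum>i\<in>F. coef u i * W i y)"

lemma l_pos: "l > 0"
  using frame unfolding local_Parseval_frame_def by (elim conjE) simp

lemma W_props: "i \<in> I \<Longrightarrow> continuous_on UNIV (W i) \<and> fun_supp (W i) \<subseteq> open_cube (1 + \<epsilon>)"
proof -
  assume i: "i \<in> I"
  have "\<forall>i\<in>I. (\<forall>n. enat n \<le> m \<longrightarrow> Ck_on n UNIV (W i)) \<and> fun_supp (W i) \<subseteq> open_cube (1 + \<epsilon>)"
    using frame unfolding local_Parseval_frame_def Let_def by (elim conjE)
  then have "enat 0 \<le> m \<longrightarrow> Ck_on 0 UNIV (W i)" "fun_supp (W i) \<subseteq> open_cube (1 + \<epsilon>)"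
    using i by blast+
  then show ?thesis by (simp add: zero_enat_def[symmetric])
qed

lemma W_zero: "i \<in> I \<Longrightarrow> x \<notin> open_cube (1 + \<epsilon>) \<Longrightarrow> W i x = 0"
  using W_props[of i] closure_subset[of "{x. W i x \<noteq> 0}"] unfolding fun_supp_def by blast

lemma W_measurable: "i \<in> I \<Longrightarrow> W i \<in> borel_measurable borel"
  using W_props borel_measurable_continuous_onI by blast

lemma open_cube_subset_cbox: "open_cube a \<subseteq> cbox (\<chi> i. - a) (\<chi> i. a)"
  unfolding open_cube_def by (auto simp: mem_box_cart less_imp_le)

lemma W_bounded: "i \<in> I \<Longrightarrow> \<exists>c. \<forall>x. \<bar>W i x\<bar> \<le> c"
proof -
  assume i: "i \<in> I"
  let ?K = "cbox (\<chi> i. - (1 + \<epsilon>)) (\<chi> i. 1 + \<epsilon>) :: (real^'d) set"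
  have "compact (W i ` ?K)"
    using W_props[OF i] continuous_on_subset by (intro compact_continuous_image) auto
  then obtain c where c: "\<And>x. x \<in> ?K \<Longrightarrow> \<bar>W i x\<bar> \<le> c"
    using compact_imp_bounded bounded_iff by (metis imageI real_norm_def)
  have "\<bar>W i x\<bar> \<le> max c 0" for x
  proof (cases "x \<in> ?K")
    case True
    then show ?thesis using c[of x] by linarith
  next
    case False
    then have "W i x = 0" using open_cube_subset_cbox[of "1 + \<epsilon>"] by (intro W_zero[OF i]) blast
    then show ?thesis by simp
  qed
  then show ?thesis by blast
qed

lemma W_Lp:
  assumes p: "p > 0" and i: "i \<in> I"
  shows "W i \<in> Lp p lborel"
proof -
  define K :: "(real^'d) set" where "K = cbox (\<chi> i. - (1 + \<epsilon>)) (\<chi> i. 1 + \<epsilon>)"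
  have K: "emeasure lborel K < \<infinity>" "K \<in> sets lborel"
    unfolding K_def by (rule emeasure_lborel_cbox_finite) simp
  obtain c where c: "\<And>x. \<bar>W i x\<bar> \<le> c" using W_bounded[OF i] by blast
  have W0: "W i x = 0" if "x \<notin> K" for x
    using that open_cube_subset_cbox[of "1 + \<epsilon>"] unfolding K_def by (intro W_zero[OF i]) blast
  have "lp_int p lborel (W i) \<le> (\<integral>\<^sup>+x. ennreal (c powr p) * indicator K x \<partial>lborel)"
    unfolding lp_int_def
    using c W0 p by (intro nn_integral_mono) (auto simp: indicator_def intro!: ennreal_leI powr_mono2)
  also have "\<dots> < \<infinity>"
    using K by (simp add: nn_integral_cmult_indicator ennreal_mult_less_top)
  finally show ?thesis using W_measurable[OF i] p by (simp add: Lp_iff)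
qed

lemma frame_Lp:
  assumes p: "1 < p"
  shows "\<exists>C>0. \<forall>u\<in>Lp p lborel. ess_supp u \<subseteq> open_cube 1 \<longrightarrow>
      epowr (seq_norm m l I 0 p 2 (coef u)) p \<le> ennreal C * lp_int p lborel u"
    and "u \<in> Lp p lborel \<Longrightarrow> ess_supp u \<subseteq> open_cube 1 \<Longrightarrow>
      uncond_sum (Lp_norm p lborel) I (\<lambda>i y. coef u i * W i y) u"
proof -
  have "\<forall>p>1. frame_characterizes {h \<in> Lp p lborel. ess_supp h \<subseteq> open_cube 1}
           (Lp_norm p lborel) {Lp_norm p lborel} (\<lambda>h i. \<integral>x. h x * W i x \<partial>lborel) W
           I (seq_norm m l I 0 p 2)"
    using frame unfolding local_Parseval_frame_def Let_def by (elim conjE)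
  then have fc: "frame_characterizes {h \<in> Lp p lborel. ess_supp h \<subseteq> open_cube 1}
           (Lp_norm p lborel) {Lp_norm p lborel} coef W I (seq_norm m l I 0 p 2)"
    using p unfolding coef_def by blast
  then show "u \<in> Lp p lborel \<Longrightarrow> ess_supp u \<subseteq> open_cube 1 \<Longrightarrow>
      uncond_sum (Lp_norm p lborel) I (\<lambda>i y. coef u i * W i y) u"
    unfolding frame_characterizes_def by blast
  obtain C where C: "0 < C" "\<And>u. u \<in> Lp p lborel \<Longrightarrow> ess_supp u \<subseteq> open_cube 1 \<Longrightarrow>
      seq_norm m l I 0 p 2 (coef u) \<le> ennreal C * Lp_norm p lborel u"
    using fc unfolding frame_characterizes_def by blast
  show "\<exists>C>0. \<forall>u\<in>Lp p lborel. ess_supp u \<subseteq> open_cube 1 \<longrightarrow>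
      epowr (seq_norm m l I 0 p 2 (coef u)) p \<le> ennreal C * lp_int p lborel u"
  proof (intro exI[of _ "C powr p"] conjI ballI impI)
    fix u :: "real^'d \<Rightarrow> real" assume u: "u \<in> Lp p lborel" "ess_supp u \<subseteq> open_cube 1"
    have "epowr (seq_norm m l I 0 p 2 (coef u)) p \<le> epowr (ennreal C * Lp_norm p lborel u) p"
      by (intro epowr_mono C(2)[OF u]) (use p in simp)
    also have "\<dots> = ennreal (C powr p) * lp_int p lborel u"
      using C(1) p by (simp add: epowr_cmult epowr_Lp_norm)
    finally show "epowr (seq_norm m l I 0 p 2 (coef u)) p \<le> ennreal (C powr p) * lp_int p lborel u" .
  qed (use C in simp)
qed

lemma psum_continuous: "F \<subseteq> I \<Longrightarrow> continuous_on UNIV (psum u F)"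
  unfolding psum_def using W_props by (intro continuous_intros) auto

lemma psum_Lp: "p > 0 \<Longrightarrow> F \<subseteq> I \<Longrightarrow> psum u F \<in> Lp p lborel"
  unfolding psum_def using W_Lp by (intro Lp_sum Lp_cmult) auto

lemma ess_supp_subset:
  assumes "closed K" "\<And>x. x \<notin> K \<Longrightarrow> f x = 0"
  shows "ess_supp f \<subseteq> K"
proof -
  have "open (- K)" "AE x in lborel. x \<in> - K \<longrightarrow> f x = 0"
    using assms by auto
  then show ?thesis unfolding ess_supp_def by blast
qed

text \<open>The constant depends neither on the finite set \<open>F\<close> of indices nor on the compact set \<open>K\<close>. The bound is
  restricted to the unit cube although the partial sums do not vanish outside it, since the dominating
  sequence norm is only available for test functions supported in the cube.\<close>

lemma psum_uniform_bound:
  assumes pq: "1 < p" "1 / p + 1 / q = 1"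
  shows "\<exists>C>0. \<forall>u\<in>Lp p lborel. ess_supp u \<subseteq> open_cube 1 \<longrightarrow> (\<forall>F K. finite F \<longrightarrow> F \<subseteq> I \<longrightarrow>
     compact K \<longrightarrow> K \<subseteq> open_cube 1 \<longrightarrow>
     (\<integral>\<^sup>+x. ennreal (\<bar>psum u F x\<bar> powr p) * indicator K x \<partial>lborel) \<le> ennreal C * lp_int p lborel u)"
proof -
  have q: "1 < q" using conjugate_exponent_gt_1 pq .
  obtain C1 where C1: "0 < C1" "\<And>u. u \<in> Lp p lborel \<Longrightarrow> ess_supp u \<subseteq> open_cube 1 \<Longrightarrow>
      epowr (seq_norm m l I 0 p 2 (coef u)) p \<le> ennreal C1 * lp_int p lborel u"
    using frame_Lp(1)[OF pq(1)] by blast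
  obtain C2 where C2: "0 < C2" "\<And>u. u \<in> Lp q lborel \<Longrightarrow> ess_supp u \<subseteq> open_cube 1 \<Longrightarrow>
      epowr (seq_norm m l I 0 q 2 (coef u)) q \<le> ennreal C2 * lp_int q lborel u"
    using frame_Lp(1)[OF q] by blast
  define L where "L = real l ^ CARD('d)"
  have L: "L > 0" unfolding L_def using l_pos by simp
  define C where "C = (L * (C1 powr (1 / p) * C2 powr (1 / q))) powr p"
  have C: "C > 0" unfolding C_def using L C1 C2 by simp
  show ?thesis
  proof (intro exI[of _ C] conjI C ballI impI allI)
    fix u :: "real^'d \<Rightarrow> real" and F and K :: "(real^'d) set"
    assume u: "u \<in> Lp p lborel" "ess_supp u \<subseteq> open_cube 1" and F: "finite F" "F \<subseteq> I"
      and K: "compact K" "K \<subseteq> open_cube 1"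
    define G where "G = psum u F"
    have Gc: "continuous_on UNIV G" unfolding G_def by (rule psum_continuous[OF F(2)])
    have [measurable]: "G \<in> borel_measurable borel" using Gc by (rule borel_measurable_continuous_onI)
    have [measurable]: "K \<in> sets borel" using K by (simp add: compact_imp_closed)
    have Kfin: "emeasure lborel K < \<infinity>"
      by (rule emeasure_bounded_finite[OF compact_imp_bounded[OF K(1)]])
    obtain M where M: "\<And>x. x \<in> K \<Longrightarrow> \<bar>G x\<bar> \<le> M"
      using compact_imp_bounded[OF compact_continuous_image[OF continuous_on_subset[OF Gc subset_UNIV] K(1)]]
      unfolding bounded_iff by auto
    \<comment> \<open>the extremal test function, which turns the pairing with \<open>G\<close> into the norm of \<open>G\<close> on \<open>K\<close>\<close>
    define v where "v x = sgn (G x) * \<bar>G x\<bar> powr (p - 1) * indicator K x" for x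
    have [measurable]: "v \<in> borel_measurable borel" unfolding v_def by measurable
    have vb: "\<bar>v x\<bar> \<le> M powr (p - 1)" if "x \<in> K" for x
      using M[OF that] pq that by (auto simp: v_def abs_mult sgn_real_def intro!: powr_mono2)
    have v0: "v x = 0" if "x \<notin> K" for x using that by (simp add: v_def)
    have Gv: "G x * v x = \<bar>G x\<bar> powr p * indicator K x" for x
    proof -
      have "G x * sgn (G x) * \<bar>G x\<bar> powr (p - 1) = \<bar>G x\<bar> powr p"
        using pq by (cases "G x = 0") (simp_all add: abs_sgn[symmetric] powr_mult_base)
      then show ?thesis by (simp add: v_def ac_simps)
    qed
    have pq': "(p - 1) * q = p" using pq q by (simp add: field_simps)
    have vq: "\<bar>v x\<bar> powr q = \<bar>G x\<bar> powr p * indicator K x" for x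
      by (cases "G x = 0") (auto simp: v_def abs_mult sgn_real_def indicator_def powr_powr pq')
    define T where "T = (\<integral>x. G x * v x \<partial>lborel)"
    have Mp: "\<bar>G x\<bar> powr p \<le> M powr p" if "x \<in> K" for x
      using M[OF that] pq by (intro powr_mono2) auto
    have int: "integrable lborel (\<lambda>x. G x * v x)"
      unfolding Gv using Mp
      by (intro integrableI_bounded_set[where A=K and B="M powr p"]) (auto simp: Kfin[simplified])
    have nnT: "(\<integral>\<^sup>+x. ennreal (\<bar>G x\<bar> powr p) * indicator K x \<partial>lborel) = ennreal T"
    proof -
      have "(\<integral>\<^sup>+x. ennreal (\<bar>G x\<bar> powr p) * indicator K x \<partial>lborel) = (\<integral>\<^sup>+x. ennreal (G x * v x) \<partial>lborel)"
        unfolding Gv by (intro nn_integral_cong) (auto simp: indicator_def)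
      also have "\<dots> = ennreal T"
        unfolding T_def using int by (intro nn_integral_eq_integral) (auto simp: Gv)
      finally show ?thesis .
    qed
    have T0: "T \<ge> 0" unfolding T_def by (intro Bochner_Integration.integral_nonneg) (auto simp: Gv)
    have lpv: "lp_int q lborel v = ennreal T"
      unfolding lp_int_def vq nnT[symmetric] by (intro nn_integral_cong) (auto simp: indicator_def)
    have vL: "v \<in> Lp q lborel" using q lpv by (simp add: Lp_iff)
    have vs: "ess_supp v \<subseteq> open_cube 1"
      using ess_supp_subset[of K v] v0 K compact_imp_closed by blast
    have iWv: "integrable lborel (\<lambda>x. v x * W i x)" if i: "i \<in> F" for i
    proof -
      have [measurable]: "W i \<in> borel_measurable borel" using W_measurable i F by blast
      obtain c where c: "\<And>x. \<bar>W i x\<bar> \<le> c" using W_bounded i F by blast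
      show ?thesis
        by (rule integrableI_bounded_set[where A=K and B="M powr (p - 1) * c"])
          (auto simp: Kfin[simplified] v0 abs_mult intro!: mult_mono vb c)
    qed
    have "T = (\<integral>x. (\<Sum>i\<in>F. coef u i * (v x * W i x)) \<partial>lborel)"
      unfolding T_def G_def psum_def by (simp add: sum_distrib_left sum_distrib_right ac_simps)
    also have "\<dots> = (\<Sum>i\<in>F. coef u i * coef v i)"
      using iWv unfolding coef_def[of v] by (subst Bochner_Integration.integral_sum) auto
    also have "\<dots> \<le> (\<Sum>i\<in>F. \<bar>coef u i * coef v i\<bar>)" by (intro sum_mono) simp
    finally have TS: "T \<le> (\<Sum>i\<in>F. \<bar>coef u i * coef v i\<bar>)" .
    obtain N where N: "lp_int p lborel u = ennreal N" "N \<ge> 0"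
      using u(1) pq by (cases "lp_int p lborel u") (auto simp: Lp_iff)
    \<comment> \<open>the slack \<open>e\<close> makes the upper bound for the norm of \<open>u\<close> positive also if \<open>N = 0\<close>\<close>
    have "T \<le> C * N + e" if e: "e > 0" for e
    proof (cases "T = 0")
      case True
      then show ?thesis using C N e by (simp add: less_imp_le)
    next
      case False
      then have T: "T > 0" using T0 by simp
      define \<delta> where "\<delta> = e / C"
      have \<delta>: "\<delta> > 0" unfolding \<delta>_def using e C by simp
      have "T \<le> L * ((C1 * (N + \<delta>)) powr (1 / p) * (C2 * T) powr (1 / q))"
        unfolding L_def
      proof (rule order_trans[OF TS sum_abs_mult_le])
        have "epowr (seq_norm m l I 0 p 2 (coef u)) p \<le> ennreal (C1 * N)"
          using C1(2)[OF u] C1(1) N by (simp add: ennreal_mult)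
        also have "\<dots> \<le> ennreal (C1 * (N + \<delta>))" using C1 \<delta> by (intro ennreal_leI) simp
        finally show "epowr (seq_norm m l I 0 p 2 (coef u)) p \<le> ennreal (C1 * (N + \<delta>))" .
        show "epowr (seq_norm m l I 0 q 2 (coef v)) q \<le> ennreal (C2 * T)"
          using C2(2)[OF vL vs] C2(1) T0 by (simp add: ennreal_mult lpv)
      qed (use pq q l_pos F N \<delta> T C1 C2 in auto)
      \<comment> \<open>one factor \<open>T powr (1 / q)\<close> cancels against \<open>T = T powr (1 / p) * T powr (1 / q)\<close>\<close>
      also have "\<dots> = L * (C1 powr (1 / p) * C2 powr (1 / q)) * (N + \<delta>) powr (1 / p) * T powr (1 / q)"
        using C1 C2 N \<delta> T by (simp add: powr_mult)
      finally have "T powr (1 / p) * T powr (1 / q) \<le>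
          L * (C1 powr (1 / p) * C2 powr (1 / q)) * (N + \<delta>) powr (1 / p) * T powr (1 / q)"
        using T pq by (simp add: powr_add[symmetric])
      then have "T powr (1 / p) \<le> L * (C1 powr (1 / p) * C2 powr (1 / q)) * (N + \<delta>) powr (1 / p)"
        using T by (simp add: mult_le_cancel_right)
      then have "(T powr (1 / p)) powr p \<le> (L * (C1 powr (1 / p) * C2 powr (1 / q)) * (N + \<delta>) powr (1 / p)) powr p"
        using pq by (intro powr_mono2) auto
      also have "\<dots> = C * (N + \<delta>)"
        unfolding C_def using L C1 C2 N \<delta> pq by (simp add: powr_mult powr_powr)
      finally have "T \<le> C * (N + \<delta>)" using T pq by (simp add: powr_powr)
      then show ?thesis using C by (simp add: \<delta>_def algebra_simps)
    qed
    then have "T \<le> C * N" by (rule field_le_epsilon)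
    then show "(\<integral>\<^sup>+x. ennreal (\<bar>psum u F x\<bar> powr p) * indicator K x \<partial>lborel) \<le> ennreal C * lp_int p lborel u"
      using nnT N C unfolding G_def by (simp add: ennreal_mult[symmetric] ennreal_leI)
  qed
qed

end

section \<open>Charts and metric determinants\<close>

lemma partial_deriv_cong:
  assumes "open S" "x \<in> S" "f differentiable_on S" "\<And>y. y \<in> S \<Longrightarrow> f y = g y"
  shows "partial_deriv i f x = partial_deriv i g x"
proof -
  have "f differentiable at x"
    using assms differentiable_on_eq_differentiable_at by blast
  then show ?thesis
    unfolding partial_deriv_def
    using frechet_derivative_transform_within_open[of f x S g] assms by simp
qed

lemma Ck_on_cong:
  assumes "open S" "Ck_on n S f" "\<And>y. y \<in> S \<Longrightarrow> f y = g y"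
  shows "Ck_on n S g"
  using assms(2,3)
proof (induction n arbitrary: f g)
  case 0
  then show ?case using continuous_on_cong by fastforce
next
  case (Suc n)
  have df: "f differentiable_on S" using Suc.prems by simp
  have "g differentiable_on S"
    unfolding differentiable_on_def
  proof
    fix x assume x: "x \<in> S"
    have "f differentiable at x"
      using df assms(1) x differentiable_on_eq_differentiable_at by blast
    then obtain f' where "(f has_derivative f') (at x)" by (auto simp: differentiable_def)
    then have "(g has_derivative f') (at x)"
      using has_derivative_transform_within_open[OF _ assms(1) x] Suc.prems(2) by blast
    then show "g differentiable at x within S"
      using differentiableI differentiable_at_withinI by blast
  qed
  moreover have "Ck_on n S (partial_deriv i g)" for i
    using Suc.IH[of "partial_deriv i f" "partial_deriv i g"] Suc.prems(1)
      partial_deriv_cong[OF assms(1) _ df Suc.prems(2)] by simp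
  ultimately show ?case by simp
qed

lemma smooth_on_cong:
  "open S \<Longrightarrow> smooth_on S f \<Longrightarrow> (\<And>y. y \<in> S \<Longrightarrow> f y = g y) \<Longrightarrow> smooth_on S g"
  unfolding smooth_on_def using Ck_on_cong by blast

lemma smooth_on_imp_continuous_on: "smooth_on S f \<Longrightarrow> continuous_on S f"
  unfolding smooth_on_def using Ck_on.simps(1) by blast

lemma smooth_on_imp_differentiable:
  "smooth_on S f \<Longrightarrow> open S \<Longrightarrow> x \<in> S \<Longrightarrow> f differentiable at x"
  unfolding smooth_on_def
  by (metis Ck_on.simps(2) differentiable_on_eq_differentiable_at)

lemma chart_inv_simps:
  assumes "is_chart c"
  shows "x \<in> fst c \<Longrightarrow> chart_inv c (snd c x) = x"
    and "y \<in> snd c ` fst c \<Longrightarrow> snd c (chart_inv c y) = y"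
    and "y \<in> snd c ` fst c \<Longrightarrow> chart_inv c y \<in> fst c"
  using assms unfolding is_chart_def homeomorphism_def by auto

lemma open_chart_image:
  assumes "is_chart c" "open V"
  shows "open (snd c ` (V \<inter> fst c))"
proof -
  have "openin (top_of_set (fst c)) (V \<inter> fst c)"
    using assms by (metis inf_commute openin_open_Int)
  then have "openin (top_of_set (snd c ` fst c)) (snd c ` (V \<inter> fst c))"
    using assms homeomorphism_imp_open_map unfolding is_chart_def by blast
  then show ?thesis
    using assms unfolding is_chart_def by (metis openin_open_trans)
qed

lemma atlas_chart: "smooth_structure A \<Longrightarrow> c \<in> A \<Longrightarrow> is_chart c"
  unfolding smooth_structure_def by (elim conjE) (erule bspec)

lemma atlas_covers:
  assumes "smooth_structure A"
  shows "\<exists>c\<in>A. x \<in> fst c"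
proof -
  have "(\<Union>c\<in>A. fst c) = UNIV" using assms unfolding smooth_structure_def by (elim conjE)
  then have "x \<in> (\<Union>c\<in>A. fst c)" by simp
  then show ?thesis by blast
qed

lemma atlas_maximal:
  "smooth_structure A \<Longrightarrow> is_chart c \<Longrightarrow> (\<And>c'. c' \<in> A \<Longrightarrow> compatible c c') \<Longrightarrow> c \<in> A"
  unfolding smooth_structure_def by (elim conjE allE[of _ c]) simp

lemma transition_differentiable:
  assumes "smooth_structure A" "c \<in> A" "c' \<in> A" "x \<in> fst c" "x \<in> fst c'"
  shows "transition c c' differentiable at (snd c x)"
proof -
  have "is_chart c" "open (fst c')"
    using assms unfolding smooth_structure_def is_chart_def by auto
  then have "open (snd c ` (fst c \<inter> fst c'))"
    using open_chart_image[of c "fst c'"] by (simp add: inf_commute)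
  moreover have "smooth_on (snd c ` (fst c \<inter> fst c')) (transition c c')"
    using assms unfolding smooth_structure_def compatible_def by auto
  ultimately show ?thesis
    using smooth_on_imp_differentiable assms by blast
qed

lemma transition_chain_rule:
  assumes "smooth_structure A" "c \<in> A" "c' \<in> A" "c'' \<in> A" "x \<in> fst c" "x \<in> fst c'" "x \<in> fst c''"
  shows "frechet_derivative (transition c c'') (at (snd c x)) v =
    frechet_derivative (transition c' c'') (at (snd c' x))
      (frechet_derivative (transition c c') (at (snd c x)) v)"
proof -
  have ch: "is_chart c" "is_chart c'" "is_chart c''"
    using assms unfolding smooth_structure_def by auto
  have x': "transition c c' (snd c x) = snd c' x"
    unfolding transition_def using chart_inv_simps(1)[OF ch(1) assms(5)] by simp
  have d1: "transition c c' differentiable at (snd c x)"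
    and d2: "transition c' c'' differentiable at (transition c c' (snd c x))"
    unfolding x' using transition_differentiable assms by blast+
  have "open (fst c')" using ch unfolding is_chart_def by auto
  then have "open (snd c ` (fst c' \<inter> fst c))"
    using open_chart_image ch by blast
  then have "frechet_derivative (transition c' c'' \<circ> transition c c') (at (snd c x)) =
    frechet_derivative (transition c c'') (at (snd c x))"
  proof (intro frechet_derivative_transform_within_open[of _ _ "snd c ` (fst c' \<inter> fst c)"])
    show "transition c' c'' \<circ> transition c c' differentiable at (snd c x)"
      using d1 d2 differentiable_chain_at by blast
    show "snd c x \<in> snd c ` (fst c' \<inter> fst c)" using assms by blast
  qed (use ch in \<open>auto simp: transition_def chart_inv_simps\<close>)
  then show ?thesis
    using frechet_derivative_compose[OF d1 d2] x' by (simp add: o_def fun_eq_iff)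
qed

lemma transition_self_derivative:
  assumes "smooth_structure A" "c \<in> A" "x \<in> fst c"
  shows "frechet_derivative (transition c c) (at (snd c x)) v = v"
proof -
  have ch: "is_chart c" using assms unfolding smooth_structure_def by auto
  have "frechet_derivative id (at (snd c x)) = frechet_derivative (transition c c) (at (snd c x))"
    by (rule frechet_derivative_transform_within_open[of _ _ "snd c ` fst c"])
      (use ch assms in \<open>auto simp: transition_def chart_inv_simps is_chart_def id_def\<close>)
  then show ?thesis by (simp add: frechet_derivative_id)
qed

lemma coord_vector_tangent:
  assumes "smooth_structure A" "c \<in> A" "x \<in> fst c"
  shows "coord_vector A c x i \<in> tangent_space A x"
proof -
  have "coord_vector A c x i c'' =
      frechet_derivative (transition c' c'') (at (snd c' x)) (coord_vector A c x i c')"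
    if "c' \<in> A" "c'' \<in> A" "x \<in> fst c' \<inter> fst c''" for c' c''
    using transition_chain_rule[OF assms(1,2) that(1,2) assms(3)] that
    unfolding coord_vector_def by simp
  moreover have "coord_vector A c x i c' = 0" if "c' \<notin> A \<or> x \<notin> fst c'" for c'
    using that unfolding coord_vector_def by auto
  ultimately show ?thesis unfolding tangent_space_def by blast
qed

lemma tangent_space_lincomb:
  assumes ss: "smooth_structure A" and v: "u \<in> tangent_space A x" "v \<in> tangent_space A x"
  shows "(\<lambda>c. a *\<^sub>R u c + v c) \<in> tangent_space A x"
proof -
  have "a *\<^sub>R u c' + v c' =
      frechet_derivative (transition c c') (at (snd c x)) (a *\<^sub>R u c + v c)"
    if c: "c \<in> A" "c' \<in> A" "x \<in> fst c \<inter> fst c'" for c c'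
  proof -
    let ?D = "frechet_derivative (transition c c') (at (snd c x))"
    have "linear ?D"
      using transition_differentiable[OF ss c(1,2)] c(3) linear_frechet_derivative by blast
    moreover have "u c' = ?D (u c)" "v c' = ?D (v c)"
      using v c unfolding tangent_space_def by blast+
    ultimately show ?thesis by (simp add: linear_add linear_scale)
  qed
  moreover have "a *\<^sub>R u c + v c = 0" if "c \<notin> A \<or> x \<notin> fst c" for c
  proof -
    have "u c = 0" "v c = 0" using v that unfolding tangent_space_def by blast+
    then show ?thesis by simp
  qed
  ultimately show ?thesis unfolding tangent_space_def by blast
qed

lemma tangent_space_zero:
  assumes ss: "smooth_structure A"
  shows "(\<lambda>_. 0) \<in> tangent_space A x"
proof -
  have "0 = frechet_derivative (transition c c') (at (snd c x)) 0"
    if c: "c \<in> A" "c' \<in> A" "x \<in> fst c \<inter> fst c'" for c c'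
    using transition_differentiable[OF ss c(1,2)] c(3) linear_frechet_derivative
    by (metis IntE linear_0)
  then show ?thesis unfolding tangent_space_def by blast
qed

lemma tangent_isometry_zero:
  assumes ss: "smooth_structure A" and ti: "tangent_isometry A g x \<iota>"
  shows "\<iota> (\<lambda>_. 0) = 0"
proof -
  define z where "z = (\<lambda>_::('a, 'b) chart. 0 :: real^'b)"
  have "z \<in> tangent_space A x" unfolding z_def by (rule tangent_space_zero[OF ss])
  then have "\<iota> (\<lambda>c. 1 *\<^sub>R z c + z c) = 1 *\<^sub>R \<iota> z + \<iota> z"
    using ti unfolding tangent_isometry_def by blast
  then have "\<iota> z = 0" unfolding z_def by simp
  then show ?thesis unfolding z_def .
qed

lemma tangent_isometry_sum:
  assumes ss: "smooth_structure A" and ti: "tangent_isometry A g x \<iota>"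
    and "finite S" and "\<And>i. i \<in> S \<Longrightarrow> e i \<in> tangent_space A x"
  shows "(\<lambda>c. \<Sum>i\<in>S. a i *\<^sub>R e i c) \<in> tangent_space A x \<and>
    \<iota> (\<lambda>c. \<Sum>i\<in>S. a i *\<^sub>R e i c) = (\<Sum>i\<in>S. a i *\<^sub>R \<iota> (e i))"
  using assms(3,4)
proof (induction S)
  case empty
  then show ?case using tangent_space_zero[OF ss] tangent_isometry_zero[OF ss ti] by simp
next
  case (insert i S)
  then show ?case
    using tangent_space_lincomb[OF ss, of "e i" x "\<lambda>c. \<Sum>i\<in>S. a i *\<^sub>R e i c" "a i"] ti
    unfolding tangent_isometry_def by simp
qed

text \<open>The metric matrix is the Gram matrix of the images under the isometry of the coordinate
  vectors, hence of the form \<open>B B\<^sup>T\<close> with \<open>B\<close> invertible.\<close>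

lemma det_metric_matrix_pos:
  assumes ss: "smooth_structure A" and c: "c \<in> A" "x \<in> fst c"
    and ti: "tangent_isometry A g x \<iota>"
  shows "det (metric_matrix A g c x) > 0"
proof -
  define e where "e = coord_vector A c x"
  define B :: "real^'b^'b" where "B = (\<chi> i. \<iota> (e i))"
  have e: "e i \<in> tangent_space A x" for i
    unfolding e_def using coord_vector_tangent ss c by blast
  have "metric_matrix A g c x = B ** transpose B"
    using ti e unfolding metric_matrix_def B_def tangent_isometry_def e_def[symmetric]
    by (simp add: vec_eq_iff matrix_matrix_mult_def transpose_def inner_vec_def)
  then have det: "det (metric_matrix A g c x) = (det B)\<^sup>2"
    by (simp add: det_mul det_transpose power2_eq_square)
  have ch: "is_chart c" using ss c unfolding smooth_structure_def by auto
  have "v = 0" if v: "transpose B *v v = 0" for v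
  proof -
    define w where "w = (\<lambda>c. \<Sum>i\<in>UNIV. (v $ i) *\<^sub>R e i c)"
    have w: "w \<in> tangent_space A x" "\<iota> w = (\<Sum>i\<in>UNIV. (v $ i) *\<^sub>R \<iota> (e i))"
      using tangent_isometry_sum[OF ss ti, of UNIV e "\<lambda>i. v $ i"] e unfolding w_def by auto
    have "\<iota> w = transpose B *v v"
      unfolding w(2) by (simp add: vec_eq_iff matrix_vector_mult_def transpose_def B_def mult.commute)
    then have "\<iota> w = \<iota> (\<lambda>_. 0)" using v tangent_isometry_zero[OF ss ti] by simp
    then have "w = (\<lambda>_. 0)"
      using ti w(1) tangent_space_zero[OF ss, of x]
      unfolding tangent_isometry_def bij_betw_def inj_on_def by blast
    then have "w c = 0" by simp
    moreover have "e i c = axis i 1" for i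
      unfolding e_def coord_vector_def using transition_self_derivative[OF ss c] c by simp
    then have "w c = v"
      unfolding w_def using basis_expansion[of v] by (simp add: scalar_mult_eq_scaleR)
    ultimately show "v = 0" by simp
  qed
  then have "invertible (transpose B)"
    using matrix_left_invertible_ker invertible_left_inverse by blast
  then have "det B \<noteq> 0"
    using invertible_det_nz det_transpose by metis
  then show ?thesis unfolding det by simp
qed

lemma continuous_det_metric:
  assumes rm: "riemannian_manifold A g" and c: "c \<in> A"
  shows "continuous_on (snd c ` fst c) (\<lambda>y. det (metric_matrix A g c (chart_inv c y)))"
proof -
  have "continuous_on (snd c ` fst c) (\<lambda>y. metric_matrix A g c (chart_inv c y) $ i $ j)" for i j
  proof -
    have "smooth_from {c} (fst c) (\<lambda>x. metric_matrix A g c x $ i $ j)"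
      using rm c unfolding riemannian_manifold_def by blast
    then have "smooth_on (snd c ` fst c) ((\<lambda>x. metric_matrix A g c x $ i $ j) \<circ> chart_inv c)"
      unfolding smooth_from_def by simp
    from smooth_on_imp_continuous_on[OF this] show ?thesis by (simp add: o_def)
  qed
  then have "continuous_on (snd c ` fst c) (\<lambda>y. of_int (sign p) *
      (\<Prod>i\<in>UNIV. metric_matrix A g c (chart_inv c y) $ i $ p i))" for p
    by (intro continuous_on_mult continuous_on_const continuous_on_prod)
  then show ?thesis unfolding det_def by (intro continuous_on_sum)
qed

lemma tangent_isometry_ball:
  assumes ti: "tangent_isometry A g x \<iota>"
  shows "bij_betw \<iota> (tangent_ball A g x \<rho>) (ball 0 \<rho>)"
proof -
  have n: "norm (\<iota> v) = sqrt (g x v v)" if "v \<in> tangent_space A x" for v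
    using ti that unfolding tangent_isometry_def norm_eq_sqrt_inner by simp
  have "tangent_ball A g x \<rho> = {v \<in> tangent_space A x. \<iota> v \<in> ball 0 \<rho>}"
    unfolding tangent_ball_def using n by (auto simp: dist_norm)
  have "bij_betw \<iota> (tangent_space A x) UNIV"
    using ti unfolding tangent_isometry_def by blast
  then have inj: "inj_on \<iota> (tangent_space A x)" and surj: "\<iota> ` tangent_space A x = UNIV"
    by (auto simp: bij_betw_def)
  have "\<iota> ` {v \<in> tangent_space A x. \<iota> v \<in> ball 0 \<rho>} = ball 0 \<rho>"
  proof (intro set_eqI iffI)
    fix y :: "real^'b" assume y: "y \<in> ball 0 \<rho>"
    obtain v where "v \<in> tangent_space A x" "y = \<iota> v" using surj by blast
    then show "y \<in> \<iota> ` {v \<in> tangent_space A x. \<iota> v \<in> ball 0 \<rho>}" using y by blast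
  qed blast
  moreover have "inj_on \<iota> {v \<in> tangent_space A x. \<iota> v \<in> ball 0 \<rho>}"
    using inj by (rule inj_on_subset) blast
  ultimately show ?thesis
    unfolding bij_betw_def \<open>tangent_ball A g x \<rho> = _\<close> by simp
qed

text \<open>A ball around \<open>x\<close> on which the exponential map is a diffeomorphism. Its inverse, composed with the
  isometry \<open>\<iota>\<close> of the tangent space, is the normal coordinate map \<open>\<kappa>\<close>.\<close>

locale normal_ball =
  fixes A :: "('a::t2_space, 'd::finite) chart set" and g :: "('a, 'd) metric"
    and x :: 'a and r :: real and \<iota> :: "('a, 'd) tvec \<Rightarrow> real^'d"
  assumes rm: "riemannian_manifold A g"
    and ti: "tangent_isometry A g x \<iota>"
    and ed: "exp_diffeo_ball A g x r \<iota>"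
begin

abbreviation "U \<equiv> geodesic_ball A g x r"
abbreviation "\<kappa> \<equiv> normal_coords A g x r \<iota>"
text \<open>The exponential map as a map on Euclidean space; it is the inverse of \<open>\<kappa>\<close> on the ball of radius \<open>r\<close>.\<close>

definition "expmap = riem_exp A g x \<circ> inv_into (tangent_space A x) \<iota>"

lemma ss: "smooth_structure A"
  using rm unfolding riemannian_manifold_def by blast

lemma r_pos: "r > 0" and open_U: "open U"
  using ed unfolding exp_diffeo_ball_def by auto

lemma tangent_ball_subset: "tangent_ball A g x \<rho> \<subseteq> tangent_space A x"
  unfolding tangent_ball_def by auto

lemma expmap_iota: "v \<in> tangent_space A x \<Longrightarrow> expmap (\<iota> v) = riem_exp A g x v"
  using ti unfolding expmap_def tangent_isometry_def bij_betw_def by simp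

lemma kappa_exp: "v \<in> tangent_ball A g x r \<Longrightarrow> \<kappa> (riem_exp A g x v) = \<iota> v"
  using ed unfolding exp_diffeo_ball_def normal_coords_def by simp

lemma expmap_image: "expmap ` ball 0 \<rho> = geodesic_ball A g x \<rho>"
proof -
  have "ball 0 \<rho> = \<iota> ` tangent_ball A g x \<rho>"
    using tangent_isometry_ball[OF ti] by (simp add: bij_betw_def)
  then show ?thesis
    unfolding geodesic_ball_def image_image
    by (simp add: image_image, intro image_cong refl) (use expmap_iota tangent_ball_subset in blast)
qed

lemma kappa_expmap: "y \<in> ball 0 r \<Longrightarrow> \<kappa> (expmap y) = y"
proof -
  assume "y \<in> ball 0 r"
  then obtain v where "v \<in> tangent_ball A g x r" "y = \<iota> v"
    using tangent_isometry_ball[OF ti, of r] unfolding bij_betw_def by blast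
  then show ?thesis using kappa_exp expmap_iota tangent_ball_subset by fastforce
qed

lemma expmap_kappa: "u \<in> U \<Longrightarrow> expmap (\<kappa> u) = u"
proof -
  assume "u \<in> U"
  then obtain y where y: "y \<in> ball 0 r" "u = expmap y" using expmap_image[of r] by blast
  show ?thesis unfolding y(2) kappa_expmap[OF y(1)] ..
qed

lemma kappa_image_ball: "\<rho> \<le> r \<Longrightarrow> \<kappa> ` geodesic_ball A g x \<rho> = ball 0 \<rho>"
  unfolding expmap_image[symmetric] image_image
  using kappa_expmap by (subst image_cong[OF refl, of _ _ "\<lambda>y. y"]) auto

lemma kappa_image: "\<kappa> ` U = ball 0 r"
  by (rule kappa_image_ball) simp

lemma inj_kappa: "inj_on \<kappa> U"
  by (rule inj_on_inverseI[of _ expmap]) (rule expmap_kappa)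

lemma inv_kappa: "y \<in> ball 0 r \<Longrightarrow> inv_into U \<kappa> y = expmap y"
proof -
  assume y: "y \<in> ball 0 r"
  then have "expmap y \<in> U" using expmap_image[of r] by blast
  then show ?thesis using inv_into_f_f[OF inj_kappa, of "expmap y"] kappa_expmap[OF y] by simp
qed

text \<open>Normal coordinates belong to the atlas, by its maximality.\<close>

lemma normal_chart: "(U, \<kappa>) \<in> A"
proof -
  have into: "smooth_into A (ball 0 r) expmap"
    using ed unfolding exp_diffeo_ball_def expmap_def by (elim conjE)
  have from_U: "smooth_from A U \<kappa>"
    using ed unfolding exp_diffeo_ball_def by (elim conjE)
  have charts: "is_chart c" if "c \<in> A" for c by (rule atlas_chart[OF ss that])
  have "continuous_on U \<kappa>"
    unfolding continuous_on_eq_continuous_at[OF open_U]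
  proof
    fix u assume u: "u \<in> U"
    obtain c where c: "c \<in> A" "u \<in> fst c" using atlas_covers[OF ss, of u] by blast
    have ch: "is_chart c" using charts c by blast
    have "continuous_on (snd c ` (U \<inter> fst c)) (\<kappa> \<circ> chart_inv c)"
      using from_U c smooth_on_imp_continuous_on unfolding smooth_from_def by blast
    moreover have "continuous_on (U \<inter> fst c) (snd c)"
      using ch unfolding is_chart_def homeomorphism_def by (meson continuous_on_subset inf_le2)
    ultimately have "continuous_on (U \<inter> fst c) ((\<kappa> \<circ> chart_inv c) \<circ> snd c)"
      using continuous_on_compose by blast
    then have "continuous_on (U \<inter> fst c) \<kappa>"
      by (rule continuous_on_eq) (simp add: chart_inv_simps(1)[OF ch])
    moreover have "open (U \<inter> fst c)" using open_U ch unfolding is_chart_def by blast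
    ultimately show "continuous (at u) \<kappa>"
      using u c continuous_on_eq_continuous_at[of "U \<inter> fst c" \<kappa>] by blast
  qed
  moreover have "continuous_on (ball 0 r) expmap"
    using into unfolding smooth_into_def by (elim conjE)
  then have "continuous_on (ball 0 r) (inv_into U \<kappa>)"
    by (rule continuous_on_eq) (simp add: inv_kappa)
  moreover have "inv_into U \<kappa> ` ball 0 r = expmap ` ball 0 r"
    by (rule image_cong) (simp_all add: inv_kappa)
  then have "inv_into U \<kappa> ` ball 0 r = U" unfolding expmap_image .
  moreover have "inv_into U \<kappa> (\<kappa> u) = u" if "u \<in> U" for u
    using inv_into_f_f[OF inj_kappa that] .
  moreover have "\<kappa> (inv_into U \<kappa> y) = y" if "y \<in> ball 0 r" for y
    using kappa_expmap[OF that] inv_kappa[OF that] by simp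
  ultimately have "is_chart (U, \<kappa>)"
    unfolding is_chart_def homeomorphism_def fst_conv snd_conv kappa_image
    using open_U by simp
  moreover have "compatible (U, \<kappa>) c" if c: "c \<in> A" for c
  proof -
    have eq: "{y \<in> ball 0 r. expmap y \<in> fst c} = \<kappa> ` (U \<inter> fst c)"
    proof (intro set_eqI iffI)
      fix y assume "y \<in> {y \<in> ball 0 r. expmap y \<in> fst c}"
      then show "y \<in> \<kappa> ` (U \<inter> fst c)"
        using expmap_image[of r] kappa_expmap by (intro image_eqI[of _ _ "expmap y"]) auto
    next
      fix y assume "y \<in> \<kappa> ` (U \<inter> fst c)"
      then show "y \<in> {y \<in> ball 0 r. expmap y \<in> fst c}"
        using kappa_image expmap_kappa by auto
    qed
    have op: "open (\<kappa> ` (U \<inter> fst c))"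
      using open_chart_image[OF \<open>is_chart (U, \<kappa>)\<close>, of "fst c"] charts[OF c]
      unfolding is_chart_def by (simp add: inf_commute)
    have "smooth_on (\<kappa> ` (U \<inter> fst c)) (snd c \<circ> expmap)"
      using into c unfolding smooth_into_def eq[symmetric] by blast
    then have "smooth_on (\<kappa> ` (U \<inter> fst c)) (snd c \<circ> inv_into U \<kappa>)"
    proof (rule smooth_on_cong[OF op])
      fix y assume "y \<in> \<kappa> ` (U \<inter> fst c)"
      then have "y \<in> ball 0 r" using kappa_image by blast
      then show "(snd c \<circ> expmap) y = (snd c \<circ> inv_into U \<kappa>) y" by (simp add: inv_kappa)
    qed
    moreover have "smooth_on (snd c ` (U \<inter> fst c)) (\<kappa> \<circ> chart_inv c)"
      using from_U c unfolding smooth_from_def by blast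
    ultimately show ?thesis
      unfolding compatible_def transition_def by simp
  qed
  ultimately show ?thesis by (rule atlas_maximal[OF ss])
qed

end

section \<open>Transfer of Lebesgue spaces along a chart\<close>

text \<open>A continuous bijection \<open>\<theta>\<close> of an open set \<open>U\<close> onto an open set \<open>B\<close> of Euclidean space, with
  measurable inverse \<open>\<psi>\<close>, which transforms the measure on \<open>U\<close> into the measure with density \<open>J\<close> on \<open>B\<close>.
  Smoothness plays no role at this level. All three functions are total; their values off \<open>U\<close> and \<open>B\<close> are arbitrary
  subject to measurability and \<open>J > 0\<close>.\<close>

locale scaled_chart =
  fixes \<nu> :: "'a::topological_space measure" and U :: "'a set" and B :: "(real^'d::finite) set"
    and \<theta> :: "'a \<Rightarrow> real^'d" and \<psi> :: "real^'d \<Rightarrow> 'a" and J :: "real^'d \<Rightarrow> real"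
  assumes sets_nu: "sets \<nu> = sets borel"
    and open_U: "open U" and open_B: "open B"
    and theta_measurable: "\<theta> \<in> borel_measurable borel"
    and psi_measurable: "\<psi> \<in> borel_measurable borel"
    and J_measurable: "J \<in> borel_measurable borel"
    and theta_continuous: "continuous_on U \<theta>"
    and theta_in: "u \<in> U \<Longrightarrow> \<theta> u \<in> B" and psi_theta: "u \<in> U \<Longrightarrow> \<psi> (\<theta> u) = u"
    and psi_in: "z \<in> B \<Longrightarrow> \<psi> z \<in> U" and theta_psi: "z \<in> B \<Longrightarrow> \<theta> (\<psi> z) = z"
    and J_pos: "J z > 0"
    and nn_integral_chart: "f \<in> borel_measurable borel \<Longrightarrow>
      (\<integral>\<^sup>+u. f u * indicator U u \<partial>\<nu>) = (\<integral>\<^sup>+z. f (\<psi> z) * ennreal (J z) * indicator B z \<partial>lborel)"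

text \<open>The isometry from \<open>L\<^sup>p\<close> of \<open>B\<close> to \<open>L\<^sup>p\<close> of \<open>U\<close>, extended by zero. In rescaled normal coordinates this is
  the operator \<open>T\<^sup>p\<^sub>x\<close>.\<close>

definition (in scaled_chart) pushed :: "real \<Rightarrow> (real^'d \<Rightarrow> real) \<Rightarrow> 'a \<Rightarrow> real" where
  "pushed p f u = (if u \<in> U then f (\<theta> u) * J (\<theta> u) powr (- 1 / p) else 0)"

context scaled_chart
begin

text \<open>The inverse isometry, from \<open>L\<^sup>p\<close> of \<open>U\<close> to \<open>L\<^sup>p\<close> of \<open>B\<close>, extended by zero.\<close>

definition pulled :: "real \<Rightarrow> ('a \<Rightarrow> real) \<Rightarrow> real^'d \<Rightarrow> real" where
  "pulled p h z = (if z \<in> B then h (\<psi> z) * J z powr (1 / p) else 0)"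

lemma measurable_nu_iff: "f \<in> borel_measurable \<nu> \<longleftrightarrow> f \<in> borel_measurable borel"
  using measurable_cong_sets[OF sets_nu refl] by blast

lemma U_sets [measurable]: "U \<in> sets borel" and B_sets [measurable]: "B \<in> sets borel"
  using open_U open_B by auto

lemma pushed_measurable: "f \<in> borel_measurable borel \<Longrightarrow> pushed p f \<in> borel_measurable borel"
proof -
  note [measurable] = theta_measurable J_measurable
  assume [measurable]: "f \<in> borel_measurable borel"
  show ?thesis unfolding pushed_def by measurable
qed

lemma pulled_measurable: "h \<in> borel_measurable borel \<Longrightarrow> pulled p h \<in> borel_measurable borel"
proof -
  note [measurable] = psi_measurable J_measurable
  assume [measurable]: "h \<in> borel_measurable borel"
  show ?thesis unfolding pulled_def by measurable
qed

lemma pulled_zero: "z \<notin> B \<Longrightarrow> pulled p h z = 0"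
  by (simp add: pulled_def)

lemma pulled_pushed: "z \<in> B \<Longrightarrow> pulled p (pushed p f) z = f z"
  using psi_in[of z] theta_psi[of z] J_pos[of z]
  by (simp add: pulled_def pushed_def powr_add[symmetric])

lemma pulled_diff: "pulled p (\<lambda>u. h u - k u) z = pulled p h z - pulled p k z"
  by (simp add: pulled_def algebra_simps)

lemma lp_int_pulled:
  assumes p: "p > 0" and h: "h \<in> borel_measurable borel" "\<And>u. u \<notin> U \<Longrightarrow> h u = 0"
  shows "lp_int p \<nu> h = lp_int p lborel (pulled p h)"
proof -
  have "lp_int p \<nu> h = (\<integral>\<^sup>+u. ennreal (\<bar>h u\<bar> powr p) * indicator U u \<partial>\<nu>)"
    unfolding lp_int_def using h(2) p by (intro nn_integral_cong) (auto simp: indicator_def)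
  also have "\<dots> = (\<integral>\<^sup>+z. ennreal (\<bar>h (\<psi> z)\<bar> powr p) * ennreal (J z) * indicator B z \<partial>lborel)"
    using h by (intro nn_integral_chart) measurable
  also have "\<dots> = lp_int p lborel (pulled p h)"
    unfolding lp_int_def
  proof (intro nn_integral_cong)
    fix z
    have "\<bar>h (\<psi> z)\<bar> powr p * J z = \<bar>h (\<psi> z) * J z powr (1 / p)\<bar> powr p"
      using p J_pos[of z] by (simp add: abs_mult powr_mult powr_powr)
    then show "ennreal (\<bar>h (\<psi> z)\<bar> powr p) * ennreal (J z) * indicator B z = ennreal (\<bar>pulled p h z\<bar> powr p)"
      using J_pos[of z] p by (simp add: pulled_def ennreal_mult[symmetric] indicator_def)
  qed
  finally show ?thesis .
qed

lemma pushed_zero: "u \<notin> U \<Longrightarrow> pushed p f u = 0"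
  by (simp add: pushed_def)

lemma pushed_Lp:
  assumes p: "p > 0" and f: "f \<in> Lp p lborel" "\<And>z. z \<notin> B \<Longrightarrow> f z = 0"
  shows "pushed p f \<in> Lp p \<nu>"
proof -
  have m: "f \<in> borel_measurable borel" using Lp_measurable[OF f(1)] by simp
  have "pulled p (pushed p f) = f"
    using pulled_pushed pulled_zero f(2) by (metis ext)
  then have "lp_int p \<nu> (pushed p f) = lp_int p lborel f"
    using lp_int_pulled[OF p pushed_measurable[OF m] pushed_zero] by simp
  then show ?thesis
    using f(1) pushed_measurable[OF m] p by (simp add: Lp_iff measurable_nu_iff)
qed

lemma chart_measure: "density \<nu> (indicator U) = distr (density lborel (\<lambda>z. ennreal (J z) * indicator B z)) borel \<psi>"
proof (rule measure_eqI)
  show "sets (density \<nu> (indicator U)) =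
      sets (distr (density lborel (\<lambda>z. ennreal (J z) * indicator B z)) borel \<psi>)"
    using sets_nu by simp
next
  fix C assume "C \<in> sets (density \<nu> (indicator U))"
  then have C: "C \<in> sets borel" using sets_nu by simp
  have [measurable]: "indicator U \<in> borel_measurable \<nu>" "C \<in> sets \<nu>" using C sets_nu by simp_all
  have D: "(\<lambda>z. ennreal (J z) * indicator B z) \<in> borel_measurable lborel" using J_measurable by measurable
  have pC: "\<psi> -` C \<in> sets lborel" using measurable_sets[OF psi_measurable C] by simp
  have "emeasure (density \<nu> (indicator U)) C = (\<integral>\<^sup>+u. indicator C u * indicator U u \<partial>\<nu>)"
    by (subst emeasure_density) (auto simp: mult.commute)
  also have "\<dots> = (\<integral>\<^sup>+z. indicator C (\<psi> z) * ennreal (J z) * indicator B z \<partial>lborel)"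
    using C by (intro nn_integral_chart) simp
  also have "\<dots> = (\<integral>\<^sup>+z. (ennreal (J z) * indicator B z) * indicator (\<psi> -` C) z \<partial>lborel)"
    by (intro nn_integral_cong) (auto simp: indicator_def)
  also have "\<dots> = emeasure (density lborel (\<lambda>z. ennreal (J z) * indicator B z)) (\<psi> -` C)"
    using D pC by (subst emeasure_density) auto
  also have "\<dots> = emeasure (distr (density lborel (\<lambda>z. ennreal (J z) * indicator B z)) borel \<psi>) C"
    using psi_measurable C by (subst emeasure_distr) (auto cong: measurable_cong_sets)
  finally show "emeasure (density \<nu> (indicator U)) C =
      emeasure (distr (density lborel (\<lambda>z. ennreal (J z) * indicator B z)) borel \<psi>) C" .
qed

lemma integral_chart:
  fixes f :: "'a \<Rightarrow> real"
  assumes f: "f \<in> borel_measurable borel" and z: "\<And>u. u \<notin> U \<Longrightarrow> f u = 0"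
  shows "(\<integral>u. f u \<partial>\<nu>) = (\<integral>z. (if z \<in> B then f (\<psi> z) * J z else 0) \<partial>lborel)"
proof -
  have e: "(\<lambda>z. ennreal (J z) * indicator B z) = (\<lambda>z. ennreal (J z * indicator B z))"
    using J_pos by (auto simp: indicator_def fun_eq_iff)
  have e': "(indicator U :: 'a \<Rightarrow> ennreal) = (\<lambda>u. ennreal (indicator U u))"
    by (simp add: fun_eq_iff indicator_def)
  have [measurable]: "f \<in> borel_measurable \<nu>" "indicator U \<in> borel_measurable \<nu>"
    using f sets_nu measurable_nu_iff by simp_all
  have "(\<integral>u. f u \<partial>\<nu>) = (\<integral>u. indicator U u *\<^sub>R f u \<partial>\<nu>)"
    using z by (intro Bochner_Integration.integral_cong) (auto simp: indicator_def)
  also have "\<dots> = (\<integral>u. f u \<partial>density \<nu> (indicator U))"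
    unfolding e' by (subst integral_density) auto
  also have "\<dots> = (\<integral>z. f (\<psi> z) \<partial>density lborel (\<lambda>z. ennreal (J z) * indicator B z))"
    unfolding chart_measure using psi_measurable f
    by (subst integral_distr) (auto cong: measurable_cong_sets)
  also have "\<dots> = (\<integral>z. (J z * indicator B z) *\<^sub>R f (\<psi> z) \<partial>lborel)"
    unfolding e using psi_measurable f J_measurable J_pos
    by (subst integral_density) (auto simp: less_imp_le intro!: measurable_compose[OF psi_measurable])
  also have "\<dots> = (\<integral>z. (if z \<in> B then f (\<psi> z) * J z else 0) \<partial>lborel)"
    by (intro Bochner_Integration.integral_cong) (auto simp: indicator_def)
  finally show ?thesis .
qed

text \<open>The isometries for conjugate exponents are dual to each other.\<close>

lemma pairing:
  assumes pq: "1 < p" "1 / p + 1 / q = 1"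
    and h: "h \<in> borel_measurable borel" and f: "f \<in> borel_measurable borel"
  shows "(\<integral>u. h u * pushed q f u \<partial>\<nu>) = (\<integral>z. pulled p h z * f z \<partial>lborel)"
proof -
  have "(\<integral>u. h u * pushed q f u \<partial>\<nu>) =
      (\<integral>z. (if z \<in> B then h (\<psi> z) * pushed q f (\<psi> z) * J z else 0) \<partial>lborel)"
    using h pushed_measurable[OF f] by (intro integral_chart) (auto simp: pushed_zero)
  also have "\<dots> = (\<integral>z. pulled p h z * f z \<partial>lborel)"
  proof (intro Bochner_Integration.integral_cong refl)
    fix z
    have "J z powr (- 1 / q) * J z = J z powr (- 1 / q) * J z powr 1"
      using J_pos[of z] by simp
    also have "\<dots> = J z powr (- 1 / q + 1)" by (rule powr_add[symmetric])
    also have "- 1 / q + 1 = 1 / p" using pq by (simp add: algebra_simps)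
    finally show "(if z \<in> B then h (\<psi> z) * pushed q f (\<psi> z) * J z else 0) = pulled p h z * f z"
      using psi_in[of z] theta_psi[of z] by (simp add: pushed_def pulled_def ac_simps)
  qed
  finally show ?thesis .
qed

end

text \<open>A single member \<open>P\<close> of the decomposition of identity, with adjoint \<open>Pa\<close>. It acts within the compact set
  \<open>K\<close>, whose image lies in the unit cube, while \<open>B\<close> contains the supports of all frame functions. The
  \<open>p\<close>-th power of the norm of \<open>P\<close> is at most \<open>D\<close>.\<close>

locale localized_frame = scaled_chart \<nu> U B \<theta> \<psi> J + local_frame m j0 l \<epsilon> \<Gamma> W
  for \<nu> :: "'a::t2_space measure" and U and B :: "(real^'d::finite) set" and \<theta> \<psi> J m j0 l \<epsilon> \<Gamma>
    and W :: "'d wavelet_index \<Rightarrow> real^'d \<Rightarrow> real" +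
  fixes p q D :: real and P Pa :: "('a \<Rightarrow> real) \<Rightarrow> 'a \<Rightarrow> real" and K :: "'a set"
  assumes pq: "1 < p" "1 / p + 1 / q = 1"
    and B_large: "open_cube (1 + \<epsilon>) \<subseteq> B"
    and P_lin: "\<And>f f' c x. P (\<lambda>x. c * f x + f' x) x = c * P f x + P f' x"
    and K: "compact K" "K \<subseteq> U" "\<theta> ` K \<subseteq> open_cube 1"
    and P_local: "\<And>f f'. (\<And>y. y \<in> K \<Longrightarrow> f y = f' y) \<Longrightarrow> P f = P f'"
    and P_supp: "\<And>f y. y \<notin> K \<Longrightarrow> P f y = 0"
    and proj: "Lp_projection p \<nu> P" and adj: "Lp_adjoint p q \<nu> P Pa"
    and D: "D > 0" and P_bound: "\<And>f. f \<in> Lp p \<nu> \<Longrightarrow> lp_int p \<nu> (P f) \<le> ennreal D * lp_int p \<nu> f"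
begin

lemma p_pos: "p > 0" and q_gt_1: "q > 1"
  using pq conjugate_exponent_gt_1[OF pq] by auto

lemma P_Lp: "f \<in> Lp p \<nu> \<Longrightarrow> P f \<in> Lp p \<nu>"
  and P_idem: "f \<in> Lp p \<nu> \<Longrightarrow> AE x in \<nu>. P (P f) x = P f x"
  using proj unfolding Lp_projection_def by blast+

lemma P_zero: "P (\<lambda>_. 0) x = 0"
  using P_lin[of 1 "\<lambda>_. 0" "\<lambda>_. 0" x] by simp

lemma P_diff: "P (\<lambda>x. f x - g x) x = P f x - P g x"
  using P_lin[of "-1" g f x] by simp

lemma P_sum: "finite F \<Longrightarrow> P (\<lambda>x. \<Sum>i\<in>F. c i * f i x) x = (\<Sum>i\<in>F. c i * P (f i) x)"
proof (induction F rule: finite_induct)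
  case (insert i F)
  then show ?case using P_lin[of "c i" "f i" "\<lambda>x. \<Sum>i\<in>F. c i * f i x" x] by simp
qed (simp add: P_zero)

lemma W_zero_B: "i \<in> I \<Longrightarrow> z \<notin> B \<Longrightarrow> W i z = 0"
  using W_zero B_large by blast

lemma pushed_W_Lp: "s > 0 \<Longrightarrow> i \<in> I \<Longrightarrow> pushed s (W i) \<in> Lp s \<nu>"
  using W_Lp W_zero_B by (intro pushed_Lp) auto

lemma pushed_psum: "pushed p (psum u F) x = (\<Sum>i\<in>F. coef u i * pushed p (W i) x)"
  by (simp add: pushed_def psum_def sum_distrib_right mult.assoc)

context
  fixes h :: "'a \<Rightarrow> real" assumes h: "h \<in> Lp p \<nu>"
begin

text \<open>The piece \<open>P h\<close> of \<open>h\<close> in Euclidean coordinates.\<close>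

definition "local_part = pulled p (P h)"

lemma Ph_measurable: "P h \<in> borel_measurable borel"
  using Lp_measurable[OF P_Lp[OF h]] measurable_nu_iff by blast

lemma lp_int_local_part: "lp_int p lborel local_part = lp_int p \<nu> (P h)"
  unfolding local_part_def using Ph_measurable P_supp K
  by (intro lp_int_pulled[symmetric] p_pos) blast+

lemma local_part_Lp: "local_part \<in> Lp p lborel"
  using lp_int_local_part P_Lp[OF h] pulled_measurable[OF Ph_measurable, of p] p_pos
  by (simp add: Lp_iff local_part_def)

lemma compact_theta_K: "compact (\<theta> ` K)"
  using K continuous_on_subset[OF theta_continuous K(2)] by (intro compact_continuous_image)

lemma ess_supp_local_part: "ess_supp local_part \<subseteq> open_cube 1"
proof -
  have "local_part z = 0" if "z \<notin> \<theta> ` K" for z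
  proof (cases "z \<in> B")
    case True
    then have "\<psi> z \<notin> K" using that theta_psi[OF True] by (metis imageI)
    then show ?thesis using P_supp by (simp add: local_part_def pulled_def)
  qed (simp add: local_part_def pulled_zero)
  then have "ess_supp local_part \<subseteq> \<theta> ` K"
    using compact_theta_K compact_imp_closed by (intro ess_supp_subset) auto
  then show ?thesis using K by blast
qed

lemma coef_local_part:
  assumes i: "i \<in> I"
  shows "(\<integral>x. Pa (pushed q (W i)) x * h x \<partial>\<nu>) = coef local_part i"
proof -
  have "pushed q (W i) \<in> Lp q \<nu>" using pushed_W_Lp[of q i] i q_gt_1 by simp
  then have "(\<integral>x. P h x * pushed q (W i) x \<partial>\<nu>) = (\<integral>x. h x * Pa (pushed q (W i)) x \<partial>\<nu>)"
    using adj h unfolding Lp_adjoint_def by blast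
  then show ?thesis
    using pairing[OF pq Ph_measurable W_measurable[OF i]]
    by (simp add: coef_def local_part_def mult.commute)
qed

text \<open>The error of a partial sum for \<open>P h\<close> is \<open>P\<close> applied to the transported Euclidean error, because \<open>P\<close> is
  a projection. As \<open>P\<close> depends only on the values on \<open>K\<close>, the Euclidean error counts only on the image
  of \<open>K\<close>.\<close>

lemma localized_error:
  assumes F: "finite F" "F \<subseteq> I"
  shows "lp_int p \<nu> (\<lambda>x. P h x - (\<Sum>i\<in>F. coef local_part i * P (pushed p (W i)) x)) \<le>
    ennreal D * (\<integral>\<^sup>+z. ennreal (\<bar>local_part z - psum local_part F z\<bar> powr p) * indicator (\<theta> ` K) z \<partial>lborel)"
proof -
  let ?g = "\<lambda>x. P h x - pushed p (psum local_part F) x"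
  define g' where "g' x = (if x \<in> K then ?g x else 0)" for x
  have K_sets [measurable]: "K \<in> sets borel" by (rule borel_closed[OF compact_imp_closed[OF K(1)]])
  have psum0: "psum local_part F z = 0" if "z \<notin> B" for z
    unfolding psum_def using W_zero_B[OF _ that] F by (intro sum.neutral) auto
  have gL: "?g \<in> Lp p \<nu>"
    using pushed_Lp[OF p_pos psum_Lp[OF p_pos F(2)] psum0] P_Lp[OF h] by (intro Lp_diff p_pos)
  then have gm: "?g \<in> borel_measurable borel" using Lp_measurable measurable_nu_iff by blast
  have g'm: "g' \<in> borel_measurable borel" unfolding g'_def using gm by measurable
  have g'L: "g' \<in> Lp p \<nu>"
    by (rule Lp_mono[OF p_pos gL]) (use g'm measurable_nu_iff g'_def in auto)
  have "P g' x = P (P h) x - (\<Sum>i\<in>F. coef local_part i * P (pushed p (W i)) x)" for x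
  proof -
    have "P g' = P ?g" by (rule P_local) (simp add: g'_def)
    then show ?thesis
      using P_sum[OF F(1), of "coef local_part" "\<lambda>i. pushed p (W i)" x] by (simp add: P_diff pushed_psum)
  qed
  then have "AE x in \<nu>. P h x - (\<Sum>i\<in>F. coef local_part i * P (pushed p (W i)) x) = P g' x"
    using P_idem[OF h] by auto
  then have "lp_int p \<nu> (\<lambda>x. P h x - (\<Sum>i\<in>F. coef local_part i * P (pushed p (W i)) x)) = lp_int p \<nu> (P g')"
    by (rule lp_int_cong_AE)
  also have "\<dots> \<le> ennreal D * lp_int p \<nu> g'" by (rule P_bound[OF g'L])
  also have "lp_int p \<nu> g' = lp_int p lborel (pulled p g')"
    using g'm K by (intro lp_int_pulled p_pos) (auto simp: g'_def)
  also have "\<dots> = (\<integral>\<^sup>+z. ennreal (\<bar>local_part z - psum local_part F z\<bar> powr p) * indicator (\<theta> ` K) z \<partial>lborel)"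
    unfolding lp_int_def
  proof (intro nn_integral_cong)
    fix z
    show "ennreal (\<bar>pulled p g' z\<bar> powr p) =
      ennreal (\<bar>local_part z - psum local_part F z\<bar> powr p) * indicator (\<theta> ` K) z"
    proof (cases "z \<in> \<theta> ` K")
      case True
      then obtain x where x: "x \<in> K" "z = \<theta> x" by blast
      then have z: "z \<in> B" "\<psi> z \<in> K" using K theta_in psi_theta by auto
      then have "pulled p g' z = pulled p ?g z" by (simp add: pulled_def g'_def)
      also have "\<dots> = local_part z - psum local_part F z"
        using pulled_diff[of p "P h" "pushed p (psum local_part F)" z] pulled_pushed[OF z(1)] by (simp add: local_part_def)
      finally show ?thesis using True by simp
    next
      case False
      have "pulled p g' z = 0"
      proof (cases "z \<in> B")
        case True
        then have "\<psi> z \<notin> K" using False theta_psi[OF True] by (metis imageI)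
        then show ?thesis by (simp add: pulled_def g'_def)
      qed (simp add: pulled_zero)
      then show ?thesis using False p_pos by simp
    qed
  qed
  finally show ?thesis .
qed

lemma localized_convergence:
  assumes e: "e > 0"
  shows "\<exists>F. finite F \<and> F \<subseteq> I \<and> (\<forall>F'. finite F' \<and> F \<subseteq> F' \<and> F' \<subseteq> I \<longrightarrow>
    lp_int p \<nu> (\<lambda>x. P h x - (\<Sum>i\<in>F'. coef local_part i * P (pushed p (W i)) x)) \<le> ennreal e)"
proof -
  have "uncond_sum (Lp_norm p lborel) I (\<lambda>i y. coef local_part i * W i y) local_part"
    by (rule frame_Lp(2)[OF pq(1) local_part_Lp ess_supp_local_part])
  note conv = this[unfolded uncond_sum_Lp_iff[OF p_pos], rule_format]
  have "e / D > 0" using e D by simp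
  from conv[OF this] have "\<exists>F. finite F \<and> F \<subseteq> I \<and> (\<forall>F'. finite F' \<and> F \<subseteq> F' \<and> F' \<subseteq> I \<longrightarrow>
      lp_int p lborel (\<lambda>y. local_part y - psum local_part F' y) < ennreal (e / D))"
    unfolding psum_def .
  then obtain F where F: "finite F" "F \<subseteq> I" and F_conv: "\<forall>F'. finite F' \<and> F \<subseteq> F' \<and> F' \<subseteq> I \<longrightarrow>
      lp_int p lborel (\<lambda>y. local_part y - psum local_part F' y) < ennreal (e / D)"
    by (elim exE conjE)
  show ?thesis
  proof (intro exI[of _ F] conjI F allI impI)
    fix F' assume F': "finite F' \<and> F \<subseteq> F' \<and> F' \<subseteq> I"
    have "lp_int p \<nu> (\<lambda>x. P h x - (\<Sum>i\<in>F'. coef local_part i * P (pushed p (W i)) x)) \<le>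
      ennreal D * (\<integral>\<^sup>+z. ennreal (\<bar>local_part z - psum local_part F' z\<bar> powr p) * indicator (\<theta> ` K) z \<partial>lborel)"
      using F' by (intro localized_error) auto
    also have "\<dots> \<le> ennreal D * lp_int p lborel (\<lambda>y. local_part y - psum local_part F' y)"
      unfolding lp_int_def by (intro mult_left_mono nn_integral_mono) (auto simp: indicator_def)
    also have "\<dots> \<le> ennreal D * ennreal (e / D)"
      using F_conv[rule_format, OF F'] by (intro mult_left_mono) auto
    also have "\<dots> = ennreal e" using D e by (simp add: ennreal_mult[symmetric])
    finally show "lp_int p \<nu> (\<lambda>x. P h x - (\<Sum>i\<in>F'. coef local_part i * P (pushed p (W i)) x)) \<le> ennreal e" .
  qed
qed

lemma localized_uniform_bound:
  assumes C: "C > 0" "\<And>F K. finite F \<Longrightarrow> F \<subseteq> I \<Longrightarrow> compact K \<Longrightarrow> K \<subseteq> open_cube 1 \<Longrightarrow>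
     (\<integral>\<^sup>+x. ennreal (\<bar>psum local_part F x\<bar> powr p) * indicator K x \<partial>lborel) \<le> ennreal C * lp_int p lborel local_part"
    and F: "finite F" "F \<subseteq> I"
  shows "lp_int p \<nu> (\<lambda>x. P h x - (\<Sum>i\<in>F. coef local_part i * P (pushed p (W i)) x)) \<le>
    ennreal (D * (2 powr p * (1 + C))) * lp_int p \<nu> (P h)"
proof -
  have [measurable]: "\<theta> ` K \<in> sets borel" by (rule borel_closed[OF compact_imp_closed[OF compact_theta_K]])
  have [measurable]: "local_part \<in> borel_measurable borel" "psum local_part F \<in> borel_measurable borel"
    using Lp_measurable[OF local_part_Lp] borel_measurable_continuous_onI[OF psum_continuous[OF F(2)]] by auto
  let ?S = "\<lambda>z. indicator (\<theta> ` K) z * psum local_part F z"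
  have S: "lp_int p lborel ?S = (\<integral>\<^sup>+x. ennreal (\<bar>psum local_part F x\<bar> powr p) * indicator (\<theta> ` K) x \<partial>lborel)"
    unfolding lp_int_def using p_pos by (intro nn_integral_cong) (auto simp: indicator_def)
  have "(\<integral>\<^sup>+z. ennreal (\<bar>local_part z - psum local_part F z\<bar> powr p) * indicator (\<theta> ` K) z \<partial>lborel) \<le>
      lp_int p lborel (\<lambda>z. local_part z - ?S z)"
    unfolding lp_int_def by (intro nn_integral_mono) (auto simp: indicator_def)
  also have "\<dots> \<le> ennreal (2 powr p) * (lp_int p lborel local_part + lp_int p lborel ?S)"
    by (intro lp_int_diff_le p_pos) measurable
  also have "\<dots> \<le> ennreal (2 powr p) * (lp_int p lborel local_part + ennreal C * lp_int p lborel local_part)"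
    unfolding S using C(2)[OF F compact_theta_K K(3)] by (intro mult_left_mono add_mono) auto
  also have "\<dots> = ennreal (2 powr p * (1 + C)) * lp_int p \<nu> (P h)"
    using C(1) unfolding lp_int_local_part
    by (subst ennreal_mult) (auto simp: distrib_right mult.assoc)
  finally have "ennreal D * (\<integral>\<^sup>+z. ennreal (\<bar>local_part z - psum local_part F z\<bar> powr p) * indicator (\<theta> ` K) z \<partial>lborel) \<le>
      ennreal D * (ennreal (2 powr p * (1 + C)) * lp_int p \<nu> (P h))"
    by (intro mult_left_mono) auto
  also have "\<dots> = ennreal (D * (2 powr p * (1 + C))) * lp_int p \<nu> (P h)"
    using D C(1) by (subst ennreal_mult) (auto simp: mult.assoc)
  finally show ?thesis using localized_error[OF F] by (rule order_trans[rotated])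
qed

end
end

section \<open>Rescaled normal coordinates\<close>

lemma nn_integral_lborel_scale:
  fixes f :: "real^'d::finite \<Rightarrow> ennreal"
  assumes "f \<in> borel_measurable borel" "c > 0"
  shows "(\<integral>\<^sup>+y. f y \<partial>lborel) = (\<integral>\<^sup>+z. f (c *\<^sub>R z) * ennreal (c ^ CARD('d)) \<partial>lborel)"
proof -
  have "(\<integral>\<^sup>+y. f y \<partial>lborel) =
    (\<integral>\<^sup>+y. f y \<partial>density (distr lborel borel (\<lambda>z. 0 + c *\<^sub>R z)) (\<lambda>_. \<bar>c\<bar> ^ DIM(real^'d)))"
    using lborel_affine[of c "0::real^'d"] assms by simp
  also have "\<dots> = (\<integral>\<^sup>+z. f (c *\<^sub>R z) * ennreal (c ^ CARD('d)) \<partial>lborel)"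
    using assms by (simp add: nn_integral_density nn_integral_distr mult.commute)
  finally show ?thesis .
qed

context normal_ball
begin

text \<open>Normal coordinates rescaled by the factor \<open>scl\<close>, so that the image of the ball of radius \<open>r\<close> is the ball
  of radius \<open>3 \<surd>d\<close> and that of the ball of radius \<open>r / (3 \<surd>d)\<close> is the unit ball. Here \<open>\<theta>\<close> is the rescaled
  coordinate map, \<open>\<psi>\<close> its inverse, \<open>wt\<close> the density of the Riemannian measure in normal coordinates and
  \<open>Jac\<close> its density in rescaled coordinates.\<close>

definition "scl = 3 * sqrt (real CARD('d)) / r"
definition "\<theta> u = (if u \<in> U then scl *\<^sub>R \<kappa> u else 0)"
definition "\<psi> z = (if z \<in> ball 0 (3 * sqrt (real CARD('d))) then expmap (z /\<^sub>R scl) else x)"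
definition "wt y = (if y \<in> ball 0 r then sqrt (det (metric_matrix A g (U, \<kappa>) (expmap y))) else 1)"
definition "Jac z = wt (z /\<^sub>R scl) / scl ^ CARD('d)"

lemma scl_pos: "scl > 0"
  unfolding scl_def using r_pos by simp

lemma scl_r: "scl * r = 3 * sqrt (real CARD('d))"
  unfolding scl_def using r_pos by simp

lemma ball_scl: "(z :: real^'d) /\<^sub>R scl \<in> ball 0 \<rho> \<longleftrightarrow> z \<in> ball 0 (scl * \<rho>)"
  unfolding mem_ball_0 norm_scaleR using scl_pos by (simp add: field_simps)

lemma det_pos:
  assumes "\<And>y. tangent_isometry A g y (I y)" "u \<in> U"
  shows "det (metric_matrix A g (U, \<kappa>) u) > 0"
  by (rule det_metric_matrix_pos[OF ss normal_chart _ assms(1)]) (simp add: assms(2))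

lemma continuous_expmap: "continuous_on (ball 0 r) expmap"
  using ed unfolding exp_diffeo_ball_def expmap_def smooth_into_def by (elim conjE)

lemma continuous_kappa: "continuous_on U \<kappa>"
  using atlas_chart[OF ss normal_chart] unfolding is_chart_def homeomorphism_def by simp

lemma wt_measurable: "wt \<in> borel_measurable borel"
proof -
  have "continuous_on (ball 0 r) (\<lambda>y. det (metric_matrix A g (U, \<kappa>) (inv_into U \<kappa> y)))"
    using continuous_det_metric[OF rm normal_chart] by (simp add: kappa_image)
  then have "continuous_on (ball 0 r) (\<lambda>y. det (metric_matrix A g (U, \<kappa>) (expmap y)))"
    by (rule continuous_on_eq) (simp add: inv_kappa)
  then show ?thesis
    unfolding wt_def by (intro borel_measurable_continuous_on_if continuous_intros) auto
qed

text \<open>The defining property of the Riemannian measure, for the chart given by normal coordinates.\<close>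

lemma emeasure_nu_U:
  assumes nu: "riemannian_measure A g \<nu>" and C: "C \<in> sets borel" "C \<subseteq> U"
  shows "emeasure \<nu> C = (\<integral>\<^sup>+y. indicator {y \<in> ball 0 r. expmap y \<in> C} y * ennreal (wt y) \<partial>lborel)"
proof -
  have im: "\<kappa> ` C = {y \<in> ball 0 r. expmap y \<in> C}"
  proof (intro set_eqI iffI)
    fix y assume "y \<in> \<kappa> ` C"
    then obtain u where u: "u \<in> C" "y = \<kappa> u" by blast
    have "\<kappa> u \<in> ball 0 r" using kappa_image u C by blast
    then show "y \<in> {y \<in> ball 0 r. expmap y \<in> C}" using u expmap_kappa C by auto
  next
    fix y assume "y \<in> {y \<in> ball 0 r. expmap y \<in> C}"
    then show "y \<in> \<kappa> ` C" using kappa_expmap by (intro image_eqI[of _ _ "expmap y"]) auto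
  qed
  have "emeasure \<nu> C = (\<integral>\<^sup>+ y. indicator (\<kappa> ` C) y *
      ennreal (sqrt (det (metric_matrix A g (U, \<kappa>) (inv_into U \<kappa> y)))) \<partial>lborel)"
    using nu normal_chart C unfolding riemannian_measure_def by fastforce
  also have "\<dots> = (\<integral>\<^sup>+y. indicator {y \<in> ball 0 r. expmap y \<in> C} y * ennreal (wt y) \<partial>lborel)"
    unfolding im by (rule nn_integral_cong) (auto simp: indicator_def wt_def inv_kappa)
  finally show ?thesis .
qed

lemma nn_integral_nu_U:
  assumes nu: "riemannian_measure A g \<nu>" and f: "f \<in> borel_measurable borel"
  shows "(\<integral>\<^sup>+u. f u * indicator U u \<partial>\<nu>) =
    (\<integral>\<^sup>+y. f (expmap y) * ennreal (wt y) * indicator (ball 0 r) y \<partial>lborel)"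
proof -
  define E where "E y = (if y \<in> ball 0 r then expmap y else x)" for y
  have E: "E \<in> borel_measurable borel"
    unfolding E_def using continuous_expmap
    by (intro borel_measurable_continuous_on_if continuous_intros) auto
  have sn: "sets \<nu> = sets borel" using nu unfolding riemannian_measure_def by (elim conjE)
  have U: "U \<in> sets borel" using open_U by simp
  have [measurable]: "ball (0::real^'d) r \<in> sets borel" by simp
  define D where "D y = ennreal (wt y) * indicator (ball 0 r) y" for y
  have D: "D \<in> borel_measurable borel"
    unfolding D_def using wt_measurable by measurable
  have "density \<nu> (indicator U) = distr (density lborel D) borel E"
  proof (rule measure_eqI)
    show "sets (density \<nu> (indicator U)) = sets (distr (density lborel D) borel E)"
      using sn by simp
  next
    fix C assume "C \<in> sets (density \<nu> (indicator U))"
    then have C: "C \<in> sets borel" using sn by simp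
    have EC: "E -` C \<in> sets borel" using measurable_sets[OF E C] by simp
    have "emeasure (density \<nu> (indicator U)) C = emeasure \<nu> (C \<inter> U)"
      using C U sn by (subst emeasure_density) (auto simp: indicator_inter_arith[symmetric] Int_commute mult.commute cong: measurable_cong_sets)
    also have "\<dots> = (\<integral>\<^sup>+y. indicator {y \<in> ball 0 r. expmap y \<in> C \<inter> U} y * ennreal (wt y) \<partial>lborel)"
      using C U by (intro emeasure_nu_U[OF nu]) auto
    also have "\<dots> = (\<integral>\<^sup>+y. D y * indicator (E -` C) y \<partial>lborel)"
      using expmap_image[of r]
      by (intro nn_integral_cong) (auto simp: D_def E_def indicator_def)
    also have "\<dots> = emeasure (density lborel D) (E -` C)"
      using EC D by (subst emeasure_density) auto
    also have "\<dots> = emeasure (distr (density lborel D) borel E) C"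
      using E C by (subst emeasure_distr) (auto cong: measurable_cong_sets)
    finally show "emeasure (density \<nu> (indicator U)) C = emeasure (distr (density lborel D) borel E) C" .
  qed
  moreover have f': "f \<in> borel_measurable \<nu>" using f sn by (simp cong: measurable_cong_sets)
  have ind: "indicator U \<in> borel_measurable \<nu>" using U sn by simp
  have "(\<integral>\<^sup>+u. f u * indicator U u \<partial>\<nu>) = integral\<^sup>N (density \<nu> (indicator U)) f"
    using f' ind by (subst nn_integral_density) (auto simp: mult.commute)
  moreover have "integral\<^sup>N (distr (density lborel D) borel E) f = (\<integral>\<^sup>+y. D y * f (E y) \<partial>lborel)"
    using E f D by (simp add: nn_integral_distr nn_integral_density cong: measurable_cong_sets)
  moreover have "(\<integral>\<^sup>+y. D y * f (E y) \<partial>lborel) =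
      (\<integral>\<^sup>+y. f (expmap y) * ennreal (wt y) * indicator (ball 0 r) y \<partial>lborel)"
    by (intro nn_integral_cong) (auto simp: D_def E_def indicator_def mult.commute)
  ultimately show ?thesis by simp
qed

lemma scaled_chart:
  assumes nu: "riemannian_measure A g \<nu>" and iso: "\<And>y. tangent_isometry A g y (I y)"
  shows "scaled_chart \<nu> U (ball 0 (3 * sqrt (real CARD('d)))) \<theta> \<psi> Jac"
proof
  let ?R = "3 * sqrt (real CARD('d))"
  show "sets \<nu> = sets borel" using nu unfolding riemannian_measure_def by (elim conjE)
  show "open U" by (rule open_U)
  show "open (ball (0::real^'d) ?R)" by simp
  have ct: "continuous_on U (\<lambda>u. scl *\<^sub>R \<kappa> u)" using continuous_kappa by (intro continuous_intros)
  then show "continuous_on U \<theta>" by (rule continuous_on_eq) (simp add: \<theta>_def)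
  show "\<theta> \<in> borel_measurable borel"
    unfolding \<theta>_def using open_U
    by (intro borel_measurable_continuous_on_if ct continuous_on_const) auto
  have sb: "(z :: real^'d) /\<^sub>R scl \<in> ball 0 r \<longleftrightarrow> z \<in> ball 0 ?R" for z
    using ball_scl[of z r] scl_r by simp
  have cp: "continuous_on (ball 0 ?R) (\<lambda>z. expmap (z /\<^sub>R scl))"
    by (rule continuous_on_compose2[OF continuous_expmap])
      (use sb in \<open>auto intro!: continuous_intros\<close>)
  show psi: "\<psi> \<in> borel_measurable borel"
    unfolding \<psi>_def using cp by (intro borel_measurable_continuous_on_if continuous_intros) auto
  show Jac: "Jac \<in> borel_measurable borel"
    unfolding Jac_def using wt_measurable by measurable
  have "det (metric_matrix A g (U, \<kappa>) (expmap y)) > 0" if "y \<in> ball 0 r" for y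
    by (rule det_pos[OF iso]) (use that expmap_image[of r] in blast)
  then have wt_pos: "wt y > 0" for y by (simp add: wt_def)
  show "Jac z > 0" for z
    unfolding Jac_def using wt_pos scl_pos by simp
  fix u and z :: "real^'d"
  show "u \<in> U \<Longrightarrow> \<theta> u \<in> ball 0 ?R"
    using kappa_image scl_pos sb[of "scl *\<^sub>R \<kappa> u"] unfolding \<theta>_def by auto
  show "u \<in> U \<Longrightarrow> \<psi> (\<theta> u) = u"
    using kappa_image scl_pos sb[of "scl *\<^sub>R \<kappa> u"] expmap_kappa unfolding \<theta>_def \<psi>_def by auto
  show psi_in: "z \<in> ball 0 ?R \<Longrightarrow> \<psi> z \<in> U" for z
    using sb[of z] expmap_image[of r] unfolding \<psi>_def by auto
  show "z \<in> ball 0 ?R \<Longrightarrow> \<theta> (\<psi> z) = z"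
    using psi_in[of z] sb[of z] kappa_expmap[of "z /\<^sub>R scl"] scl_pos unfolding \<psi>_def \<theta>_def by simp
  fix f :: "'a \<Rightarrow> ennreal" assume f: "f \<in> borel_measurable borel"
  have [measurable]: "ball (0::real^'d) r \<in> sets borel" by simp
  define h where "h y = f (\<psi> (scl *\<^sub>R y)) * ennreal (wt y) * indicator (ball 0 r) y" for y
  have h: "h \<in> borel_measurable borel"
    unfolding h_def using f psi wt_measurable by measurable
  have eq: "expmap y = \<psi> (scl *\<^sub>R y)" if "y \<in> ball 0 r" for y
    using sb[of "scl *\<^sub>R y"] that scl_pos unfolding \<psi>_def by simp
  have "(\<integral>\<^sup>+u. f u * indicator U u \<partial>\<nu>) = (\<integral>\<^sup>+y. h y \<partial>lborel)"
    unfolding nn_integral_nu_U[OF nu f]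
    by (intro nn_integral_cong) (auto simp: h_def indicator_def eq)
  also have "\<dots> = (\<integral>\<^sup>+z. h ((1 / scl) *\<^sub>R z) * ennreal ((1 / scl) ^ CARD('d)) \<partial>lborel)"
    using h scl_pos by (intro nn_integral_lborel_scale) auto
  also have "\<dots> = (\<integral>\<^sup>+z. f (\<psi> z) * ennreal (Jac z) * indicator (ball 0 ?R) z \<partial>lborel)"
  proof (intro nn_integral_cong)
    fix z :: "real^'d"
    have "indicator (ball 0 r) ((1 / scl) *\<^sub>R z) = (indicator (ball 0 ?R) z :: ennreal)"
      using sb[of z] unfolding indicator_def by (simp add: inverse_eq_divide)
    moreover have "ennreal (Jac z) = ennreal (wt ((1 / scl) *\<^sub>R z)) * ennreal ((1 / scl) ^ CARD('d))"
      unfolding Jac_def using wt_pos scl_pos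
      by (simp add: ennreal_mult[symmetric] less_imp_le power_one_over inverse_eq_divide)
    ultimately show "h ((1 / scl) *\<^sub>R z) * ennreal ((1 / scl) ^ CARD('d)) =
        f (\<psi> z) * ennreal (Jac z) * indicator (ball 0 ?R) z"
      unfolding h_def using scl_pos by (simp add: ac_simps)
  qed
  finally show "(\<integral>\<^sup>+u. f u * indicator U u \<partial>\<nu>) =
    (\<integral>\<^sup>+z. f (\<psi> z) * ennreal (Jac z) * indicator (ball 0 ?R) z \<partial>lborel)" .
qed

lemma transport_eq_pushed:
  assumes nu: "riemannian_measure A g \<nu>" and iso: "\<And>y. tangent_isometry A g y (I y)"
    and "p > 0"
  shows "transport A g p x r \<iota> f = scaled_chart.pushed U \<theta> Jac p f"
proof
  fix u
  interpret scaled_chart \<nu> U "ball 0 (3 * sqrt (real CARD('d)))" \<theta> \<psi> Jac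
    by (rule scaled_chart[OF nu iso])
  show "transport A g p x r \<iota> f u = pushed p f u"
  proof (cases "u \<in> U")
    case True
    define D where "D = det (metric_matrix A g (U, \<kappa>) u)"
    have D: "D > 0" unfolding D_def by (rule det_pos[OF iso True])
    have "\<kappa> u \<in> ball 0 r" using kappa_image True by blast
    then have "Jac (\<theta> u) = sqrt D / scl ^ CARD('d)"
      using True scl_pos expmap_kappa[OF True] unfolding Jac_def \<theta>_def wt_def D_def by simp
    also have "\<dots> powr (- 1 / p) = D powr (- 1 / (2 * p)) * scl powr (real CARD('d) / p)"
      using D scl_pos
      by (simp add: powr_divide powr_half_sqrt[symmetric] powr_powr powr_realpow[symmetric] powr_minus_divide field_simps)
    finally have "Jac (\<theta> u) powr (- 1 / p) = scl powr (real CARD('d) / p) * \<bar>D\<bar> powr (- 1 / (2 * p))"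
      using D by (simp add: mult.commute)
    then show ?thesis
      using True unfolding transport_def pushed_def Let_def D_def[symmetric] scl_def[symmetric]
      by (simp add: \<theta>_def ac_simps)
  next
    case False
    then show ?thesis by (simp add: transport_def pushed_def Let_def)
  qed
qed

lemma theta_image_ball:
  "\<theta> ` geodesic_ball A g x (r / (3 * sqrt (real CARD('d)))) = ball 0 1"
  and small_ball_subset: "geodesic_ball A g x (r / (3 * sqrt (real CARD('d)))) \<subseteq> U"
proof -
  let ?R = "3 * sqrt (real CARD('d))"
  have "sqrt (real CARD('d)) \<ge> 1" by (simp add: Suc_leI)
  then have R: "?R \<ge> 1" by linarith
  then have le: "r / ?R \<le> r" using r_pos by (simp add: divide_le_eq)
  then show sub: "geodesic_ball A g x (r / ?R) \<subseteq> U"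
    unfolding geodesic_ball_def tangent_ball_def by fastforce
  have "\<theta> ` geodesic_ball A g x (r / ?R) = (*\<^sub>R) scl ` \<kappa> ` geodesic_ball A g x (r / ?R)"
    unfolding image_image by (rule image_cong) (use sub in \<open>auto simp: \<theta>_def\<close>)
  also have "\<dots> = (*\<^sub>R) scl ` ball 0 (r / ?R)" unfolding kappa_image_ball[OF le] ..
  also have "\<dots> = ball 0 1"
    using ball_scale[of scl 0 "r / ?R"] scl_pos scl_r r_pos unfolding scl_def by simp
  finally show "\<theta> ` geodesic_ball A g x (r / ?R) = ball 0 1" .
qed

end

section \<open>Localized operators\<close>

lemma H_operator_lin:
  "H_operator \<phi> \<Phi> V (\<lambda>x. c * f x + f' x) x = c * H_operator \<phi> \<Phi> V f x + H_operator \<phi> \<Phi> V f' x"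
  by (simp add: H_operator_def algebra_simps)

text \<open>A simple operator acts within the compact set consisting of the support of \<open>\<phi>\<close> and its image under \<open>\<Phi>\<close>:
  the former carries the values, the latter the arguments that matter. The identities hold pointwise,
  not merely almost everywhere.\<close>

lemma simple_H_on_props:
  fixes A :: "('a::t2_space, 'd::finite) chart set"
  assumes "S \<in> simple_H_on A \<Omega>"
  shows "(\<forall>f f' c x. S (\<lambda>x. c * f x + f' x) x = c * S f x + S f' x) \<and>
    (\<exists>K. compact K \<and> K \<subseteq> \<Omega> \<and> (\<forall>f x. x \<notin> K \<longrightarrow> S f x = 0) \<and>
      (\<forall>f f'. (\<forall>y\<in>K. f y = f' y) \<longrightarrow> S f = S f'))"
proof -
  obtain \<phi> \<Phi> V V' where S: "S = H_operator \<phi> \<Phi> V" "manifold_diffeo A V V' \<Phi>"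
    "compact (fun_supp \<phi>)" "fun_supp \<phi> \<subseteq> V" "V \<subseteq> \<Omega>" "V' \<subseteq> \<Omega>"
    using assms unfolding simple_H_on_def by blast
  have \<Phi>: "continuous_on V \<Phi>"
    using S(2) unfolding manifold_diffeo_def smooth_map_def by (elim conjE)
  have \<Phi>V: "\<Phi> ` V = V'"
    using S(2) unfolding manifold_diffeo_def bij_betw_def by (elim conjE)
  let ?K = "fun_supp \<phi> \<union> \<Phi> ` fun_supp \<phi>"
  have \<phi>: "\<phi> x = 0" if "x \<notin> fun_supp \<phi>" for x
    using that closure_subset[of "{x. \<phi> x \<noteq> 0}"] unfolding fun_supp_def by blast
  have "compact (\<Phi> ` fun_supp \<phi>)"
    using continuous_on_subset[OF \<Phi> S(4)] S(3) by (rule compact_continuous_image)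
  then have K: "compact ?K" using S(3) by (intro compact_Un)
  have K\<Omega>: "?K \<subseteq> \<Omega>" using S(4-6) \<Phi>V by blast
  show ?thesis
  proof (intro conjI exI[of _ ?K] allI impI)
    show "S (\<lambda>x. c * f x + f' x) x = c * S f x + S f' x" for f f' c x
      unfolding S(1) by (rule H_operator_lin)
    show "S f x = 0" if "x \<notin> ?K" for f x
      using that \<phi>[of x] unfolding S(1) H_operator_def by auto
    show "S f = S f'" if "\<forall>y\<in>?K. f y = f' y" for f f'
    proof
      fix x show "S f x = S f' x"
        using that \<phi>[of x] unfolding S(1) H_operator_def by (cases "x \<in> fun_supp \<phi>") auto
    qed
  qed (fact K, fact K\<Omega>)
qed

lemma H_ops_on_props:
  fixes A :: "('a::t2_space, 'd::finite) chart set"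
  assumes "T \<in> H_ops_on A \<Omega>"
  shows "\<And>f f' c x. T (\<lambda>x. c * f x + f' x) x = c * T f x + T f' x"
    and "\<exists>K. compact K \<and> K \<subseteq> \<Omega> \<and> (\<forall>f x. x \<notin> K \<longrightarrow> T f x = 0) \<and>
      (\<forall>f f'. (\<forall>y\<in>K. f y = f' y) \<longrightarrow> T f = T f')"
proof -
  obtain n a S where S: "\<And>i. i < n \<Longrightarrow> S i \<in> simple_H_on A \<Omega>"
    and T: "T = (\<lambda>f x. \<Sum>i<(n::nat). (a i :: real) * S i f x)"
    using assms unfolding H_ops_on_def by blast
  define Q where "Q i K \<longleftrightarrow> compact K \<and> K \<subseteq> \<Omega> \<and> (\<forall>f x. x \<notin> K \<longrightarrow> S i f x = 0) \<and>
      (\<forall>f f'. (\<forall>y\<in>K. f y = f' y) \<longrightarrow> S i f = S i f')" for i K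
  have "\<forall>i\<in>{..<n}. \<exists>K. Q i K"
  proof
    fix i assume "i \<in> {..<n}"
    then show "\<exists>K. Q i K"
      unfolding Q_def using simple_H_on_props[OF S, of i, THEN conjunct2] by simp
  qed
  then obtain K where "\<forall>i\<in>{..<n}. Q i (K i)" by (rule bchoice[THEN exE])
  then have Q: "Q i (K i)" if "i < n" for i using that by simp
  have K: "compact (K i)" "K i \<subseteq> \<Omega>" "\<And>f x. x \<notin> K i \<Longrightarrow> S i f x = 0"
    "\<And>f f'. (\<And>y. y \<in> K i \<Longrightarrow> f y = f' y) \<Longrightarrow> S i f = S i f'" if "i < n" for i
    using Q[OF that] unfolding Q_def by simp_all
  show "T (\<lambda>x. c * f x + f' x) x = c * T f x + T f' x" for f f' c x
  proof -
    have "S i (\<lambda>x. c * f x + f' x) x = c * S i f x + S i f' x" if "i < n" for i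
      using simple_H_on_props[OF S[OF that], THEN conjunct1] by simp
    then have "T (\<lambda>x. c * f x + f' x) x = (\<Sum>i<n. c * (a i * S i f x) + a i * S i f' x)"
      unfolding T by (intro sum.cong refl) (simp add: algebra_simps)
    then show ?thesis unfolding T by (simp add: sum.distrib sum_distrib_left)
  qed
  show "\<exists>K. compact K \<and> K \<subseteq> \<Omega> \<and> (\<forall>f x. x \<notin> K \<longrightarrow> T f x = 0) \<and>
      (\<forall>f f'. (\<forall>y\<in>K. f y = f' y) \<longrightarrow> T f = T f')"
  proof (intro exI[of _ "\<Union>i<n. K i"] conjI allI impI)
    show "compact (\<Union>i<n. K i)" using K(1) by (intro compact_UN) auto
    show "(\<Union>i<n. K i) \<subseteq> \<Omega>" using K(2) by blast
    show "T f x = 0" if "x \<notin> (\<Union>i<n. K i)" for f x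
      unfolding T using that K(3) by (intro sum.neutral) auto
    show "T f = T f'" if "\<forall>y\<in>\<Union>i<n. K i. f y = f' y" for f f'
    proof -
      have "S i f = S i f'" if "i < n" for i
        using \<open>\<forall>y\<in>\<Union>i<n. K i. f y = f' y\<close> that by (intro K(4)) auto
      then show ?thesis unfolding T by (intro ext sum.cong refl) simp
    qed
  qed
qed

section \<open>Gluing of local expansions\<close>

lemma nn_integral_count_space_tail:
  assumes X: "countable X" and s: "(\<integral>\<^sup>+x. s x \<partial>count_space X) < \<infinity>" and e: "e > 0"
  shows "\<exists>Y. finite Y \<and> Y \<subseteq> X \<and> (\<integral>\<^sup>+x. s x * indicator (X - Y) x \<partial>count_space X) < e"
proof -
  \<comment> \<open>exhaustion of \<open>X\<close> along an enumeration\<close>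
  define Y where "Y n = {x \<in> X. to_nat_on X x < n}" for n
  have fin: "finite (Y n)" for n
  proof (rule finite_imageD)
    show "finite (to_nat_on X ` Y n)" by (rule finite_subset[of _ "{..<n}"]) (auto simp: Y_def)
    show "inj_on (to_nat_on X) (Y n)"
      using inj_on_to_nat_on[OF X] by (rule inj_on_subset) (auto simp: Y_def)
  qed
  have "(\<lambda>n. \<integral>\<^sup>+x. s x * indicator (X - Y n) x \<partial>count_space X) \<longlonglongrightarrow> (\<integral>\<^sup>+x. 0 \<partial>count_space X)"
  proof (rule nn_integral_dominated_convergence[where w=s])
    show "AE x in count_space X. (\<lambda>n. s x * indicator (X - Y n) x) \<longlonglongrightarrow> 0"
    proof (rule AE_I2)
      fix x assume "x \<in> space (count_space X)"
      then have "s x * indicator (X - Y n) x = 0" if "to_nat_on X x < n" for n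
        using that by (simp add: Y_def)
      then have "eventually (\<lambda>n. s x * indicator (X - Y n) x = 0) sequentially"
        using eventually_gt_at_top by (rule eventually_mono[rotated])
      then show "(\<lambda>n. s x * indicator (X - Y n) x) \<longlonglongrightarrow> 0"
        by (rule tendsto_eventually)
    qed
  qed (use s in \<open>auto simp: indicator_def\<close>)
  then have "eventually (\<lambda>n. (\<integral>\<^sup>+x. s x * indicator (X - Y n) x \<partial>count_space X) < e) sequentially"
    using e by (intro order_tendstoD) simp_all
  then obtain n where "(\<integral>\<^sup>+x. s x * indicator (X - Y n) x \<partial>count_space X) < e"
    by (auto simp: eventually_sequentially)
  then show ?thesis using fin[of n] by (intro exI[of _ "Y n"]) (auto simp: Y_def)
qed

text \<open>Gluing of expansions. The functions \<open>a x i\<close>, \<open>i \<in> I\<close>, expand the piece \<open>P x h\<close>, with finite sums bounded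
  uniformly in \<open>x\<close> relative to the norm of \<open>P x h\<close>; applying \<open>P y\<close> to a finite sum of such functions
  selects the terms that belong to \<open>y\<close>.\<close>

lemma uncond_sum_glue:
  fixes P :: "'x \<Rightarrow> ('b \<Rightarrow> real) \<Rightarrow> 'b \<Rightarrow> real" and a :: "'x \<Rightarrow> 'i \<Rightarrow> 'b \<Rightarrow> real"
  assumes p: "p > 0" and X: "countable X"
    and lower: "0 < c" "\<And>f. f \<in> Lp p M \<Longrightarrow>
      ennreal c * lp_int p M f \<le> (\<integral>\<^sup>+x. lp_int p M (P x f) \<partial>count_space X)"
    and summ: "(\<integral>\<^sup>+x. lp_int p M (P x h) \<partial>count_space X) < \<infinity>"
    and h: "h \<in> Lp p M" and a: "\<And>x i. x \<in> X \<Longrightarrow> i \<in> I \<Longrightarrow> a x i \<in> Lp p M"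
    and comp: "\<And>y G. y \<in> X \<Longrightarrow> finite G \<Longrightarrow> G \<subseteq> X \<times> I \<Longrightarrow>
      lp_int p M (P y (\<lambda>t. h t - (\<Sum>(x, i)\<in>G. a x i t))) =
      lp_int p M (\<lambda>t. P y h t - (\<Sum>i\<in>{i. (y, i) \<in> G}. a y i t))"
    and conv: "\<And>y e. y \<in> X \<Longrightarrow> 0 < e \<Longrightarrow> \<exists>F. finite F \<and> F \<subseteq> I \<and> (\<forall>F'. finite F' \<and> F \<subseteq> F' \<and> F' \<subseteq> I \<longrightarrow>
      lp_int p M (\<lambda>t. P y h t - (\<Sum>i\<in>F'. a y i t)) \<le> ennreal e)"
    and D: "0 < D" and unif: "\<And>y F. y \<in> X \<Longrightarrow> finite F \<Longrightarrow> F \<subseteq> I \<Longrightarrow>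
      lp_int p M (\<lambda>t. P y h t - (\<Sum>i\<in>F. a y i t)) \<le> ennreal D * lp_int p M (P y h)"
  shows "uncond_sum (Lp_norm p M) (X \<times> I) (\<lambda>(x, i) t. a x i t) h"
  unfolding uncond_sum_Lp_iff[OF p]
proof (intro allI impI)
  fix e :: real assume e: "e > 0"
  \<comment> \<open>half of the admissible error \<open>c * e / 2\<close> is spent outside the finite set \<open>Y\<close> of pieces\<close>
  define e1 where "e1 = e * c / 4"
  have e1: "e1 > 0" unfolding e1_def using e lower by simp
  have "ennreal (e1 / D) > 0" using e1 D by simp
  from nn_integral_count_space_tail[OF X summ this]
  obtain Y where Y: "finite Y" "Y \<subseteq> X"
    "(\<integral>\<^sup>+x. lp_int p M (P x h) * indicator (X - Y) x \<partial>count_space X) < ennreal (e1 / D)" by blast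
  \<comment> \<open>the other half is distributed over \<open>Y\<close>; the summand \<open>1\<close> covers the case \<open>Y = {}\<close>\<close>
  define e2 where "e2 = e1 / (real (card Y) + 1)"
  have e2: "e2 > 0" unfolding e2_def using e1 by simp
  have "\<forall>y\<in>Y. \<exists>F. finite F \<and> F \<subseteq> I \<and> (\<forall>F'. finite F' \<and> F \<subseteq> F' \<and> F' \<subseteq> I \<longrightarrow>
      lp_int p M (\<lambda>t. P y h t - (\<Sum>i\<in>F'. a y i t)) \<le> ennreal e2)"
    using conv[OF _ e2] Y(2) by blast
  then obtain F where F: "\<And>y. y \<in> Y \<Longrightarrow> finite (F y)" "\<And>y. y \<in> Y \<Longrightarrow> F y \<subseteq> I"
    "\<And>y F'. y \<in> Y \<Longrightarrow> finite F' \<Longrightarrow> F y \<subseteq> F' \<Longrightarrow> F' \<subseteq> I \<Longrightarrow>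
      lp_int p M (\<lambda>t. P y h t - (\<Sum>i\<in>F'. a y i t)) \<le> ennreal e2" by metis
  define G0 where "G0 = Sigma Y F"
  show "\<exists>G0. finite G0 \<and> G0 \<subseteq> X \<times> I \<and> (\<forall>G. finite G \<and> G0 \<subseteq> G \<and> G \<subseteq> X \<times> I \<longrightarrow>
      lp_int p M (\<lambda>t. h t - (\<Sum>xi\<in>G. (case xi of (x, i) \<Rightarrow> \<lambda>t. a x i t) t)) < ennreal e)"
  proof (intro exI[of _ G0] conjI allI impI)
    show "finite G0" unfolding G0_def using Y F by auto
    show "G0 \<subseteq> X \<times> I" unfolding G0_def using Y F by auto
    fix G assume G: "finite G \<and> G0 \<subseteq> G \<and> G \<subseteq> X \<times> I"
    define R where "R t = h t - (\<Sum>(x, i)\<in>G. a x i t)" for t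
    have "(\<lambda>t. \<Sum>xi\<in>G. (case xi of (x, i) \<Rightarrow> a x i t)) \<in> Lp p M"
      using G a by (intro Lp_sum p) auto
    then have R: "R \<in> Lp p M"
      unfolding R_def using h by (intro Lp_diff p) auto
    have fG: "finite {i. (y, i) \<in> G}" "{i. (y, i) \<in> G} \<subseteq> I" for y
      using G finite_subset[of "{i. (y, i) \<in> G}" "snd ` G"] by force+
    have "lp_int p M (P y R) \<le> ennreal e2 * indicator Y y + ennreal D * (lp_int p M (P y h) * indicator (X - Y) y)"
      if y: "y \<in> X" for y
    proof (cases "y \<in> Y")
      case True
      then have "F y \<subseteq> {i. (y, i) \<in> G}" using G unfolding G0_def by auto
      from F(3)[OF True fG(1) this fG(2)] show ?thesis
        using comp[OF y, of G] G True unfolding R_def by simp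
    next
      case False
      then show ?thesis
        using unif[OF y fG] comp[OF y, of G] G y unfolding R_def by simp
    qed
    then have "(\<integral>\<^sup>+y. lp_int p M (P y R) \<partial>count_space X) \<le>
      (\<integral>\<^sup>+y. ennreal e2 * indicator Y y + ennreal D * (lp_int p M (P y h) * indicator (X - Y) y) \<partial>count_space X)"
      by (intro nn_integral_mono) simp
    also have "\<dots> = (\<integral>\<^sup>+y. ennreal e2 * indicator Y y \<partial>count_space X) +
        ennreal D * (\<integral>\<^sup>+y. lp_int p M (P y h) * indicator (X - Y) y \<partial>count_space X)"
      by (simp add: nn_integral_add nn_integral_cmult)
    also have "\<dots> \<le> ennreal e1 + ennreal e1"
    proof (rule add_mono)
      have "(\<integral>\<^sup>+y. ennreal e2 * indicator Y y \<partial>count_space X) = ennreal e2 * ennreal (real (card Y))"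
        using Y by (subst nn_integral_cmult_indicator)
          (auto simp: emeasure_count_space_finite ennreal_of_nat_eq_real_of_nat)
      also have "\<dots> \<le> ennreal e1"
        using e1 by (simp add: e2_def ennreal_mult[symmetric] field_simps)
      finally show "(\<integral>\<^sup>+y. ennreal e2 * indicator Y y \<partial>count_space X) \<le> ennreal e1" .
      have "ennreal D * (\<integral>\<^sup>+y. lp_int p M (P y h) * indicator (X - Y) y \<partial>count_space X) \<le>
          ennreal D * ennreal (e1 / D)"
        using Y(3) by (intro mult_left_mono) auto
      also have "\<dots> = ennreal e1" using D e1 by (simp add: ennreal_mult[symmetric])
      finally show "ennreal D * (\<integral>\<^sup>+y. lp_int p M (P y h) * indicator (X - Y) y \<partial>count_space X) \<le> ennreal e1" .
    qed
    also have "\<dots> = ennreal (e1 + e1)" using e1 by (subst ennreal_plus) auto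
    finally have "(\<integral>\<^sup>+y. lp_int p M (P y R) \<partial>count_space X) \<le> ennreal (e1 + e1)" .
    then have "ennreal c * lp_int p M R \<le> ennreal (c * (e / 2))"
      using order_trans[OF lower(2)[OF R]] unfolding e1_def by (simp add: field_simps)
    then have "ennreal c * lp_int p M R \<le> ennreal c * ennreal (e / 2)"
      using lower(1) e by (subst (asm) ennreal_mult) auto
    then have "lp_int p M R \<le> ennreal (e / 2)"
      using lower(1) by (subst (asm) ennreal_mult_le_mult_iff) auto
    also have "\<dots> < ennreal e" using e by (intro ennreal_lessI) auto
    finally show "lp_int p M (\<lambda>t. h t - (\<Sum>xi\<in>G. (case xi of (x, i) \<Rightarrow> \<lambda>t. a x i t) t)) < ennreal e"
      unfolding R_def by (simp add: case_prod_unfold)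
  qed
qed

section \<open>The global frame\<close>

text \<open>The local estimates with the coefficients expressed by the adjoint operator.\<close>

lemma (in localized_frame) finite_error:
  assumes h: "h \<in> Lp p \<nu>"
  defines "c \<equiv> \<lambda>i. \<integral>x. Pa (pushed q (W i)) x * h x \<partial>\<nu>"
  shows "0 < e \<Longrightarrow> \<exists>F. finite F \<and> F \<subseteq> I \<and> (\<forall>F'. finite F' \<and> F \<subseteq> F' \<and> F' \<subseteq> I \<longrightarrow>
      lp_int p \<nu> (\<lambda>x. P h x - (\<Sum>i\<in>F'. c i * P (pushed p (W i)) x)) \<le> ennreal e)"
    and "\<lbrakk>C > 0; \<forall>u\<in>Lp p lborel. ess_supp u \<subseteq> open_cube 1 \<longrightarrow> (\<forall>F K. finite F \<longrightarrow> F \<subseteq> I \<longrightarrow>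
       compact K \<longrightarrow> K \<subseteq> open_cube 1 \<longrightarrow>
       (\<integral>\<^sup>+x. ennreal (\<bar>psum u F x\<bar> powr p) * indicator K x \<partial>lborel) \<le> ennreal C * lp_int p lborel u);
       finite F; F \<subseteq> I\<rbrakk> \<Longrightarrow>
      lp_int p \<nu> (\<lambda>x. P h x - (\<Sum>i\<in>F. c i * P (pushed p (W i)) x)) \<le>
      ennreal (D * (2 powr p * (1 + C))) * lp_int p \<nu> (P h)"
proof -
  have c: "(\<Sum>i\<in>F. c i * P (pushed p (W i)) x) = (\<Sum>i\<in>F. coef (local_part h) i * P (pushed p (W i)) x)"
    if "F \<subseteq> I" for F x
    unfolding c_def using that coef_local_part[OF h] by (intro sum.cong refl) auto
  show "\<exists>F. finite F \<and> F \<subseteq> I \<and> (\<forall>F'. finite F' \<and> F \<subseteq> F' \<and> F' \<subseteq> I \<longrightarrow>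
      lp_int p \<nu> (\<lambda>x. P h x - (\<Sum>i\<in>F'. c i * P (pushed p (W i)) x)) \<le> ennreal e)" if "0 < e"
    using localized_convergence[OF h that] by (simp add: c cong: conj_cong)
  show "lp_int p \<nu> (\<lambda>x. P h x - (\<Sum>i\<in>F. c i * P (pushed p (W i)) x)) \<le>
      ennreal (D * (2 powr p * (1 + C))) * lp_int p \<nu> (P h)"
    if "C > 0" "\<forall>u\<in>Lp p lborel. ess_supp u \<subseteq> open_cube 1 \<longrightarrow> (\<forall>F K. finite F \<longrightarrow> F \<subseteq> I \<longrightarrow>
       compact K \<longrightarrow> K \<subseteq> open_cube 1 \<longrightarrow>
       (\<integral>\<^sup>+x. ennreal (\<bar>psum u F x\<bar> powr p) * indicator K x \<partial>lborel) \<le> ennreal C * lp_int p lborel u)"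
       and F: "finite F" "F \<subseteq> I"
    unfolding c[OF F(2)]
    by (rule localized_uniform_bound[OF h that(1) _ F])
      (rule that(2)[rule_format, OF local_part_Lp[OF h] ess_supp_local_part[OF h]])
qed

lemma open_cube_subset_ball:
  assumes "\<epsilon> < 1 / 2"
  shows "open_cube (1 + \<epsilon>) \<subseteq> ball (0 :: real^'d::finite) (3 * sqrt (real CARD('d)))"
proof
  fix x :: "real^'d" assume x: "x \<in> open_cube (1 + \<epsilon>)"
  have "norm (x $ i) \<le> 2" for i
  proof -
    have "- (1 + \<epsilon>) < x $ i" "x $ i < 1 + \<epsilon>" using x unfolding open_cube_def by blast+
    then show ?thesis using assms unfolding real_norm_def by linarith
  qed
  then have "norm x \<le> L2_set (\<lambda>_. 2) (UNIV :: 'd set)"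
    unfolding norm_vec_def by (intro L2_set_mono) auto
  also have "\<dots> = 2 * sqrt (real CARD('d))"
    by (simp add: L2_set_def real_sqrt_mult)
  also have "\<dots> < 3 * sqrt (real CARD('d))" by simp
  finally show "x \<in> ball 0 (3 * sqrt (real CARD('d)))" by simp
qed

lemma ball_subset_open_cube: "ball (0 :: real^'d::finite) 1 \<subseteq> open_cube 1"
proof
  fix x :: "real^'d" assume "x \<in> ball 0 1"
  then have "\<bar>x $ i\<bar> < 1" for i using component_le_norm_cart[of x i] by simp
  then show "x \<in> open_cube 1" unfolding open_cube_def by (simp add: abs_less_iff minus_less_iff)
qed

lemma lq_norm_Lp_norm:
  assumes "p > 0"
  shows "epowr (lq_norm (ennreal p) X (\<lambda>x. Lp_norm p M (f x))) p = (\<integral>\<^sup>+x. lp_int p M (f x) \<partial>count_space X)"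
  using assms by (simp add: lq_norm_def elp_norm_def epowr_Lp_norm epowr_epowr epowr_one)

text \<open>The equivalence of norms in a decomposition of identity, raised to the power \<open>p\<close>.\<close>

lemma smooth_decomposition_lp_int:
  assumes p: "p > 0" and sd: "smooth_decomposition A M p X \<Omega> P"
  shows "\<exists>c>0. \<exists>C>0. \<forall>f\<in>Lp p M.
    ennreal c * lp_int p M f \<le> (\<integral>\<^sup>+x. lp_int p M (P x f) \<partial>count_space X) \<and>
    (\<integral>\<^sup>+x. lp_int p M (P x f) \<partial>count_space X) \<le> ennreal C * lp_int p M f"
proof -
  have "\<exists>c C. 0 < c \<and> 0 < C \<and> (\<forall>f\<in>Lp p M.
        ennreal c * Lp_norm p M f \<le> lq_norm (ennreal p) X (\<lambda>x. Lp_norm p M (P x f)) \<and>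
        lq_norm (ennreal p) X (\<lambda>x. Lp_norm p M (P x f)) \<le> ennreal C * Lp_norm p M f)"
    using sd unfolding smooth_decomposition_def by (elim conjE)
  then obtain c C where cC: "0 < c" "0 < C" and b: "\<And>f. f \<in> Lp p M \<Longrightarrow>
        ennreal c * Lp_norm p M f \<le> lq_norm (ennreal p) X (\<lambda>x. Lp_norm p M (P x f)) \<and>
        lq_norm (ennreal p) X (\<lambda>x. Lp_norm p M (P x f)) \<le> ennreal C * Lp_norm p M f" by blast
  have "ennreal (c powr p) * lp_int p M f \<le> (\<integral>\<^sup>+x. lp_int p M (P x f) \<partial>count_space X) \<and>
    (\<integral>\<^sup>+x. lp_int p M (P x f) \<partial>count_space X) \<le> ennreal (C powr p) * lp_int p M f"
    if f: "f \<in> Lp p M" for f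
    using epowr_mono[OF less_imp_le[OF p] b[OF f, THEN conjunct1]]
      epowr_mono[OF less_imp_le[OF p] b[OF f, THEN conjunct2]] cC
    unfolding lq_norm_Lp_norm[OF p] by (simp add: epowr_cmult epowr_Lp_norm[OF p])
  then show ?thesis using cC by (intro exI[of _ "c powr p"] exI[of _ "C powr p"] conjI) auto
qed

theorem corollary5p8:
  fixes A :: "('a::{t2_space, second_countable_topology}, 'd::finite) chart set"
    and g :: "('a, 'd) metric"
    and \<nu> :: "'a measure"
    and p p' :: real
    and r :: "'a \<Rightarrow> real"
    and \<iota> :: "'a \<Rightarrow> ('a, 'd) tvec \<Rightarrow> real^'d"
    and X :: "'a set"
    and P Padj :: "'a \<Rightarrow> ('a \<Rightarrow> real) \<Rightarrow> 'a \<Rightarrow> real"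
    and m :: enat and j0 l :: nat and \<epsilon> :: real
    and \<Gamma> :: "nat \<Rightarrow> (int^'d) set"
    and W :: "'d wavelet_index \<Rightarrow> real^'d \<Rightarrow> real"
  assumes "connected (UNIV :: 'a set)"
    and "riemannian_manifold A g"
    and "riemannian_measure A g \<nu>"
    and "1 < p" and "1 / p + 1 / p' = 1"
    and "m \<ge> 1" and "0 < \<epsilon>" and "\<epsilon> < 1 / 2"
    and "local_Parseval_frame m j0 \<epsilon> l \<Gamma> W"
    and "\<And>x. tangent_isometry A g x (\<iota> x)"
    and "\<And>x. exp_diffeo_ball A g x (r x) (\<iota> x)"
    and "smooth_decomposition A \<nu> p X
           (\<lambda>x. geodesic_ball A g x (r x / (3 * sqrt (real CARD('d))))) P"
    and "\<And>x. x \<in> X \<Longrightarrow> Lp_adjoint p p' \<nu> (P x) (Padj x)"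
  shows "unconditional_frame_Lp p p' \<nu> (X \<times> frame_indices j0 \<Gamma>)
           (\<lambda>(x, i). P x (transport A g p x (r x) (\<iota> x) (W i)))
           (\<lambda>(x, i). Padj x (transport A g p' x (r x) (\<iota> x) (W i)))"
proof -
  note rm = assms(2) and nu = assms(3) and pq = assms(4,5) and iso = assms(10) and sd = assms(12)
    and adj = assms(13)
  have p: "p > 0" and p': "p' > 0" using pq conjugate_exponent_gt_1[OF pq] by auto
  let ?I = "frame_indices j0 \<Gamma>" and ?R = "3 * sqrt (real CARD('d))"
  let ?\<Omega> = "\<lambda>x. geodesic_ball A g x (r x / ?R)"
  let ?T = "\<lambda>s x. transport A g s x (r x) (\<iota> x)"
  interpret local_frame m j0 l \<epsilon> \<Gamma> W
    by unfold_locales (fact assms)+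
  have nb: "normal_ball A g x (r x) (\<iota> x)" for x
    by unfold_locales (fact assms)+
  have X: "countable X" using sd unfolding smooth_decomposition_def by (elim conjE)
  have P: "P x \<in> H_ops_on A (?\<Omega> x)" "Lp_projection p \<nu> (P x)" if "x \<in> X" for x
  proof -
    have "\<forall>x\<in>X. P x \<in> H_ops_on A (?\<Omega> x) \<and> Lp_projection p \<nu> (P x)"
      using sd unfolding smooth_decomposition_def by (elim conjE)
    then show "P x \<in> H_ops_on A (?\<Omega> x)" "Lp_projection p \<nu> (P x)" using that by auto
  qed
  have orth: "Lp_zero_op p \<nu> (\<lambda>f. P x (P y f))" if "x \<in> X" "y \<in> X" "x \<noteq> y" for x y
  proof -
    have "\<forall>x\<in>X. \<forall>y\<in>X. x \<noteq> y \<longrightarrow> Lp_zero_op p \<nu> (\<lambda>f. P x (P y f))"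
      using sd unfolding smooth_decomposition_def by (elim conjE)
    then show ?thesis using that by simp
  qed
  obtain c D where c: "c > 0" and D: "D > 0"
    and lower: "\<And>f. f \<in> Lp p \<nu> \<Longrightarrow> ennreal c * lp_int p \<nu> f \<le> (\<integral>\<^sup>+x. lp_int p \<nu> (P x f) \<partial>count_space X)"
    and upper: "\<And>f. f \<in> Lp p \<nu> \<Longrightarrow> (\<integral>\<^sup>+x. lp_int p \<nu> (P x f) \<partial>count_space X) \<le> ennreal D * lp_int p \<nu> f"
    using smooth_decomposition_lp_int[OF p sd] by blast
  \<comment> \<open>the norms of the projections are bounded uniformly, each being one term of the series\<close>
  have P_bound: "lp_int p \<nu> (P x f) \<le> ennreal D * lp_int p \<nu> f" if "x \<in> X" "f \<in> Lp p \<nu>" for x f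
    using nn_integral_ge_point[OF that(1), of "\<lambda>x. lp_int p \<nu> (P x f)"] upper[OF that(2)]
    by (rule order_trans)
  obtain C where C: "C > 0" and C_bound: "\<forall>u\<in>Lp p lborel. ess_supp u \<subseteq> open_cube 1 \<longrightarrow>
     (\<forall>F K. finite F \<longrightarrow> F \<subseteq> ?I \<longrightarrow> compact K \<longrightarrow> K \<subseteq> open_cube 1 \<longrightarrow>
     (\<integral>\<^sup>+x. ennreal (\<bar>psum u F x\<bar> powr p) * indicator K x \<partial>lborel) \<le> ennreal C * lp_int p lborel u)"
    using psum_uniform_bound[OF pq] by blast
  let ?U = "\<lambda>x. geodesic_ball A g x (r x)"
  let ?\<theta> = "\<lambda>x. normal_ball.\<theta> A g x (r x) (\<iota> x)"
  let ?\<psi> = "\<lambda>x. normal_ball.\<psi> A g x (r x) (\<iota> x)"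
  let ?J = "\<lambda>x. normal_ball.Jac A g x (r x) (\<iota> x)"
  have "\<exists>K. localized_frame \<nu> (?U x) (ball 0 ?R) (?\<theta> x) (?\<psi> x) (?J x) m j0 l \<epsilon> \<Gamma> W p p' D (P x) (Padj x) K"
    if x: "x \<in> X" for x
  proof -
    interpret normal_ball A g x "r x" "\<iota> x" by (rule nb)
    interpret scaled_chart \<nu> "?U x" "ball 0 ?R" "?\<theta> x" "?\<psi> x" "?J x"
      by (rule scaled_chart[OF nu iso])
    obtain K where K: "compact K" "K \<subseteq> ?\<Omega> x" "\<forall>f y. y \<notin> K \<longrightarrow> P x f y = 0"
      "\<forall>f f'. (\<forall>y\<in>K. f y = f' y) \<longrightarrow> P x f = P x f'"
      using H_ops_on_props(2)[OF P(1)[OF x]] by blast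
    have "K \<subseteq> ?U x" using K(2) small_ball_subset by (rule order_trans)
    moreover have "?\<theta> x ` K \<subseteq> open_cube 1"
      using image_mono[OF K(2), of "?\<theta> x"] theta_image_ball ball_subset_open_cube by auto
    ultimately have "localized_frame \<nu> (?U x) (ball 0 ?R) (?\<theta> x) (?\<psi> x) (?J x) m j0 l \<epsilon> \<Gamma> W p p' D (P x) (Padj x) K"
      using K H_ops_on_props(1)[OF P(1)[OF x]] P(2)[OF x] adj[OF x] P_bound[OF x] pq D
        open_cube_subset_ball[OF assms(8)]
      by unfold_locales simp_all
    then show ?thesis by blast
  qed
  then obtain K where lf: "\<And>x. x \<in> X \<Longrightarrow>
      localized_frame \<nu> (?U x) (ball 0 ?R) (?\<theta> x) (?\<psi> x) (?J x) m j0 l \<epsilon> \<Gamma> W p p' D (P x) (Padj x) (K x)"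
    by metis
  have T: "scaled_chart.pushed (?U x) (?\<theta> x) (?J x) s = ?T s x" if "s > 0" for s x
  proof
    show "scaled_chart.pushed (?U x) (?\<theta> x) (?J x) s f = ?T s x f" for f
      by (rule normal_ball.transport_eq_pushed[OF nb nu iso that, symmetric])
  qed
  have T_Lp: "?T s x (W i) \<in> Lp s \<nu>" if "x \<in> X" "i \<in> ?I" "s > 0" for s x i
    using localized_frame.pushed_W_Lp[OF lf[OF that(1)] that(3,2)] unfolding T[OF that(3)] .
  have PT_Lp: "P x (?T p x (W i)) \<in> Lp p \<nu>" if "x \<in> X" "i \<in> ?I" for x i
    by (rule localized_frame.P_Lp[OF lf[OF that(1)] T_Lp[OF that p]])
  have "uncond_sum (Lp_norm p \<nu>) (X \<times> ?I)
      (\<lambda>(x, i) t. (\<integral>u. Padj x (?T p' x (W i)) u * h u \<partial>\<nu>) * P x (?T p x (W i)) t) h"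
    if h: "h \<in> Lp p \<nu>" for h
  proof (rule uncond_sum_glue[OF p X c lower _ h])
    let ?c = "\<lambda>x i. \<integral>u. Padj x (?T p' x (W i)) u * h u \<partial>\<nu>"
    show "(\<integral>\<^sup>+x. lp_int p \<nu> (P x h) \<partial>count_space X) < \<infinity>"
      using upper[OF h] h p by (auto simp: Lp_iff ennreal_mult_less_top intro: le_less_trans)
    show "(\<lambda>t. ?c x i * P x (?T p x (W i)) t) \<in> Lp p \<nu>" if "x \<in> X" "i \<in> ?I" for x i
      by (rule Lp_cmult[OF p PT_Lp[OF that]])
    show "D * (2 powr p * (1 + C)) > 0" using C D by (intro mult_pos_pos) auto
    fix y assume y: "y \<in> X"
    note L = localized_frame.finite_error[OF lf[OF y] h, unfolded T[OF p] T[OF p']]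
    show "\<exists>F. finite F \<and> F \<subseteq> ?I \<and> (\<forall>F'. finite F' \<and> F \<subseteq> F' \<and> F' \<subseteq> ?I \<longrightarrow>
        lp_int p \<nu> (\<lambda>t. P y h t - (\<Sum>i\<in>F'. ?c y i * P y (?T p y (W i)) t)) \<le> ennreal e)" if "0 < e" for e
      by (rule L(1)[OF that])
    show "lp_int p \<nu> (\<lambda>t. P y h t - (\<Sum>i\<in>F. ?c y i * P y (?T p y (W i)) t)) \<le>
        ennreal (D * (2 powr p * (1 + C))) * lp_int p \<nu> (P y h)" if "finite F" "F \<subseteq> ?I" for F
      by (rule L(2)[OF C C_bound that])
    fix G assume G: "finite G" "G \<subseteq> X \<times> ?I"
    have "AE t in \<nu>. P y (P (fst xi) (?T p (fst xi) (W (snd xi)))) t =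
        (if fst xi = y then P y (?T p y (W (snd xi))) t else 0)" if "xi \<in> G" for xi
    proof -
      have xi: "fst xi \<in> X" "snd xi \<in> ?I" using that G(2) by auto
      show ?thesis
      proof (cases "fst xi = y")
        case True
        then show ?thesis
          using localized_frame.P_idem[OF lf[OF y] T_Lp[OF y xi(2) p]] by simp
      next
        case False
        then show ?thesis
          using orth[OF y xi(1)] T_Lp[OF xi p] unfolding Lp_zero_op_def by auto
      qed
    qed
    then have "AE t in \<nu>. \<forall>xi\<in>G. P y (P (fst xi) (?T p (fst xi) (W (snd xi)))) t =
        (if fst xi = y then P y (?T p y (W (snd xi))) t else 0)"
      using G(1) by (simp add: AE_finite_all)
    then have "AE t in \<nu>. P y (\<lambda>t. h t - (\<Sum>(x, i)\<in>G. ?c x i * P x (?T p x (W i)) t)) t =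
        P y h t - (\<Sum>i\<in>{i. (y, i) \<in> G}. ?c y i * P y (?T p y (W i)) t)"
    proof (rule AE_mp, intro AE_I2 impI)
      fix t assume t: "\<forall>xi\<in>G. P y (P (fst xi) (?T p (fst xi) (W (snd xi)))) t =
        (if fst xi = y then P y (?T p y (W (snd xi))) t else 0)"
      have "P y (\<lambda>t. h t - (\<Sum>(x, i)\<in>G. ?c x i * P x (?T p x (W i)) t)) t =
        P y h t - (\<Sum>xi\<in>G. ?c (fst xi) (snd xi) * P y (P (fst xi) (?T p (fst xi) (W (snd xi)))) t)"
        unfolding localized_frame.P_diff[OF lf[OF y]] case_prod_unfold
        by (subst localized_frame.P_sum[OF lf[OF y] G(1)]) (rule refl)
      also have "(\<Sum>xi\<in>G. ?c (fst xi) (snd xi) * P y (P (fst xi) (?T p (fst xi) (W (snd xi)))) t) =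
        (\<Sum>xi\<in>G. if fst xi = y then ?c y (snd xi) * P y (?T p y (W (snd xi))) t else 0)"
        using t by (intro sum.cong refl) auto
      also have "\<dots> = (\<Sum>xi\<in>{xi\<in>G. fst xi = y}. ?c y (snd xi) * P y (?T p y (W (snd xi))) t)"
        by (rule sum.inter_filter[OF G(1), symmetric])
      also have "\<dots> = (\<Sum>i\<in>{i. (y, i) \<in> G}. ?c y i * P y (?T p y (W i)) t)"
        by (rule sum.reindex_bij_witness[of _ "Pair y" snd]) auto
      finally show "P y (\<lambda>t. h t - (\<Sum>(x, i)\<in>G. ?c x i * P x (?T p x (W i)) t)) t =
        P y h t - (\<Sum>i\<in>{i. (y, i) \<in> G}. ?c y i * P y (?T p y (W i)) t)" .
    qed
    then show "lp_int p \<nu> (P y (\<lambda>t. h t - (\<Sum>(x, i)\<in>G. ?c x i * P x (?T p x (W i)) t))) =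
        lp_int p \<nu> (\<lambda>t. P y h t - (\<Sum>i\<in>{i. (y, i) \<in> G}. ?c y i * P y (?T p y (W i)) t))"
      by (rule lp_int_cong_AE)
  qed
  moreover have "Padj x (?T p' x (W i)) \<in> Lp p' \<nu>" if "x \<in> X" "i \<in> ?I" for x i
    using adj[OF that(1)] T_Lp[OF that p'] unfolding Lp_adjoint_def by blast
  moreover have "countable (X \<times> ?I)"
    by (rule countable_SIGMA[OF X countableI_type])
  ultimately show ?thesis
    unfolding unconditional_frame_Lp_def using PT_Lp by (auto simp: case_prod_unfold)
qed

end
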